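(* Let $b^2>a^2>0$, $\theta\in[0,1]$, $s\ge0$, $m\in[1,2)$, and let $u=(u^{(1)},u^{(2)},u^{(3)})^{\mathrm T}$ solve $$u_{tt}-a^2\Delta u-(b^2-a^2)\nabla\operatorname{div}u+(-\Delta)^{\theta}u_t=0\ \text{ on }(0,\infty)\times\mathbb{R}^3,\qquad (u,u_t)(0,\cdot)=(u_0,u_1),$$ with $(u_0^{(k)},u_1^{(k)})\in(\dot H^{s+1}\cap L^m)\times(\dot H^s\cap L^m)$ for $k=1,2,3$. Then for $k=1,2,3$ and $t\ge0$, $$\|u^{(k)}(t,\cdot)\|_{L^2}\lesssim d_{0,m}(t)\sum_{j=1}^3\|(u_0^{(j)},u_1^{(j)})\|_{(\dot H^1\cap L^m)\times(L^2\cap L^m)},$$ $$\||D|^{s+1}u^{(k)}(t,\cdot)\|_{L^2}+\||D|^su^{(k)}_t(t,\cdot)\|_{L^2}\lesssim d_{s+1,m}(t)\sum_{j=1}^3\|(u_0^{(j)},u_1^{(j)})\|_{(\dot H^{s+1}\cap L^m)\times(\dot H^s\cap L^m)}.$$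
   Context: $(-\Delta)^\theta$, $|D|^s$ are the Fourier multipliers with symbols $|\xi|^{2\theta}$, $|\xi|^s$; norms of intersections/products are sums of the norms. The decay functions are $d_{0,m}(t)=(1+t)^{-\rho_0(m,\theta)}$ if $\theta\in[0,1/2)$, $m\in[1,6/5)$; $d_{0,m}(t)=(1+t)^{1-\rho_1(m,\theta)}$ if $\theta\in[0,1/2)$, $m\in[6/5,2)$; $d_{0,m}(t)=(1+t)^{-\frac{6-5m}{4m\theta}}$ if $\theta\in[1/2,1]$, $m\in[1,6/5)$; $d_{0,m}(t)=(1+t)^{1-\frac{6-3m}{4m\theta}}$ if $\theta\in[1/2,1]$, $m\in[6/5,2)$; $d_{s+1,m}(t)=(1+t)^{-\rho_{s+1}(m,\theta)}$ if $\theta\in[0,1/2)$ and $d_{s+1,m}(t)=(1+t)^{-\frac{6-3m+2sm}{4m\theta}}$ if $\theta\in[1/2,1]$, where $\rho_0(m,\theta)<\min\{\frac{6-5m+2m(1-2\theta)}{4m(1-\theta)};\frac{6-5m}{4m\theta}\}$, $\rho_1(m,\theta)<\min\{\frac{6-3m+2m(1-2\theta)}{4m(1-\theta)};\frac{6-3m}{4m\theta}\}$, $\rho_{s+1}(m,\theta)<\min\{\frac{6-3m+2sm+2m(1-2\theta)}{4m(1-\theta)};\frac{6-3m+2sm}{4m\theta}\}$ are arbitrary constants (terms with $\theta=0$ in the denominator read as $+\infty$). $\lesssim$ hides a constant independent of $t$ and data. *)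

theory Defs
  imports "HOL-Analysis.Analysis"
begin

definition ft1 :: "(real^3 \<Rightarrow> complex) \<Rightarrow> real^3 \<Rightarrow> complex" where
  "ft1 g x = (\<integral>\<xi>. g \<xi> * cis (- (x \<bullet> \<xi>)) \<partial>lborel)"

definition gauss :: "real^3 \<Rightarrow> real \<Rightarrow> real^3 \<Rightarrow> real" where
  "gauss \<eta> \<sigma> \<xi> = exp (- (norm (\<xi> - \<eta>))\<^sup>2 / \<sigma>)"

text \<open>F is the (distributional) Fourier transform of f: the identity
  integral F phi = integral f hat(phi) holds for all Gaussian test functions phi,
  which form a determining family for locally integrable F.\<close>
definition is_FT :: "(real^3 \<Rightarrow> real) \<Rightarrow> (real^3 \<Rightarrow> complex) \<Rightarrow> bool" where
  "is_FT f F \<longleftrightarrow> F \<in> borel_measurable lborel \<and>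
     (\<forall>\<eta> \<sigma>. \<sigma> > 0 \<longrightarrow>
        integrable lborel (\<lambda>\<xi>. F \<xi> * complex_of_real (gauss \<eta> \<sigma> \<xi>)) \<and>
        integrable lborel (\<lambda>x. complex_of_real (f x) * ft1 (\<lambda>\<xi>. complex_of_real (gauss \<eta> \<sigma> \<xi>)) x) \<and>
        (\<integral>\<xi>. F \<xi> * complex_of_real (gauss \<eta> \<sigma> \<xi>) \<partial>lborel) =
        (\<integral>x. complex_of_real (f x) * ft1 (\<lambda>\<xi>. complex_of_real (gauss \<eta> \<sigma> \<xi>)) x \<partial>lborel))"

definition memLp :: "real \<Rightarrow> (real^3 \<Rightarrow> real) \<Rightarrow> bool" where
  "memLp p f \<longleftrightarrow> f \<in> borel_measurable lborel \<and> integrable lborel (\<lambda>x. \<bar>f x\<bar> powr p)"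

definition Lp_norm :: "real \<Rightarrow> (real^3 \<Rightarrow> real) \<Rightarrow> real" where
  "Lp_norm p f = (\<integral>x. \<bar>f x\<bar> powr p \<partial>lborel) powr (1 / p)"

text \<open>Homogeneous Sobolev space via the Fourier transform F of the function:
  || |D|^s f ||_{L^2} = (2 pi)^{-3/2} || |xi|^s F ||_{L^2} (Plancherel).\<close>
definition memHdot :: "real \<Rightarrow> (real^3 \<Rightarrow> complex) \<Rightarrow> bool" where
  "memHdot s F \<longleftrightarrow> integrable lborel (\<lambda>\<xi>. norm \<xi> powr (2 * s) * (cmod (F \<xi>))\<^sup>2)"

definition Hdot_norm :: "real \<Rightarrow> (real^3 \<Rightarrow> complex) \<Rightarrow> real" where
  "Hdot_norm s F = sqrt (\<integral>\<xi>. norm \<xi> powr (2 * s) * (cmod (F \<xi>))\<^sup>2 \<partial>lborel) / (2 * pi) powr (3 / 2)"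

text \<open>Admissibility of the arbitrary constants rho: with n = 6 - 3m + 2 sigma m,
  rho < min{ (n + 2m(1-2 theta)) / (4m(1-theta)) ; n / (4 m theta) },
  the second term being +infinity for theta = 0.
  rho_0: sigma = -1; rho_1: sigma = 0; rho_{s+1}: sigma = s.\<close>
definition rho_ok :: "real \<Rightarrow> real \<Rightarrow> real \<Rightarrow> real \<Rightarrow> bool" where
  "rho_ok \<theta> m \<sigma> \<rho> \<longleftrightarrow>
     \<rho> < (6 - 3*m + 2*\<sigma>*m + 2*m*(1 - 2*\<theta>)) / (4*m*(1 - \<theta>)) \<and>
     (\<theta> = 0 \<or> \<rho> < (6 - 3*m + 2*\<sigma>*m) / (4*m*\<theta>))"

definition d0 :: "real \<Rightarrow> real \<Rightarrow> real \<Rightarrow> real \<Rightarrow> real \<Rightarrow> real" where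
  "d0 \<theta> m \<rho>0 \<rho>1 t =
     (if \<theta> < 1/2 then
        (if m < 6/5 then (1 + t) powr (- \<rho>0) else (1 + t) powr (1 - \<rho>1))
      else
        (if m < 6/5 then (1 + t) powr (- ((6 - 5*m) / (4*m*\<theta>)))
         else (1 + t) powr (1 - (6 - 3*m) / (4*m*\<theta>))))"

definition dS :: "real \<Rightarrow> real \<Rightarrow> real \<Rightarrow> real \<Rightarrow> real \<Rightarrow> real" where
  "dS \<theta> m \<sigma> \<rho>s t =
     (if \<theta> < 1/2 then (1 + t) powr (- \<rho>s)
      else (1 + t) powr (- ((6 - 3*m + 2*\<sigma>*m) / (4*m*\<theta>))))"

text \<open>Right-hand side of the Fourier-transformed system
  U_tt = -(a^2|xi|^2 U + (b^2-a^2) xi (xi.U) + |xi|^{2 theta} U_t).\<close>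
definition lame_rhs :: "real \<Rightarrow> real \<Rightarrow> real \<Rightarrow> real^3 \<Rightarrow> complex^3 \<Rightarrow> complex^3 \<Rightarrow> complex^3" where
  "lame_rhs a b \<theta> \<xi> U V = (\<chi> k.
     - (complex_of_real (a\<^sup>2 * (norm \<xi>)\<^sup>2) * U $ k
        + complex_of_real ((b\<^sup>2 - a\<^sup>2) * \<xi> $ k) * (\<Sum>j\<in>UNIV. complex_of_real (\<xi> $ j) * U $ j)
        + complex_of_real (norm \<xi> powr (2 * \<theta>)) * V $ k))"

end

theory Submission
  imports Defs "HOL-Probability.Characteristic_Functions"
begin

text \<open>On the Fourier side the system is, for every frequency, an ordinary differential equation
  \<open>U'' + p U' + A U = 0\<close> with \<open>p = |\<xi>| ^ (2 \<theta>)\<close> and \<open>A\<close> comparable to \<open>|\<xi>| ^ 2\<close>. Its solutions decay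
  at the rate \<open>min p (|\<xi>| ^ 2 / p)\<close>; this follows from Lyapunov functionals and needs no
  diagonalisation of \<open>A\<close>. For \<open>|\<xi>| \<ge> 1\<close> the rate is at least \<open>1\<close>, so only frequencies
  \<open>|\<xi>| \<le> 1\<close> limit the decay, and there the \<open>L\<^sup>m\<close> norm of the data enters through
  \<open>\<integral>\<^bsub>|\<xi>| \<le> R\<^esub> |F|\<^sup>2 \<lesssim> R ^ (6 / m - 3) * \<parallel>f\<parallel>\<^sub>m\<^sup>2\<close>, a substitute for Hausdorff-Young that is summed
  over dyadic shells. This inequality and Plancherel's theorem are obtained from the Parseval
  identity for Gaussian weights, since testing against Gaussians says that the convolution of \<open>F\<close>
  with a Gaussian is the classical transform of \<open>f\<close> times a Gaussian.\<close>

section \<open>Gaussians and their Fourier transforms\<close>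


text \<open>\<open>is_FT\<close> sees \<open>F\<close> only through Gaussian averages and does not
  make it square integrable. Each L^2 bound is therefore produced by duality: pair with a bounded
  continuous function, smooth by Gaussians whose width tends to 0, and estimate the smoothed side
  classically. Constants may be lost, so crude splittings can stand in for interpolation and for the
  exact Plancherel identity. The decay functions have three sources. By the bound on balls, |F|^2
  carries \<open>q = 6 / m - 3\<close> powers of |\<xi>| near the origin. For \<theta> >= 1/2 the
  velocity datum enters the displacement with the factor 1 / |\<xi>|; the square of that factor is
  summable over dyadic shells when q > 2, that is m < 6/5, and otherwise a factor
  \<open>1 + t\<close> is paid. For \<theta> < 1/2 the low frequency energy has a fast part, damped
  by exp(-|\<xi>|^(2\<theta>) t), and a slow part, damped at the rate |\<xi>|^(2-2\<theta>) but with
  a gain |\<xi>|^(1-2\<theta>) in the norm; their decay exponents are the two quotients in the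
  minimum that defines \<rho>.\<close>

lemma nn_integral_lborel_affine:
  fixes c :: real and t :: "'a::euclidean_space"
  assumes [measurable]: "f \<in> borel_measurable borel" and c: "c \<noteq> 0"
  shows "(\<integral>\<^sup>+x. f x \<partial>lborel) = ennreal (\<bar>c\<bar> ^ DIM('a)) * (\<integral>\<^sup>+x. f (t + c *\<^sub>R x) \<partial>lborel)"
  by (subst lborel_affine[OF c, of t])
     (simp add: nn_integral_density nn_integral_distr nn_integral_cmult)

lemma integrable_lborel_affine:
  fixes f :: "'a::euclidean_space \<Rightarrow> 'b::{banach, second_countable_topology}"
  assumes f: "integrable lborel f" and c: "c \<noteq> 0"
  shows "integrable lborel (\<lambda>x. f (t + c *\<^sub>R x))"
proof -
  have [measurable]: "f \<in> borel_measurable borel"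
    using f by auto
  have "(\<integral>\<^sup>+x. norm (f x) \<partial>lborel) = ennreal (\<bar>c\<bar> ^ DIM('a)) * (\<integral>\<^sup>+x. norm (f (t + c *\<^sub>R x)) \<partial>lborel)"
    using c by (intro nn_integral_lborel_affine) auto
  moreover have "(\<integral>\<^sup>+x. norm (f x) \<partial>lborel) < \<infinity>"
    using f by (simp add: integrable_iff_bounded)
  ultimately show ?thesis
    using c unfolding integrable_iff_bounded by (auto simp: ennreal_mult_less_top)
qed

lemma integrable_lborel_affine_iff:
  fixes f :: "'a::euclidean_space \<Rightarrow> 'b::{banach, second_countable_topology}"
  assumes c: "c \<noteq> 0"
  shows "integrable lborel (\<lambda>x. f (t + c *\<^sub>R x)) \<longleftrightarrow> integrable lborel f"
  using integrable_lborel_affine[of f c t] c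
    integrable_lborel_affine[of "\<lambda>x. f (t + c *\<^sub>R x)" "1/c" "- (1/c) *\<^sub>R t"]
  by (auto simp: algebra_simps)

lemma integral_lborel_affine:
  fixes f :: "'a::euclidean_space \<Rightarrow> 'b::{banach, second_countable_topology}"
  assumes c: "c \<noteq> 0"
  shows "(\<integral>x. f x \<partial>lborel) = (\<bar>c\<bar> ^ DIM('a)) *\<^sub>R (\<integral>x. f (t + c *\<^sub>R x) \<partial>lborel)"
proof (cases "integrable lborel f")
  case f[measurable]: True
  show ?thesis
    using f f[THEN borel_measurable_integrable] integrable_lborel_affine[OF f c, of t]
    by (subst lborel_affine[OF c, of t]) (simp add: integral_density integral_distr)
next
  case False
  then show ?thesis
    using c by (simp add: integrable_lborel_affine_iff not_integrable_integral_eq)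
qed

text \<open>A dilation of the known characteristic function of the standard normal law.\<close>

lemma gaussian_fourier_real:
  fixes \<sigma> x :: real
  assumes \<sigma>: "0 < \<sigma>"
  shows "integrable lborel (\<lambda>y. complex_of_real (exp (- y\<^sup>2 / \<sigma>)) * cis (- (x * y)))"
    and "(\<integral>y. complex_of_real (exp (- y\<^sup>2 / \<sigma>)) * cis (- (x * y)) \<partial>lborel) =
         complex_of_real (sqrt (pi * \<sigma>) * exp (- \<sigma> * x\<^sup>2 / 4))"
proof -
  \<comment> \<open>With this dilation (c y)^2 / 2 = y^2 / \<sigma>.\<close>
  define c where "c = sqrt (2 / \<sigma>)"
  have c: "c > 0" "c\<^sup>2 = 2 / \<sigma>" using \<sigma> by (auto simp: c_def)
  define g where "g = (\<lambda>y. std_normal_density y *\<^sub>R iexp ((- x / c) * y))"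
  have gi: "integrable lborel g"
  proof (rule Bochner_Integration.integrable_bound[where f="std_normal_density"])
    show "integrable lborel std_normal_density"
      by (rule integrable_normal_density) simp
  qed (auto simp: g_def)
  have "char std_normal_distribution (- x / c) = (\<integral>y. g y \<partial>lborel)"
    unfolding char_def g_def
    by (subst integral_density) auto
  then have gI: "(\<integral>y. g y \<partial>lborel) = complex_of_real (exp (- ((- x / c)\<^sup>2) / 2))"
    by (simp add: char_std_normal_distribution)
  have gc: "g (0 + c * y) = complex_of_real (1 / sqrt (2 * pi)) *
      (complex_of_real (exp (- y\<^sup>2 / \<sigma>)) * cis (- (x * y)))" for y
    using c by (simp add: g_def std_normal_density_def power_mult_distrib cis_conv_exp scaleR_conv_of_real)
  have 1: "integrable lborel (\<lambda>y. g (0 + c * y))"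
    using gi c by (intro lborel_integrable_real_affine) auto
  then show i: "integrable lborel (\<lambda>y. complex_of_real (exp (- y\<^sup>2 / \<sigma>)) * cis (- (x * y)))"
  proof -
    have "(\<lambda>y. complex_of_real (exp (- y\<^sup>2 / \<sigma>)) * cis (- (x * y))) = (\<lambda>y. complex_of_real (sqrt (2 * pi)) * g (0 + c * y))"
      by (rule ext, unfold gc) simp
    with 1 show ?thesis by simp
  qed
  have "(\<integral>y. g y \<partial>lborel) = c *\<^sub>R (\<integral>y. g (0 + c * y) \<partial>lborel)"
    using lborel_integral_real_affine[of c g 0] c by simp
  also have "\<dots> = complex_of_real (c / sqrt (2 * pi)) *
      (\<integral>y. complex_of_real (exp (- y\<^sup>2 / \<sigma>)) * cis (- (x * y)) \<partial>lborel)"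
    unfolding gc by (simp add: scaleR_conv_of_real)
  finally have "(\<integral>y. complex_of_real (exp (- y\<^sup>2 / \<sigma>)) * cis (- (x * y)) \<partial>lborel) =
      complex_of_real (sqrt (2 * pi) / c) * complex_of_real (exp (- ((- x / c)\<^sup>2) / 2))"
    using c gI by (simp add: field_simps)
  also have "sqrt (2 * pi) / c = sqrt (pi * \<sigma>)"
    using \<sigma> by (simp add: c_def real_sqrt_divide real_sqrt_mult field_simps)
  also have "- ((- x / c)\<^sup>2) / 2 = - \<sigma> * x\<^sup>2 / 4"
    using c \<sigma> by (simp add: power_divide field_simps)
  finally show "(\<integral>y. complex_of_real (exp (- y\<^sup>2 / \<sigma>)) * cis (- (x * y)) \<partial>lborel) =
         complex_of_real (sqrt (pi * \<sigma>) * exp (- \<sigma> * x\<^sup>2 / 4))" by simp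
qed

lemma cis_sum: "finite A \<Longrightarrow> cis (\<Sum>a\<in>A. f a) = (\<Prod>a\<in>A. cis (f a))"
  by (induction A rule: finite_induct) (auto simp: cis_mult[symmetric])

text \<open>The integrand factorises over the coordinates, and \<open>lborel\<close> is the image of
  a product measure, so the one-dimensional formula applies factor by factor.\<close>

lemma gaussian_fourier:
  fixes \<sigma> :: real and x :: "'a::euclidean_space"
  assumes \<sigma>: "0 < \<sigma>"
  shows "integrable lborel (\<lambda>y. complex_of_real (exp (- (norm y)\<^sup>2 / \<sigma>)) * cis (- (x \<bullet> y)))"
    and "(\<integral>y. complex_of_real (exp (- (norm y)\<^sup>2 / \<sigma>)) * cis (- (x \<bullet> y)) \<partial>lborel) =
         complex_of_real (sqrt (pi * \<sigma>) ^ DIM('a) * exp (- \<sigma> * (norm x)\<^sup>2 / 4))"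
proof -
  interpret product_sigma_finite "\<lambda>b::'a. lborel :: real measure" ..
  define f where "f = (\<lambda>b y. complex_of_real (exp (- y\<^sup>2 / \<sigma>)) * cis (- ((x \<bullet> b) * y)))"
  define G where "G = (\<lambda>y::'a. complex_of_real (exp (- (norm y)\<^sup>2 / \<sigma>)) * cis (- (x \<bullet> y)))"
  have [measurable]: "G \<in> borel_measurable borel"
    unfolding G_def cis_conv_exp by measurable
  have G: "G y = (\<Prod>b\<in>Basis. f b (y \<bullet> b))" for y
  proof -
    have 1: "x \<bullet> y = (\<Sum>b\<in>Basis. (x \<bullet> b) * (y \<bullet> b))" by (rule euclidean_inner)
    have "(norm y)\<^sup>2 = (\<Sum>b\<in>Basis. (y \<bullet> b)\<^sup>2)"
      by (subst euclidean_inner[of y y, folded power2_norm_eq_inner]) (simp add: power2_eq_square)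
    then have 2: "- (norm y)\<^sup>2 / \<sigma> = (\<Sum>b\<in>Basis. - (y \<bullet> b)\<^sup>2 / \<sigma>)"
      by (simp add: sum_negf sum_divide_distrib)
    show ?thesis unfolding G_def f_def 1 2 prod.distrib
      by (simp add: exp_sum cis_sum sum_negf[symmetric])
  qed
  have fi: "integrable lborel (f b)" for b
    unfolding f_def by (rule gaussian_fourier_real[OF \<sigma>])
  have comp: "(\<Sum>b\<in>Basis. w b *\<^sub>R b) \<bullet> b = w b" if "b \<in> Basis" for w :: "'a \<Rightarrow> real" and b
    using that by (simp add: inner_sum_left inner_Basis if_distrib cong: if_cong)
  have Gw: "G (\<Sum>b\<in>Basis. w b *\<^sub>R b) = (\<Prod>b\<in>Basis. f b (w b))" for w
    unfolding G by (intro prod.cong refl) (simp add: comp)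
  have pi: "integrable (Pi\<^sub>M Basis (\<lambda>b::'a. lborel)) (\<lambda>w. \<Prod>b\<in>Basis. f b (w b))"
    by (intro product_integrable_prod fi) auto
  show "integrable lborel G"
    by (subst lborel_eq, subst integrable_distr_eq) (auto simp: Gw pi)
  have "(\<integral>y. G y \<partial>lborel) = (\<integral>w. (\<Prod>b\<in>Basis. f b (w b)) \<partial>(Pi\<^sub>M Basis (\<lambda>b::'a. lborel)))"
    by (subst lborel_eq, subst integral_distr) (auto simp: Gw)
  also have "\<dots> = (\<Prod>b\<in>Basis. \<integral>y. f b y \<partial>lborel)"
    by (intro product_integral_prod fi) auto
  also have "\<dots> = (\<Prod>b\<in>Basis. complex_of_real (sqrt (pi * \<sigma>)) * complex_of_real (exp (- \<sigma> * (x \<bullet> b)\<^sup>2 / 4)))"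
    unfolding f_def gaussian_fourier_real[OF \<sigma>] by simp
  also have "\<dots> = complex_of_real (sqrt (pi * \<sigma>) ^ DIM('a) * exp (\<Sum>b\<in>Basis. - \<sigma> * (x \<bullet> b)\<^sup>2 / 4))"
    by (simp add: prod.distrib exp_sum)
  also have "(\<Sum>b\<in>Basis. - \<sigma> * (x \<bullet> b)\<^sup>2 / 4) = - \<sigma> * (norm x)\<^sup>2 / 4"
    by (subst euclidean_inner[of x x, folded power2_norm_eq_inner])
       (simp add: power2_eq_square sum_distrib_left sum_divide_distrib sum_negf[symmetric])
  finally show "(\<integral>y. G y \<partial>lborel) = complex_of_real (sqrt (pi * \<sigma>) ^ DIM('a) * exp (- \<sigma> * (norm x)\<^sup>2 / 4))" .
qed

lemma integrable_gaussian:
  fixes \<sigma> :: real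
  assumes \<sigma>: "0 < \<sigma>"
  shows "integrable lborel (\<lambda>y::'a::euclidean_space. exp (- (norm y)\<^sup>2 / \<sigma>))"
    and "(\<integral>y. exp (- (norm (y::'a))\<^sup>2 / \<sigma>) \<partial>lborel) = sqrt (pi * \<sigma>) ^ DIM('a)"
proof -
  have i: "integrable lborel (\<lambda>y::'a. complex_of_real (exp (- (norm y)\<^sup>2 / \<sigma>)))"
    and e: "(\<integral>y. complex_of_real (exp (- (norm (y::'a))\<^sup>2 / \<sigma>)) \<partial>lborel) = complex_of_real (sqrt (pi * \<sigma>) ^ DIM('a))"
    using gaussian_fourier[OF \<sigma>, of "0::'a"] by simp_all
  show "integrable lborel (\<lambda>y::'a. exp (- (norm y)\<^sup>2 / \<sigma>))"
    using integrable_Re[OF i] by simp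
  show "(\<integral>y. exp (- (norm (y::'a))\<^sup>2 / \<sigma>) \<partial>lborel) = sqrt (pi * \<sigma>) ^ DIM('a)"
    using e unfolding integral_complex_of_real of_real_eq_iff .
qed

lemma gauss_nonneg: "0 \<le> gauss \<eta> \<sigma> \<xi>" and gauss_le_1: "0 < \<sigma> \<Longrightarrow> gauss \<eta> \<sigma> \<xi> \<le> 1"
  by (auto simp: gauss_def)

lemma gauss_measurable [measurable]: "case_prod (\<lambda>\<eta> \<xi>. gauss \<eta> \<sigma> \<xi>) \<in> borel_measurable (borel \<Otimes>\<^sub>M borel)"
  unfolding gauss_def by measurable

lemma gauss_commute: "gauss \<eta> \<sigma> \<xi> = gauss \<xi> \<sigma> \<eta>"
  by (simp add: gauss_def norm_minus_commute)

lemma gauss_integrable: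
  assumes \<sigma>: "0 < \<sigma>"
  shows "integrable lborel (gauss \<eta> \<sigma>)"
    and "(\<integral>\<xi>. gauss \<eta> \<sigma> \<xi> \<partial>lborel) = sqrt (pi * \<sigma>) ^ 3"
proof -
  have "(\<lambda>\<xi>. gauss \<eta> \<sigma> (\<eta> + 1 *\<^sub>R \<xi>)) = (\<lambda>\<xi>. exp (- (norm \<xi>)\<^sup>2 / \<sigma>))"
    by (simp add: gauss_def)
  then show "integrable lborel (gauss \<eta> \<sigma>)" "(\<integral>\<xi>. gauss \<eta> \<sigma> \<xi> \<partial>lborel) = sqrt (pi * \<sigma>) ^ 3"
    using integrable_lborel_affine_iff[of 1 "gauss \<eta> \<sigma>" \<eta>] integral_lborel_affine[of 1 "gauss \<eta> \<sigma>" \<eta>]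
      integrable_gaussian[OF \<sigma>, where 'a="real^3"] by simp_all
qed

text \<open>Translation by \<eta> contributes only a phase. A Gaussian of width \<sigma> becomes one
  of width \<open>4 / \<sigma>\<close>; this pairing of widths recurs in all later choices.\<close>

lemma ft1_gauss:
  assumes \<sigma>: "0 < \<sigma>"
  shows "ft1 (\<lambda>\<xi>. complex_of_real (gauss \<eta> \<sigma> \<xi>)) x =
    complex_of_real (sqrt (pi * \<sigma>) ^ 3 * exp (- \<sigma> * (norm x)\<^sup>2 / 4)) * cis (- (x \<bullet> \<eta>))"
proof -
  have "ft1 (\<lambda>\<xi>. complex_of_real (gauss \<eta> \<sigma> \<xi>)) x =
      (\<integral>\<xi>. complex_of_real (gauss \<eta> \<sigma> (\<eta> + 1 *\<^sub>R \<xi>)) * cis (- (x \<bullet> (\<eta> + 1 *\<^sub>R \<xi>))) \<partial>lborel)"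
    unfolding ft1_def by (subst integral_lborel_affine[of 1 _ \<eta>]) simp_all
  also have "\<dots> = (\<integral>\<xi>. complex_of_real (exp (- (norm \<xi>)\<^sup>2 / \<sigma>)) * cis (- (x \<bullet> \<xi>)) * cis (- (x \<bullet> \<eta>)) \<partial>lborel)"
    by (intro Bochner_Integration.integral_cong refl) (simp add: gauss_def inner_add_right cis_mult mult.assoc add.commute)
  also have "\<dots> = complex_of_real (sqrt (pi * \<sigma>) ^ 3 * exp (- \<sigma> * (norm x)\<^sup>2 / 4)) * cis (- (x \<bullet> \<eta>))"
    using gaussian_fourier(2)[OF \<sigma>, of x] by simp
  finally show ?thesis .
qed


section \<open>The multiplication formula and a Parseval identity with Gaussian weight\<close>

lemma integrable_lborel_pair_mult:
  fixes f :: "'a::euclidean_space \<Rightarrow> 'c::{real_normed_field,banach,second_countable_topology}"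
    and g :: "'b::euclidean_space \<Rightarrow> 'c"
  assumes f: "integrable lborel f" and g: "integrable lborel g"
  shows "integrable (lborel \<Otimes>\<^sub>M lborel) (\<lambda>(x, y). f x * g y)"
proof (rule lborel_pair.Fubini_integrable)
  have [measurable]: "f \<in> borel_measurable borel" "g \<in> borel_measurable borel" using f g by auto
  show "(\<lambda>(x, y). f x * g y) \<in> borel_measurable (lborel \<Otimes>\<^sub>M lborel)" by measurable
  show "integrable lborel (\<lambda>x. \<integral>y. norm (case (x, y) of (x, y) \<Rightarrow> f x * g y) \<partial>lborel)"
    using f by (simp add: norm_mult)
  show "AE x in lborel. integrable lborel (\<lambda>y. case (x, y) of (x, y) \<Rightarrow> f x * g y)"
    using g by simp
qed

lemma ft1_integrand:
  assumes "integrable lborel g"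
  shows "integrable lborel (\<lambda>\<xi>. g \<xi> * cis (- (x \<bullet> \<xi>)))"
proof (rule Bochner_Integration.integrable_bound[OF assms])
  have [measurable]: "g \<in> borel_measurable borel" using assms by auto
  show "(\<lambda>\<xi>. g \<xi> * cis (- (x \<bullet> \<xi>))) \<in> borel_measurable lborel"
    unfolding cis_conv_exp by measurable
qed (simp add: norm_mult)

lemma ft1_measurable:
  assumes "integrable lborel g"
  shows "ft1 g \<in> borel_measurable borel"
proof -
  have [measurable]: "g \<in> borel_measurable borel" using assms by auto
  have "(\<lambda>x. \<integral>\<xi>. g \<xi> * cis (- (x \<bullet> \<xi>)) \<partial>lborel) \<in> borel_measurable borel"
    by (rule lborel.borel_measurable_lebesgue_integral) (unfold cis_conv_exp, measurable)
  then show ?thesis by (simp add: ft1_def[abs_def])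
qed

lemma norm_ft1_le: "norm (ft1 g x) \<le> (\<integral>\<xi>. norm (g \<xi>) \<partial>lborel)"
proof -
  have "norm (ft1 g x) \<le> (\<integral>\<xi>. norm (g \<xi> * cis (- (x \<bullet> \<xi>))) \<partial>lborel)"
    unfolding ft1_def by (rule integral_norm_bound)
  then show ?thesis by (simp add: norm_mult)
qed

lemma integrable_ft1_mult:
  assumes g: "integrable lborel g" and h: "integrable lborel h"
  shows "integrable lborel (\<lambda>x. ft1 g x * h x)"
proof (rule Bochner_Integration.integrable_bound[of _ "\<lambda>x. (\<integral>\<xi>. norm (g \<xi>) \<partial>lborel) * norm (h x)"])
  have [measurable]: "h \<in> borel_measurable borel" "ft1 g \<in> borel_measurable borel"
    using h ft1_measurable[OF g] by auto
  show "(\<lambda>x. ft1 g x * h x) \<in> borel_measurable lborel" by measurable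
  show "AE x in lborel. norm (ft1 g x * h x) \<le> norm ((\<integral>\<xi>. norm (g \<xi>) \<partial>lborel) * norm (h x))"
    by (auto simp: norm_mult intro!: AE_I2 mult_right_mono order_trans[OF norm_ft1_le])
qed (use h in auto)

text \<open>Fubini for the kernel \<open>cis (- (x \<bullet> \<xi>))\<close>. It asks for integrable
  functions only, and the Parseval identity below is derived from it.\<close>

lemma ft1_multiplication_formula:
  assumes g: "integrable lborel g" and h: "integrable lborel h"
  shows "(\<integral>x. ft1 g x * h x \<partial>lborel) = (\<integral>x. g x * ft1 h x \<partial>lborel)"
proof -
  have [measurable]: "g \<in> borel_measurable borel" "h \<in> borel_measurable borel" using g h by auto
  have i: "integrable (lborel \<Otimes>\<^sub>M lborel) (\<lambda>(\<xi>, x). g \<xi> * h x * cis (- (x \<bullet> \<xi>)))"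
  proof (rule Bochner_Integration.integrable_bound[OF integrable_lborel_pair_mult[OF g h]])
    show "(\<lambda>(\<xi>, x). g \<xi> * h x * cis (- (x \<bullet> \<xi>))) \<in> borel_measurable (lborel \<Otimes>\<^sub>M lborel)"
      unfolding cis_conv_exp by measurable
  qed (simp add: norm_mult case_prod_unfold)
  have "(\<integral>x. ft1 g x * h x \<partial>lborel) = (\<integral>x. \<integral>\<xi>. g \<xi> * h x * cis (- (x \<bullet> \<xi>)) \<partial>lborel \<partial>lborel)"
    unfolding ft1_def by (simp add: mult_ac flip: integral_mult_right_zero)
  also have "\<dots> = (\<integral>\<xi>. \<integral>x. g \<xi> * h x * cis (- (x \<bullet> \<xi>)) \<partial>lborel \<partial>lborel)"
    by (rule lborel_pair.Fubini_integral[OF i])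
  also have "\<dots> = (\<integral>x. g x * ft1 h x \<partial>lborel)"
    unfolding ft1_def by (simp add: mult_ac inner_commute flip: integral_mult_right_zero)
  finally show ?thesis .
qed

lemma integrable_of_real_mult_gauss:
  fixes g :: "real^3 \<Rightarrow> real"
  assumes g: "integrable lborel g" and \<sigma>: "0 < \<sigma>"
  shows "integrable lborel (\<lambda>x. g x * gauss \<eta> \<sigma> x)"
proof (rule Bochner_Integration.integrable_bound[OF g])
  have [measurable]: "g \<in> borel_measurable borel" using g by auto
  show "(\<lambda>x. g x * gauss \<eta> \<sigma> x) \<in> borel_measurable lborel" by measurable
  show "AE x in lborel. norm (g x * gauss \<eta> \<sigma> x) \<le> norm (g x)"
    using gauss_le_1[OF \<sigma>] by (auto simp: abs_mult gauss_nonneg intro!: mult_left_le)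
qed

text \<open>For merely integrable \<open>g\<close> and \<open>\<psi>\<close> the product of the
  transforms is just bounded, so a Gaussian weight is built in. The multiplication formula is
  applied to \<open>g\<close> and to the weighted conjugate transform of \<open>\<psi>\<close>,
  whose own transform is a Gaussian average of \<open>\<psi>\<close>.\<close>

lemma parseval_gauss:
  fixes g \<psi> :: "real^3 \<Rightarrow> real"
  assumes g: "integrable lborel g" and \<psi>: "integrable lborel \<psi>" and \<epsilon>: "0 < \<epsilon>"
  defines "G \<equiv> ft1 (\<lambda>x. complex_of_real (g x))" and "P \<equiv> ft1 (\<lambda>x. complex_of_real (\<psi> x))"
  shows "integrable lborel (\<lambda>\<eta>. Re (G \<eta> * cnj (P \<eta>)) * gauss 0 (1 / \<epsilon>) \<eta>)"
    and "(\<integral>\<eta>. Re (G \<eta> * cnj (P \<eta>)) * gauss 0 (1 / \<epsilon>) \<eta> \<partial>lborel) =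
      sqrt (pi / \<epsilon>) ^ 3 * (\<integral>x. g x * (\<integral>y. \<psi> y * gauss x (4 * \<epsilon>) y \<partial>lborel) \<partial>lborel)"
proof -
  define h where "h = (\<lambda>\<eta>. cnj (P \<eta>) * complex_of_real (gauss 0 (1 / \<epsilon>) \<eta>))"
  have e1: "0 < 1 / \<epsilon>" using \<epsilon> by simp
  have gc: "integrable lborel (\<lambda>x. complex_of_real (g x))"
    and \<psi>c: "integrable lborel (\<lambda>x. complex_of_real (\<psi> x))" using g \<psi> by auto
  have gi: "integrable lborel (\<lambda>\<xi>. complex_of_real (gauss 0 (1 / \<epsilon>) \<xi>))"
    using gauss_integrable[OF e1] by simp
  have h: "integrable lborel h"
  proof -
    have "integrable lborel (\<lambda>\<eta>. cnj (P \<eta> * complex_of_real (gauss 0 (1 / \<epsilon>) \<eta>)))"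
      unfolding P_def by (subst complex_integrable_cnj) (rule integrable_ft1_mult[OF \<psi>c gi])
    then show ?thesis by (simp add: h_def)
  qed
  \<comment> \<open>After conjugation the multiplication formula applies a second time and moves the
    transform from \<open>\<psi>\<close> to a modulated Gaussian. The modulation by
    \<open>cis (x \<bullet> \<eta>)\<close> recentres its transform at \<open>x\<close>, with width
    \<open>4 * \<epsilon>\<close> dual to \<open>1 / \<epsilon>\<close>.\<close>
  have fh: "ft1 h x = complex_of_real (sqrt (pi / \<epsilon>) ^ 3 * (\<integral>y. \<psi> y * gauss x (4 * \<epsilon>) y \<partial>lborel))" for x
  proof -
    have gx: "integrable lborel (\<lambda>\<eta>. complex_of_real (gauss 0 (1 / \<epsilon>) \<eta>) * cis (x \<bullet> \<eta>))"
      using ft1_integrand[OF gi, of "- x"] by simp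
    have "cnj (ft1 h x) = (\<integral>\<eta>. P \<eta> * (complex_of_real (gauss 0 (1 / \<epsilon>) \<eta>) * cis (x \<bullet> \<eta>)) \<partial>lborel)"
    proof -
      have "cnj (ft1 h x) = (\<integral>\<eta>. cnj (h \<eta> * cis (- (x \<bullet> \<eta>))) \<partial>lborel)"
        unfolding ft1_def by (rule Bochner_Integration.integral_cnj[symmetric])
      also have "\<dots> = (\<integral>\<eta>. P \<eta> * (complex_of_real (gauss 0 (1 / \<epsilon>) \<eta>) * cis (x \<bullet> \<eta>)) \<partial>lborel)"
        by (intro Bochner_Integration.integral_cong refl) (simp add: h_def cis_cnj mult.assoc)
      finally show ?thesis .
    qed
    also have "\<dots> = (\<integral>y. complex_of_real (\<psi> y) * ft1 (\<lambda>\<eta>. complex_of_real (gauss 0 (1 / \<epsilon>) \<eta>) * cis (x \<bullet> \<eta>)) y \<partial>lborel)"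
      unfolding P_def by (rule ft1_multiplication_formula[OF \<psi>c gx])
    also have "\<dots> = (\<integral>y. complex_of_real (sqrt (pi / \<epsilon>) ^ 3 * (\<psi> y * gauss x (4 * \<epsilon>) y)) \<partial>lborel)"
    proof (intro Bochner_Integration.integral_cong refl)
      fix y
      have "ft1 (\<lambda>\<eta>. complex_of_real (gauss 0 (1 / \<epsilon>) \<eta>) * cis (x \<bullet> \<eta>)) y =
          ft1 (\<lambda>\<eta>. complex_of_real (gauss 0 (1 / \<epsilon>) \<eta>)) (y - x)"
        unfolding ft1_def by (simp add: cis_mult inner_diff_left mult.assoc)
      also have "\<dots> = complex_of_real (sqrt (pi / \<epsilon>) ^ 3 * gauss x (4 * \<epsilon>) y)"
        unfolding ft1_gauss[OF e1] by (simp add: gauss_def mult.commute)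
      finally show "complex_of_real (\<psi> y) * ft1 (\<lambda>\<eta>. complex_of_real (gauss 0 (1 / \<epsilon>) \<eta>) * cis (x \<bullet> \<eta>)) y =
          complex_of_real (sqrt (pi / \<epsilon>) ^ 3 * (\<psi> y * gauss x (4 * \<epsilon>) y))" by simp
    qed
    also have "\<dots> = complex_of_real (sqrt (pi / \<epsilon>) ^ 3 * (\<integral>y. \<psi> y * gauss x (4 * \<epsilon>) y \<partial>lborel))"
      unfolding integral_complex_of_real by simp
    finally have "cnj (cnj (ft1 h x)) = cnj (complex_of_real (sqrt (pi / \<epsilon>) ^ 3 * (\<integral>y. \<psi> y * gauss x (4 * \<epsilon>) y \<partial>lborel)))"
      by (rule arg_cong)
    then show ?thesis by simp
  qed
  have Re: "Re (G \<eta> * cnj (P \<eta>)) * gauss 0 (1 / \<epsilon>) \<eta> = Re (G \<eta> * h \<eta>)" for \<eta>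
    by (simp add: h_def algebra_simps)
  have Gh: "integrable lborel (\<lambda>\<eta>. G \<eta> * h \<eta>)"
    unfolding G_def by (rule integrable_ft1_mult[OF gc h])
  show "integrable lborel (\<lambda>\<eta>. Re (G \<eta> * cnj (P \<eta>)) * gauss 0 (1 / \<epsilon>) \<eta>)"
    unfolding Re by (rule integrable_Re[OF Gh])
  have "(\<integral>\<eta>. Re (G \<eta> * cnj (P \<eta>)) * gauss 0 (1 / \<epsilon>) \<eta> \<partial>lborel) = Re (\<integral>\<eta>. G \<eta> * h \<eta> \<partial>lborel)"
    unfolding Re by (rule integral_Re[OF Gh])
  also have "(\<integral>\<eta>. G \<eta> * h \<eta> \<partial>lborel) =
      (\<integral>x. complex_of_real (sqrt (pi / \<epsilon>) ^ 3 * (g x * (\<integral>y. \<psi> y * gauss x (4 * \<epsilon>) y \<partial>lborel))) \<partial>lborel)"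
    unfolding G_def ft1_multiplication_formula[OF gc h] fh by (simp add: mult_ac)
  also have "Re \<dots> = sqrt (pi / \<epsilon>) ^ 3 * (\<integral>x. g x * (\<integral>y. \<psi> y * gauss x (4 * \<epsilon>) y \<partial>lborel) \<partial>lborel)"
    unfolding integral_complex_of_real by simp
  finally show "(\<integral>\<eta>. Re (G \<eta> * cnj (P \<eta>)) * gauss 0 (1 / \<epsilon>) \<eta> \<partial>lborel) =
      sqrt (pi / \<epsilon>) ^ 3 * (\<integral>x. g x * (\<integral>y. \<psi> y * gauss x (4 * \<epsilon>) y \<partial>lborel) \<partial>lborel)" .
qed

text \<open>Splitting according to whether the factors exceed \<open>l\<close> replaces interpolation in the
  proof of the Hausdorff-Young type bound below.\<close>
lemma mult_le_powr_split:
  fixes a b l m :: real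
  assumes a: "0 \<le> a" and b: "0 \<le> b" and l: "0 < l" and m: "1 \<le> m" "m \<le> 2"
  shows "a * b \<le> l powr (2 - 2 * m) * a powr m * b powr m + l powr (2 - m) * (a powr m + b powr m)"
proof -
  have big: "x \<le> l powr (1 - m) * x powr m" if "l < x" for x
  proof -
    have "x = (x / l) powr 1 * l" using that l by simp
    also have "\<dots> \<le> (x / l) powr m * l" using that l m by (intro mult_right_mono powr_mono) auto
    also have "\<dots> = l powr (1 - m) * x powr m" using that l by (simp add: powr_divide powr_diff)
    finally show ?thesis .
  qed
  have small: "x * x \<le> l powr (2 - m) * x powr m" if "0 \<le> x" "x \<le> l" for x
  proof (cases "x = 0")
    case False
    have "x * x = x powr (2 - m) * x powr m"
      using that False by (simp add: powr_add[symmetric] power2_eq_square)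
    also have "\<dots> \<le> l powr (2 - m) * x powr m"
      using that m by (intro mult_right_mono powr_mono2) auto
    finally show ?thesis .
  qed auto
  have mixed: "x * y \<le> l powr (2 - m) * x powr m" if "l < x" "y \<le> l" for x y
  proof -
    have "x * y \<le> x * l" using that l by (intro mult_left_mono) auto
    also have "\<dots> \<le> (l powr (1 - m) * x powr m) * l" using big[OF that(1)] l by (intro mult_right_mono) auto
    also have "\<dots> = l powr (2 - m) * x powr m"
      using l by (simp add: powr_diff power2_eq_square)
    finally show ?thesis .
  qed
  have nn: "0 \<le> l powr (2 - 2 * m) * a powr m * b powr m" "0 \<le> l powr (2 - m) * a powr m" "0 \<le> l powr (2 - m) * b powr m"
    by auto
  consider "l < a" "l < b" | "l < a" "b \<le> l" | "a \<le> l" "l < b" | "a \<le> l" "b \<le> l" by linarith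
  then show ?thesis
  proof cases
    case 1
    have "a * b \<le> (l powr (1 - m) * a powr m) * (l powr (1 - m) * b powr m)"
      using 1 l big by (intro mult_mono) auto
    also have "\<dots> = l powr (2 - 2 * m) * a powr m * b powr m"
      using l by (simp add: powr_add[symmetric] mult_ac)
    finally show ?thesis using nn unfolding distrib_left by linarith
  next
    case 2 then show ?thesis using mixed[of a b] nn unfolding distrib_left by linarith
  next
    case 3 then show ?thesis using mixed[of b a] nn unfolding distrib_left mult.commute[of a b] by linarith
  next
    case 4
    have "2 * (a * b) \<le> a * a + b * b" using sum_squares_bound[of a b] by (simp add: power2_eq_square)
    moreover have "0 \<le> a * b" using a b by simp
    ultimately show ?thesis using small[OF a 4(1)] small[OF b 4(2)] nn unfolding distrib_left by linarith
  qed
qed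

section \<open>Fourier bounds for pairs related by Gaussian testing\<close>


lemma integrable_pair_gauss:
  fixes P :: "real^3 \<Rightarrow> real"
  assumes P: "integrable lborel P" "\<And>x. 0 \<le> P x" and s: "0 < s"
  shows "integrable (lborel \<Otimes>\<^sub>M lborel) (\<lambda>(x, y). P x * gauss x s y)"
    and "integral\<^sup>L (lborel \<Otimes>\<^sub>M lborel) (\<lambda>(x, y). P x * gauss x s y) = sqrt (pi * s) ^ 3 * (\<integral>x. P x \<partial>lborel)"
    and "integrable (lborel \<Otimes>\<^sub>M lborel) (\<lambda>(x, y). P y * gauss x s y)"
    and "integral\<^sup>L (lborel \<Otimes>\<^sub>M lborel) (\<lambda>(x, y). P y * gauss x s y) = sqrt (pi * s) ^ 3 * (\<integral>x. P x \<partial>lborel)"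
proof -
  have [measurable]: "P \<in> borel_measurable borel" using P by auto
  have inn: "(\<integral>y. P x * gauss x s y \<partial>lborel) = sqrt (pi * s) ^ 3 * P x" for x
    by (simp add: gauss_integrable[OF s])
  show i: "integrable (lborel \<Otimes>\<^sub>M lborel) (\<lambda>(x, y). P x * gauss x s y)"
  proof (rule lborel_pair.Fubini_integrable)
    show "integrable lborel (\<lambda>x. \<integral>y. norm (case (x, y) of (x, y) \<Rightarrow> P x * gauss x s y) \<partial>lborel)"
      using P by (simp add: abs_mult gauss_nonneg gauss_integrable[OF s])
    show "AE x in lborel. integrable lborel (\<lambda>y. case (x, y) of (x, y) \<Rightarrow> P x * gauss x s y)"
      by (simp add: gauss_integrable[OF s])
  qed measurable
  show e: "integral\<^sup>L (lborel \<Otimes>\<^sub>M lborel) (\<lambda>(x, y). P x * gauss x s y) = sqrt (pi * s) ^ 3 * (\<integral>x. P x \<partial>lborel)"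
    unfolding lborel_pair.integral_fst[OF i, symmetric] inn by simp
  have sw: "(\<lambda>(x, y). P y * gauss x s y) = (\<lambda>(x, y). (case (y, x) of (x, y) \<Rightarrow> P x * gauss x s y))"
    by (auto simp: gauss_commute fun_eq_iff)
  show "integrable (lborel \<Otimes>\<^sub>M lborel) (\<lambda>(x, y). P y * gauss x s y)"
    unfolding sw by (rule lborel_pair.integrable_product_swap[OF i])
  show "integral\<^sup>L (lborel \<Otimes>\<^sub>M lborel) (\<lambda>(x, y). P y * gauss x s y) = sqrt (pi * s) ^ 3 * (\<integral>x. P x \<partial>lborel)"
    unfolding e[symmetric] sw by (rule lborel_pair.integral_product_swap) measurable
qed

text \<open>The constant of the Hausdorff-Young substitute: \<open>sqrt pi ^ 3\<close> is left over
  from the Parseval factor, the summand 1 comes from the product term of the splitting, and each of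
  the two remaining terms contributes the kernel mass \<open>sqrt (4 * pi) ^ 3\<close>.\<close>

definition HY_const :: real where
  "HY_const = sqrt pi ^ 3 * (1 + 2 * sqrt (4 * pi) ^ 3)"

lemma HY_const_pos: "0 < HY_const"
  unfolding HY_const_def by (intro mult_pos_pos add_pos_pos) auto

text \<open>Parseval with both functions equal to \<open>g\<close> turns the weighted energy into
  the double integral of g(x) g(y) exp(-|x - y|^2 / (4 \<epsilon>)).
  \<open>mult_le_powr_split\<close> bounds the product g(x) g(y) by powers of exponent
  \<open>m\<close>, with a threshold \<open>l\<close> that is free and is optimised at the
  end.\<close>

lemma ft1_gauss_energy:
  fixes g :: "real^3 \<Rightarrow> real"
  assumes g: "integrable lborel g" and gm: "integrable lborel (\<lambda>x. \<bar>g x\<bar> powr m)"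
    and m: "1 \<le> m" "m \<le> 2" and \<epsilon>: "0 < \<epsilon>"
  defines "G \<equiv> ft1 (\<lambda>x. complex_of_real (g x))"
  shows "integrable lborel (\<lambda>\<eta>. (cmod (G \<eta>))\<^sup>2 * gauss 0 (1 / \<epsilon>) \<eta>)"
    and "(\<integral>\<eta>. (cmod (G \<eta>))\<^sup>2 * gauss 0 (1 / \<epsilon>) \<eta> \<partial>lborel) \<le>
      HY_const * \<epsilon> powr (3/2 - 3 / m) * (\<integral>x. \<bar>g x\<bar> powr m \<partial>lborel) powr (2 / m)"
proof -
  define N where "N = (\<integral>x. \<bar>g x\<bar> powr m \<partial>lborel)"
  define k where "k = sqrt (pi * (4 * \<epsilon>)) ^ 3"
  have N0: "0 \<le> N" unfolding N_def by simp
  have k0: "0 \<le> k" unfolding k_def using \<epsilon> by simp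
  have \<epsilon>4: "0 < 4 * \<epsilon>" using \<epsilon> by simp
  have [measurable]: "g \<in> borel_measurable borel" using g by auto
  have sq: "(cmod (G \<eta>))\<^sup>2 = Re (G \<eta> * cnj (G \<eta>))" for \<eta>
    by (simp add: complex_mult_cnj cmod_power2)
  note P = parseval_gauss[OF g g \<epsilon>, folded G_def, folded sq]
  show "integrable lborel (\<lambda>\<eta>. (cmod (G \<eta>))\<^sup>2 * gauss 0 (1 / \<epsilon>) \<eta>)"
    by (rule P(1))
  define J where "J = (\<integral>x. g x * (\<integral>y. g y * gauss x (4 * \<epsilon>) y \<partial>lborel) \<partial>lborel)"
  have i0: "integrable (lborel \<Otimes>\<^sub>M lborel) (\<lambda>(x, y). g x * g y * gauss x (4 * \<epsilon>) y)"
  proof (rule Bochner_Integration.integrable_bound[OF integrable_lborel_pair_mult[OF g g]])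
    show "AE z in lborel \<Otimes>\<^sub>M lborel. norm (case z of (x, y) \<Rightarrow> g x * g y * gauss x (4 * \<epsilon>) y) \<le> norm (case z of (x, y) \<Rightarrow> g x * g y)"
      using gauss_le_1[OF \<epsilon>4] by (auto simp: abs_mult gauss_nonneg intro!: mult_left_le AE_I2)
  qed measurable
  have "J = (\<integral>x. \<integral>y. g x * g y * gauss x (4 * \<epsilon>) y \<partial>lborel \<partial>lborel)"
    unfolding J_def by (simp add: mult.assoc)
  also have "\<dots> = integral\<^sup>L (lborel \<Otimes>\<^sub>M lborel) (\<lambda>(x, y). g x * g y * gauss x (4 * \<epsilon>) y)"
    by (rule lborel_pair.integral_fst[OF i0])
  finally have J: "J = integral\<^sup>L (lborel \<Otimes>\<^sub>M lborel) (\<lambda>(x, y). g x * g y * gauss x (4 * \<epsilon>) y)" .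
  have bound: "J \<le> l powr (2 - 2 * m) * N\<^sup>2 + 2 * l powr (2 - m) * k * N" if l: "0 < l" for l
  proof -
    note pg = integrable_pair_gauss[OF gm powr_ge_zero \<epsilon>4]
    have 1: "integrable (lborel \<Otimes>\<^sub>M lborel) (\<lambda>(x, y). \<bar>g x\<bar> powr m * \<bar>g y\<bar> powr m)"
      by (rule integrable_lborel_pair_mult[OF gm gm])
    have A1: "integral\<^sup>L (lborel \<Otimes>\<^sub>M lborel) (\<lambda>(x, y). \<bar>g x\<bar> powr m * \<bar>g y\<bar> powr m) = N\<^sup>2"
      unfolding lborel_pair.integral_fst[OF 1, symmetric] by (simp add: N_def power2_eq_square)
    let ?B = "\<lambda>z. l powr (2 - 2 * m) * (case z of (x, y) \<Rightarrow> \<bar>g x\<bar> powr m * \<bar>g y\<bar> powr m) +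
        l powr (2 - m) * ((case z of (x, y) \<Rightarrow> \<bar>g x\<bar> powr m * gauss x (4 * \<epsilon>) y) + (case z of (x, y) \<Rightarrow> \<bar>g y\<bar> powr m * gauss x (4 * \<epsilon>) y))"
    have "J \<le> integral\<^sup>L (lborel \<Otimes>\<^sub>M lborel) ?B"
      unfolding J
    proof (rule integral_mono[OF i0])
      show "integrable (lborel \<Otimes>\<^sub>M lborel) ?B"
        using 1 pg by (intro Bochner_Integration.integrable_add integrable_mult_right) auto
      fix z :: "(real^3) \<times> (real^3)"
      obtain x y where z: "z = (x, y)" by (cases z)
      let ?g = "gauss x (4 * \<epsilon>) y"
      have "g x * g y * ?g \<le> \<bar>g x\<bar> * \<bar>g y\<bar> * ?g"
        by (intro mult_right_mono gauss_nonneg) (metis abs_ge_self abs_mult)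
      also have "\<dots> \<le> (l powr (2 - 2 * m) * \<bar>g x\<bar> powr m * \<bar>g y\<bar> powr m + l powr (2 - m) * (\<bar>g x\<bar> powr m + \<bar>g y\<bar> powr m)) * ?g"
        by (intro mult_right_mono gauss_nonneg mult_le_powr_split l m) auto
      also have "\<dots> = l powr (2 - 2 * m) * \<bar>g x\<bar> powr m * \<bar>g y\<bar> powr m * ?g + l powr (2 - m) * (\<bar>g x\<bar> powr m + \<bar>g y\<bar> powr m) * ?g"
        by (rule distrib_right)
      \<comment> \<open>In the product term the kernel is replaced by 1, because both variables are
        already integrated against powers of |g|. In the other term the kernel is kept, since it
        alone makes the integral over the free variable finite.\<close>
      also have "\<dots> \<le> l powr (2 - 2 * m) * \<bar>g x\<bar> powr m * \<bar>g y\<bar> powr m + l powr (2 - m) * (\<bar>g x\<bar> powr m + \<bar>g y\<bar> powr m) * ?g"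
        using gauss_le_1[OF \<epsilon>4] by (intro add_right_mono mult_left_le) auto
      finally show "(case z of (x, y) \<Rightarrow> g x * g y * gauss x (4 * \<epsilon>) y) \<le> ?B z"
        unfolding z by (simp add: algebra_simps)
    qed
    also have "\<dots> = l powr (2 - 2 * m) * N\<^sup>2 + l powr (2 - m) * (k * N + k * N)"
    proof (subst Bochner_Integration.integral_add)
      have "integrable (lborel \<Otimes>\<^sub>M lborel) (\<lambda>z. ((case z of (x, y) \<Rightarrow> \<bar>g x\<bar> powr m * gauss x (4 * \<epsilon>) y) + (case z of (x, y) \<Rightarrow> \<bar>g y\<bar> powr m * gauss x (4 * \<epsilon>) y)))"
        by (rule Bochner_Integration.integrable_add[OF pg(1,3)])
      then show "integrable (lborel \<Otimes>\<^sub>M lborel) (\<lambda>z. l powr (2 - m) * ((case z of (x, y) \<Rightarrow> \<bar>g x\<bar> powr m * gauss x (4 * \<epsilon>) y) + (case z of (x, y) \<Rightarrow> \<bar>g y\<bar> powr m * gauss x (4 * \<epsilon>) y)))"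
        by (rule integrable_mult_right)
      show "integrable (lborel \<Otimes>\<^sub>M lborel) (\<lambda>z. l powr (2 - 2 * m) * (case z of (x, y) \<Rightarrow> \<bar>g x\<bar> powr m * \<bar>g y\<bar> powr m))"
        using 1 by (rule integrable_mult_right)
    qed (simp only: integral_mult_right_zero Bochner_Integration.integral_add[OF pg(1,3)] A1 pg(2,4) N_def k_def)
    finally show ?thesis by (simp add: algebra_simps)
  qed
  have "sqrt (pi / \<epsilon>) ^ 3 * J \<le> HY_const * \<epsilon> powr (3/2 - 3 / m) * N powr (2 / m)"
  proof (cases "N = 0")
    case True
    then have "J \<le> 0" using bound[of 1] by simp
    then have "sqrt (pi / \<epsilon>) ^ 3 * J \<le> 0" using \<epsilon> by (intro mult_nonneg_nonpos) auto
    then show ?thesis using True by simp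
  next
    case False
    then have N: "0 < N" using N0 by simp
    \<comment> \<open>This threshold balances the two contributions
      \<open>l powr (2 - 2 * m) * N^2\<close> and \<open>l powr (2 - m) * k * N\<close> up to
      constants, because \<open>k\<close> is a multiple of \<open>\<epsilon> powr (3/2)\<close>. It
      would vanish for \<open>N = 0\<close>, hence the separate case.\<close>
    define l where "l = (N * \<epsilon> powr (- 3/2)) powr (1 / m)"
    have l: "0 < l" using N \<epsilon> by (simp add: l_def)
    have lp: "l powr p = N powr (p / m) * \<epsilon> powr (- (3 * p / (2 * m)))" for p
    proof -
      have "l powr p = N powr (1 / m * p) * \<epsilon> powr (- 3/2 * (1 / m * p))"
        using N \<epsilon> by (simp add: l_def powr_powr powr_mult)
      moreover have "1 / m * p = p / m" "- 3/2 * (1 / m * p) = - (3 * p / (2 * m))" by simp_all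
      ultimately show ?thesis by simp
    qed
    have cube: "sqrt x ^ 3 = x powr (3/2)" if "0 < x" for x :: real
      using that by (simp add: powr_half_sqrt[symmetric] powr_power)
    have s1: "sqrt (pi / \<epsilon>) ^ 3 = sqrt pi ^ 3 * \<epsilon> powr (-3/2)"
      using \<epsilon> by (simp add: cube powr_divide powr_minus_divide)
    have s2: "k = sqrt (4 * pi) ^ 3 * \<epsilon> powr (3/2)"
      using \<epsilon> by (simp add: k_def cube powr_mult[symmetric] mult_ac)
    have e1: "(2 - 2 * m) / m + 2 = 2 / m" "- (3 * (2 - 2 * m) / (2 * m)) + - 3 / 2 = 3 / 2 - 3 / m"
      "(2 - m) / m + 1 = 2 / m" "- (3 * (2 - m) / (2 * m)) = 3 / 2 - 3 / m"
      using m by (simp_all add: field_simps)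
    have t1: "l powr (2 - 2 * m) * N\<^sup>2 * \<epsilon> powr (-3/2) = \<epsilon> powr (3/2 - 3 / m) * N powr (2 / m)"
    proof -
      have "l powr (2 - 2 * m) * N\<^sup>2 * \<epsilon> powr (-3/2) =
          N powr ((2 - 2 * m) / m + 2) * \<epsilon> powr (- (3 * (2 - 2 * m) / (2 * m)) + - 3 / 2)"
        using N \<epsilon> unfolding lp powr_add by (simp add: mult_ac)
      then show ?thesis unfolding e1 by (simp add: mult.commute)
    qed
    have t2: "l powr (2 - m) * N = \<epsilon> powr (3/2 - 3 / m) * N powr (2 / m)"
    proof -
      have "l powr (2 - m) * N = N powr ((2 - m) / m + 1) * \<epsilon> powr (- (3 * (2 - m) / (2 * m)))"
        using N \<epsilon> unfolding lp powr_add by (simp add: mult_ac)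
      then show ?thesis unfolding e1 by (simp add: mult.commute)
    qed
    have ee: "\<epsilon> powr (3/2) * \<epsilon> powr (-3/2) = 1"
      using \<epsilon> by (simp add: powr_add[symmetric])
    have "sqrt (pi / \<epsilon>) ^ 3 * J \<le> sqrt (pi / \<epsilon>) ^ 3 * (l powr (2 - 2 * m) * N\<^sup>2 + 2 * l powr (2 - m) * k * N)"
      using \<epsilon> by (intro mult_left_mono bound l) auto
    also have "\<dots> = sqrt pi ^ 3 * (l powr (2 - 2 * m) * N\<^sup>2 * \<epsilon> powr (-3/2)) +
       sqrt pi ^ 3 * (2 * sqrt (4 * pi) ^ 3) * (l powr (2 - m) * N) * (\<epsilon> powr (3/2) * \<epsilon> powr (-3/2))"
      unfolding s1 s2 by (simp add: algebra_simps)
    also have "\<dots> = HY_const * \<epsilon> powr (3/2 - 3 / m) * N powr (2 / m)"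
      unfolding t1 t2 ee HY_const_def by (simp add: algebra_simps)
    finally show ?thesis .
  qed
  then show "(\<integral>\<eta>. (cmod (G \<eta>))\<^sup>2 * gauss 0 (1 / \<epsilon>) \<eta> \<partial>lborel) \<le>
      HY_const * \<epsilon> powr (3/2 - 3 / m) * (\<integral>x. \<bar>g x\<bar> powr m \<partial>lborel) powr (2 / m)"
    unfolding P(2) J_def[symmetric] N_def[symmetric] .
qed

section \<open>Duality and Gaussian mollification\<close>

text \<open>The tests bound a linear functional by a constant plus a quadratic form. Inserting a
  multiple of \<open>h\<close> itself and optimising the multiple gives the bound on the square. The
  additive form \<open>A + B * ...\<close> is what Young's inequality delivers in the applications.
  Only the integral of \<open>h * w\<close> is assumed finite, and tests are given for continuous
  functions, so \<open>h\<close> is truncated and the tests are first extended to bounded measurable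
  functions.\<close>

lemma weighted_L2_bound_by_duality:
  fixes h w :: "'a::euclidean_space \<Rightarrow> real"
  assumes [measurable]: "h \<in> borel_measurable borel"
    and w: "integrable lborel w" "\<And>x. 0 \<le> w x"
    and hw: "integrable lborel (\<lambda>x. h x * w x)" and B: "0 < B" and A: "0 \<le> A"
    and test: "\<And>\<phi> K. continuous_on UNIV \<phi> \<Longrightarrow> (\<And>x. \<bar>\<phi> x\<bar> \<le> K) \<Longrightarrow>
      (\<integral>x. h x * \<phi> x * w x \<partial>lborel) \<le> A + B * (\<integral>x. (\<phi> x)\<^sup>2 * w x \<partial>lborel)"
  shows "(\<integral>\<^sup>+x. ennreal ((h x)\<^sup>2 * w x) \<partial>lborel) \<le> ennreal (4 * A * B)"
proof -
  have [measurable]: "w \<in> borel_measurable borel" using w by auto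
  have test': "(\<integral>x. h x * \<phi> x * w x \<partial>lborel) \<le> A + B * (\<integral>x. (\<phi> x)\<^sup>2 * w x \<partial>lborel)"
    if [measurable]: "\<phi> \<in> borel_measurable borel" and K: "\<And>x. \<bar>\<phi> x\<bar> \<le> K" for \<phi> K
  proof -
    have "\<phi> \<in> borel_measurable lebesgue" by (rule measurable_completion) simp
    then have "\<phi> measurable_on UNIV"
      by (intro lebesgue_measurable_imp_measurable_on_real) auto
    then obtain N F where N: "negligible N" and F: "\<And>n. continuous_on UNIV (F n)"
      and lim: "\<And>x. x \<notin> N \<Longrightarrow> (\<lambda>n. F n x) \<longlonglongrightarrow> \<phi> x"
      unfolding measurable_on_def by auto
    have K0: "0 \<le> K" using K[of undefined] by linarith
    \<comment> \<open>Clipping to [-K, K] preserves continuity, supplies the dominating functions,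
      and leaves the limit unchanged because |\<phi>| is at most \<open>K\<close>.\<close>
    define T where "T = (\<lambda>n x. max (- K) (min K (F n x)))"
    have Tc: "continuous_on UNIV (T n)" for n
      unfolding T_def by (intro continuous_intros F)
    have [measurable]: "T n \<in> borel_measurable borel" for n
      by (rule borel_measurable_continuous_onI[OF Tc])
    have TK: "\<bar>T n x\<bar> \<le> K" for n x using K0 by (auto simp: T_def)
    have Tl: "(\<lambda>n. T n x) \<longlonglongrightarrow> \<phi> x" if "x \<notin> N" for x
    proof -
      have "(\<lambda>n. T n x) \<longlonglongrightarrow> max (- K) (min K (\<phi> x))"
        unfolding T_def by (intro tendsto_intros lim that)
      moreover have "max (- K) (min K (\<phi> x)) = \<phi> x" using K[of x] by auto
      ultimately show ?thesis by simp
    qed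
    have ae: "AE x in lborel. (\<lambda>n. T n x) \<longlonglongrightarrow> \<phi> x"
    proof -
      have "AE x in lebesgue. x \<notin> N"
        using N by (intro AE_not_in) (simp add: negligible_iff_null_sets)
      then have "AE x in lborel. x \<notin> N" by (simp add: AE_completion_iff)
      then show ?thesis by eventually_elim (rule Tl)
    qed
    have "(\<lambda>n. \<integral>x. h x * T n x * w x \<partial>lborel) \<longlonglongrightarrow> (\<integral>x. h x * \<phi> x * w x \<partial>lborel)"
    proof (rule integral_dominated_convergence[where w="\<lambda>x. K * \<bar>h x * w x\<bar>"])
      show "AE x in lborel. (\<lambda>n. h x * T n x * w x) \<longlonglongrightarrow> h x * \<phi> x * w x"
        using ae by eventually_elim (intro tendsto_intros)
      show "AE x in lborel. norm (h x * T n x * w x) \<le> K * \<bar>h x * w x\<bar>" for n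
      proof (rule AE_I2)
        fix x
        have "\<bar>T n x\<bar> * \<bar>h x * w x\<bar> \<le> K * \<bar>h x * w x\<bar>" by (intro mult_right_mono TK) auto
        then show "norm (h x * T n x * w x) \<le> K * \<bar>h x * w x\<bar>" by (simp add: abs_mult mult_ac)
      qed
    qed (use hw in auto)
    moreover have "(\<lambda>n. A + B * (\<integral>x. (T n x)\<^sup>2 * w x \<partial>lborel)) \<longlonglongrightarrow> A + B * (\<integral>x. (\<phi> x)\<^sup>2 * w x \<partial>lborel)"
    proof (intro tendsto_intros, rule integral_dominated_convergence[where w="\<lambda>x. K\<^sup>2 * w x"])
      show "AE x in lborel. (\<lambda>n. (T n x)\<^sup>2 * w x) \<longlonglongrightarrow> (\<phi> x)\<^sup>2 * w x"
        using ae by eventually_elim (intro tendsto_intros)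
      show "AE x in lborel. norm ((T n x)\<^sup>2 * w x) \<le> K\<^sup>2 * w x" for n
        using TK[of n] w(2) K0 by (auto simp: abs_mult intro!: AE_I2 mult_right_mono abs_le_square_iff[THEN iffD1])
    qed (use w in auto)
    ultimately show ?thesis
      by (rule LIMSEQ_le) (use test[OF Tc TK] in auto)
  qed
  \<comment> \<open>The truncations are bounded, so their weighted squares are integrable; Fatou's
    lemma transfers the uniform bound to \<open>h\<close>.\<close>
  define t where "t = (\<lambda>n x. if \<bar>h x\<bar> \<le> real n then h x else 0)"
  have [measurable]: "t n \<in> borel_measurable borel" for n unfolding t_def by measurable
  have tn: "\<bar>t n x\<bar> \<le> real n" for n x by (simp add: t_def)
  have tw: "integrable lborel (\<lambda>x. (t n x)\<^sup>2 * w x)" for n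
  proof (rule Bochner_Integration.integrable_bound[where f="\<lambda>x. (real n)\<^sup>2 * w x"])
    show "AE x in lborel. norm ((t n x)\<^sup>2 * w x) \<le> norm ((real n)\<^sup>2 * w x)"
      using tn[of n] w(2) by (auto simp: abs_mult intro!: AE_I2 mult_right_mono abs_le_square_iff[THEN iffD1])
  qed (use w in auto)
  have le: "(\<integral>x. (t n x)\<^sup>2 * w x \<partial>lborel) \<le> 4 * A * B" for n
  proof -
    let ?I = "\<integral>x. (t n x)\<^sup>2 * w x \<partial>lborel"
    \<comment> \<open>With I the weighted square integral of the truncation, the factor 1 / (2 B)
      yields I / (2 B) <= A + I / (4 B), which is I <= 4 A B.\<close>
    have "(\<integral>x. h x * (t n x / (2 * B)) * w x \<partial>lborel) \<le> A + B * (\<integral>x. (t n x / (2 * B))\<^sup>2 * w x \<partial>lborel)"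
    proof (rule test')
      show "\<bar>t n x / (2 * B)\<bar> \<le> real n / (2 * B)" for x
        using tn[of n x] B by (simp add: divide_right_mono)
    qed measurable
    also have "(\<lambda>x. h x * (t n x / (2 * B)) * w x) = (\<lambda>x. (1 / (2 * B)) * ((t n x)\<^sup>2 * w x))"
      by (auto simp: t_def power2_eq_square fun_eq_iff)
    also have "(\<lambda>x. (t n x / (2 * B))\<^sup>2 * w x) = (\<lambda>x. (1 / (4 * B\<^sup>2)) * ((t n x)\<^sup>2 * w x))"
      by (auto simp: power_divide power_mult_distrib)
    finally have "1 / (2 * B) * ?I \<le> A + B * (1 / (4 * B\<^sup>2) * ?I)" by simp
    then show ?thesis using B by (simp add: field_simps power2_eq_square)
  qed
  have "(\<integral>\<^sup>+x. ennreal ((h x)\<^sup>2 * w x) \<partial>lborel) = (\<integral>\<^sup>+x. liminf (\<lambda>n. ennreal ((t n x)\<^sup>2 * w x)) \<partial>lborel)"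
  proof (rule nn_integral_cong)
    fix x
    obtain n0 where n0: "\<bar>h x\<bar> \<le> real n0" using real_arch_simple by blast
    have "eventually (\<lambda>n. ennreal ((t n x)\<^sup>2 * w x) = ennreal ((h x)\<^sup>2 * w x)) sequentially"
      using eventually_ge_at_top[of n0] by eventually_elim (use n0 in \<open>auto simp: t_def\<close>)
    then have "(\<lambda>n. ennreal ((t n x)\<^sup>2 * w x)) \<longlonglongrightarrow> ennreal ((h x)\<^sup>2 * w x)"
      by (rule tendsto_eventually)
    then show "ennreal ((h x)\<^sup>2 * w x) = liminf (\<lambda>n. ennreal ((t n x)\<^sup>2 * w x))"
      by (metis lim_imp_Liminf sequentially_bot)
  qed
  also have "\<dots> \<le> liminf (\<lambda>n. \<integral>\<^sup>+x. ennreal ((t n x)\<^sup>2 * w x) \<partial>lborel)"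
    by (rule nn_integral_liminf) measurable
  also have "\<dots> \<le> ennreal (4 * A * B)"
  proof (rule Liminf_le)
    show "eventually (\<lambda>n. (\<integral>\<^sup>+x. ennreal ((t n x)\<^sup>2 * w x) \<partial>lborel) \<le> ennreal (4 * A * B)) sequentially"
      using le w(2) by (intro always_eventually allI) (simp add: nn_integral_eq_integral[OF tw] ennreal_leI)
  qed simp
  finally show ?thesis .
qed

text \<open>Fubini moves the smoothing from \<open>h\<close>, which has no regularity, to the
  continuous function \<phi> times a Gaussian. There it converges pointwise, and dominated
  convergence finishes. Integrability of \<open>h\<close> against wider Gaussians than the weight
  itself is what provides the majorant.\<close>

lemma gauss_mollifier_tendsto:
  fixes h \<phi> :: "real^3 \<Rightarrow> real"
  assumes h: "\<And>\<sigma>. 0 < \<sigma> \<Longrightarrow> integrable lborel (\<lambda>x. h x * gauss 0 \<sigma> x)"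
    and [measurable]: "h \<in> borel_measurable borel"
    and \<phi>: "continuous_on UNIV \<phi>" "\<And>x. \<bar>\<phi> x\<bar> \<le> K" and \<tau>: "0 < \<tau>"
    and \<sigma>: "\<And>n. 0 < \<sigma> n" "\<And>n. \<sigma> n \<le> \<tau> / 2" "\<sigma> \<longlonglongrightarrow> 0"
  shows "(\<lambda>n. (\<integral>\<eta>. (\<integral>\<xi>. h \<xi> * gauss \<eta> (\<sigma> n) \<xi> \<partial>lborel) * (\<phi> \<eta> * gauss 0 \<tau> \<eta>) \<partial>lborel) / sqrt (pi * \<sigma> n) ^ 3)
    \<longlonglongrightarrow> (\<integral>\<xi>. h \<xi> * \<phi> \<xi> * gauss 0 \<tau> \<xi> \<partial>lborel)"
proof -
  have [measurable]: "\<phi> \<in> borel_measurable borel" by (rule borel_measurable_continuous_onI[OF \<phi>(1)])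
  have K0: "0 \<le> K" using \<phi>(2)[of 0] by linarith
  define e where "e = (\<lambda>z::real^3. exp (- (norm z)\<^sup>2 / 1))"
  have e_int: "integrable lborel e" "(\<integral>z. e z \<partial>lborel) = sqrt pi ^ 3"
    using integrable_gaussian[of 1, where 'a="real^3"] by (simp_all add: e_def)
  have [measurable]: "e \<in> borel_measurable borel" unfolding e_def by measurable
  \<comment> \<open>The smoothed test function after the substitution \<eta> = \<xi> + sqrt(\<sigma>
    n) z, which removes the width from the kernel; the Jacobian \<open>sqrt (\<sigma> n) ^ 3\<close>
    cancels against the normalisation.\<close>
  define L where "L = (\<lambda>n \<xi>. \<integral>z. e z * (\<phi> (\<xi> + sqrt (\<sigma> n) *\<^sub>R z) * gauss 0 \<tau> (\<xi> + sqrt (\<sigma> n) *\<^sub>R z)) \<partial>lborel)"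
  have [measurable]: "L n \<in> borel_measurable borel" for n
    unfolding L_def by measurable
  \<comment> \<open>Here \<open>\<sigma> n \<le> \<tau> / 2\<close> is used: from |\<xi>|^2 <= 2
    |y|^2 + \<tau> |z|^2 half of the decay in \<open>z\<close> pays for the shift, and the weight
    survives with doubled width.\<close>
  have gb: "gauss 0 \<tau> (\<xi> + sqrt (\<sigma> n) *\<^sub>R z) * e z \<le> exp (- (norm z)\<^sup>2 / 2) * gauss 0 (2 * \<tau>) \<xi>" for n \<xi> z
  proof -
    let ?y = "\<xi> + sqrt (\<sigma> n) *\<^sub>R z"
    have "norm \<xi> = norm (?y - sqrt (\<sigma> n) *\<^sub>R z)" by simp
    also have "\<dots> \<le> norm ?y + norm (sqrt (\<sigma> n) *\<^sub>R z)" by (rule norm_triangle_ineq4)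
    finally have "(norm \<xi>)\<^sup>2 \<le> (norm ?y + norm (sqrt (\<sigma> n) *\<^sub>R z))\<^sup>2"
      by (intro power_mono) auto
    also have "\<dots> \<le> 2 * (norm ?y)\<^sup>2 + 2 * (norm (sqrt (\<sigma> n) *\<^sub>R z))\<^sup>2"
      using sum_squares_bound[of "norm ?y" "norm (sqrt (\<sigma> n) *\<^sub>R z)"] by (simp add: power2_sum)
    also have "(norm (sqrt (\<sigma> n) *\<^sub>R z))\<^sup>2 = \<sigma> n * (norm z)\<^sup>2"
      using \<sigma>(1)[of n] by (simp add: power_mult_distrib)
    also have "\<sigma> n * (norm z)\<^sup>2 \<le> \<tau> / 2 * (norm z)\<^sup>2"
      using \<sigma>(2) by (intro mult_right_mono) auto
    finally have "(norm \<xi>)\<^sup>2 \<le> 2 * (norm ?y)\<^sup>2 + \<tau> * (norm z)\<^sup>2" by simp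
    then have "(norm \<xi>)\<^sup>2 / (2 * \<tau>) \<le> (norm ?y)\<^sup>2 / \<tau> + (norm z)\<^sup>2 / 2"
      using \<tau> by (simp add: field_simps)
    then show ?thesis by (simp add: gauss_def e_def exp_add[symmetric])
  qed
  have bnd: "\<bar>e z * (\<phi> (\<xi> + sqrt (\<sigma> n) *\<^sub>R z) * gauss 0 \<tau> (\<xi> + sqrt (\<sigma> n) *\<^sub>R z))\<bar>
      \<le> K * gauss 0 (2 * \<tau>) \<xi> * exp (- (norm z)\<^sup>2 / 2)" for n \<xi> z
  proof -
    have "\<bar>e z * (\<phi> (\<xi> + sqrt (\<sigma> n) *\<^sub>R z) * gauss 0 \<tau> (\<xi> + sqrt (\<sigma> n) *\<^sub>R z))\<bar> =
        \<bar>\<phi> (\<xi> + sqrt (\<sigma> n) *\<^sub>R z)\<bar> * (gauss 0 \<tau> (\<xi> + sqrt (\<sigma> n) *\<^sub>R z) * e z)"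
      by (simp add: abs_mult gauss_nonneg e_def)
    also have "\<dots> \<le> K * (exp (- (norm z)\<^sup>2 / 2) * gauss 0 (2 * \<tau>) \<xi>)"
      by (intro mult_mono \<phi> gb K0 mult_nonneg_nonneg gauss_nonneg) (auto simp: e_def)
    finally show ?thesis by (simp add: mult_ac)
  qed
  have b_int: "integrable lborel (\<lambda>z::real^3. K * gauss 0 (2 * \<tau>) \<xi> * exp (- (norm z)\<^sup>2 / 2))" for \<xi>
    by (intro integrable_mult_right integrable_gaussian) simp
  have L_int: "integrable lborel (\<lambda>z. e z * (\<phi> (\<xi> + sqrt (\<sigma> n) *\<^sub>R z) * gauss 0 \<tau> (\<xi> + sqrt (\<sigma> n) *\<^sub>R z)))" for n \<xi>
    by (rule Bochner_Integration.integrable_bound[OF b_int[of \<xi>]]) (auto intro!: AE_I2 order_trans[OF bnd])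
  have L_le: "\<bar>L n \<xi>\<bar> \<le> K * sqrt (2 * pi) ^ 3 * gauss 0 (2 * \<tau>) \<xi>" for n \<xi>
  proof -
    have "\<bar>L n \<xi>\<bar> \<le> (\<integral>z. \<bar>e z * (\<phi> (\<xi> + sqrt (\<sigma> n) *\<^sub>R z) * gauss 0 \<tau> (\<xi> + sqrt (\<sigma> n) *\<^sub>R z))\<bar> \<partial>lborel)"
      unfolding L_def by (rule integral_abs_bound)
    also have "\<dots> \<le> (\<integral>z. K * gauss 0 (2 * \<tau>) \<xi> * exp (- (norm (z::real^3))\<^sup>2 / 2) \<partial>lborel)"
      by (intro integral_mono integrable_abs L_int b_int bnd)
    also have "\<dots> = K * sqrt (2 * pi) ^ 3 * gauss 0 (2 * \<tau>) \<xi>"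
      using integrable_gaussian(2)[of 2, where 'a="real^3"] by (simp add: mult_ac)
    finally show ?thesis .
  qed
  have L_lim: "(\<lambda>n. L n \<xi>) \<longlonglongrightarrow> sqrt pi ^ 3 * (\<phi> \<xi> * gauss 0 \<tau> \<xi>)" for \<xi>
  proof -
    have "(\<lambda>n. L n \<xi>) \<longlonglongrightarrow> (\<integral>z. e z * (\<phi> \<xi> * gauss 0 \<tau> \<xi>) \<partial>lborel)"
      unfolding L_def
    proof (rule integral_dominated_convergence[OF _ _ b_int[of \<xi>]])
      have c: "isCont \<phi> \<xi>" "isCont (gauss 0 \<tau>) \<xi>"
        using \<phi>(1) \<tau> by (auto simp: continuous_on_eq_continuous_at gauss_def[abs_def] intro!: continuous_intros)
      show "AE z in lborel. (\<lambda>n. e z * (\<phi> (\<xi> + sqrt (\<sigma> n) *\<^sub>R z) * gauss 0 \<tau> (\<xi> + sqrt (\<sigma> n) *\<^sub>R z)))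
          \<longlonglongrightarrow> e z * (\<phi> \<xi> * gauss 0 \<tau> \<xi>)"
      proof (intro AE_I2 tendsto_intros)
        fix z
        have "(\<lambda>n. \<xi> + sqrt (\<sigma> n) *\<^sub>R z) \<longlonglongrightarrow> \<xi> + sqrt 0 *\<^sub>R z"
          by (intro tendsto_intros \<sigma>)
        then have l: "(\<lambda>n. \<xi> + sqrt (\<sigma> n) *\<^sub>R z) \<longlonglongrightarrow> \<xi>" by simp
        show "(\<lambda>n. \<phi> (\<xi> + sqrt (\<sigma> n) *\<^sub>R z)) \<longlonglongrightarrow> \<phi> \<xi>"
          by (rule isCont_tendsto_compose[OF c(1) l])
        show "(\<lambda>n. gauss 0 \<tau> (\<xi> + sqrt (\<sigma> n) *\<^sub>R z)) \<longlonglongrightarrow> gauss 0 \<tau> \<xi>"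
          by (rule isCont_tendsto_compose[OF c(2) l])
      qed
    qed (use bnd in auto)
    then show ?thesis using e_int by simp
  qed
  have main: "(\<integral>\<eta>. (\<integral>\<xi>. h \<xi> * gauss \<eta> (\<sigma> n) \<xi> \<partial>lborel) * (\<phi> \<eta> * gauss 0 \<tau> \<eta>) \<partial>lborel) / sqrt (pi * \<sigma> n) ^ 3
      = (\<integral>\<xi>. h \<xi> * (L n \<xi> / sqrt pi ^ 3) \<partial>lborel)" for n
  proof -
    let ?s = "\<sigma> n"
    note s = \<sigma>(1)[of n]
    have inn: "(\<integral>\<eta>. gauss \<eta> ?s \<xi> * (\<phi> \<eta> * gauss 0 \<tau> \<eta>) \<partial>lborel) = sqrt ?s ^ 3 * L n \<xi>" for \<xi>
      using s unfolding L_def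
      by (subst integral_lborel_affine[of "sqrt ?s" _ \<xi>])
         (auto simp: gauss_def e_def power_mult_distrib)
    have inn_i: "integrable lborel (\<lambda>\<eta>. gauss \<eta> ?s \<xi> * (\<phi> \<eta> * gauss 0 \<tau> \<eta>))" for \<xi>
    proof (subst integrable_lborel_affine_iff[of "sqrt ?s" _ \<xi>, symmetric])
      show "integrable lborel (\<lambda>x. gauss (\<xi> + sqrt ?s *\<^sub>R x) ?s \<xi> * (\<phi> (\<xi> + sqrt ?s *\<^sub>R x) * gauss 0 \<tau> (\<xi> + sqrt ?s *\<^sub>R x)))"
        using L_int[of \<xi> n] s by (simp add: gauss_def e_def power_mult_distrib)
    qed (use s in auto)
    have inn_n: "(\<integral>\<eta>. \<bar>gauss \<eta> ?s \<xi> * (\<phi> \<eta> * gauss 0 \<tau> \<eta>)\<bar> \<partial>lborel) \<le> sqrt ?s ^ 3 * (K * sqrt (2 * pi) ^ 3 * gauss 0 (2 * \<tau>) \<xi>)" for \<xi>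
    proof -
      have "(\<integral>\<eta>. \<bar>gauss \<eta> ?s \<xi> * (\<phi> \<eta> * gauss 0 \<tau> \<eta>)\<bar> \<partial>lborel) =
          sqrt ?s ^ 3 * (\<integral>z. \<bar>e z * (\<phi> (\<xi> + sqrt ?s *\<^sub>R z) * gauss 0 \<tau> (\<xi> + sqrt ?s *\<^sub>R z))\<bar> \<partial>lborel)"
        using s by (subst integral_lborel_affine[of "sqrt ?s" _ \<xi>])
           (auto simp: gauss_def e_def power_mult_distrib)
      also have "\<dots> \<le> sqrt ?s ^ 3 * (\<integral>z. K * gauss 0 (2 * \<tau>) \<xi> * exp (- (norm (z::real^3))\<^sup>2 / 2) \<partial>lborel)"
        using s by (intro mult_left_mono integral_mono integrable_abs L_int b_int bnd) auto
      also have "\<dots> = sqrt ?s ^ 3 * (K * sqrt (2 * pi) ^ 3 * gauss 0 (2 * \<tau>) \<xi>)"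
        using integrable_gaussian(2)[of 2, where 'a="real^3"] by (simp add: mult_ac)
      finally show ?thesis .
    qed
    have i: "integrable (lborel \<Otimes>\<^sub>M lborel) (\<lambda>(\<xi>, \<eta>). h \<xi> * (gauss \<eta> ?s \<xi> * (\<phi> \<eta> * gauss 0 \<tau> \<eta>)))"
    proof (rule lborel_pair.Fubini_integrable)
      show "AE \<xi> in lborel. integrable lborel (\<lambda>\<eta>. case (\<xi>, \<eta>) of (\<xi>, \<eta>) \<Rightarrow> h \<xi> * (gauss \<eta> ?s \<xi> * (\<phi> \<eta> * gauss 0 \<tau> \<eta>)))"
        using inn_i by simp
      show "integrable lborel (\<lambda>\<xi>. \<integral>\<eta>. norm (case (\<xi>, \<eta>) of (\<xi>, \<eta>) \<Rightarrow> h \<xi> * (gauss \<eta> ?s \<xi> * (\<phi> \<eta> * gauss 0 \<tau> \<eta>))) \<partial>lborel)"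
      proof (rule Bochner_Integration.integrable_bound)
        show "integrable lborel (\<lambda>\<xi>. sqrt ?s ^ 3 * K * sqrt (2 * pi) ^ 3 * (h \<xi> * gauss 0 (2 * \<tau>) \<xi>))"
          using h[of "2 * \<tau>"] \<tau> by simp
        show "AE \<xi> in lborel. norm (\<integral>\<eta>. norm (case (\<xi>, \<eta>) of (\<xi>, \<eta>) \<Rightarrow> h \<xi> * (gauss \<eta> ?s \<xi> * (\<phi> \<eta> * gauss 0 \<tau> \<eta>))) \<partial>lborel)
            \<le> norm (sqrt ?s ^ 3 * K * sqrt (2 * pi) ^ 3 * (h \<xi> * gauss 0 (2 * \<tau>) \<xi>))"
        proof (rule AE_I2)
          fix \<xi>
          have "norm (\<integral>\<eta>. norm (case (\<xi>, \<eta>) of (\<xi>, \<eta>) \<Rightarrow> h \<xi> * (gauss \<eta> ?s \<xi> * (\<phi> \<eta> * gauss 0 \<tau> \<eta>))) \<partial>lborel)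
              = \<bar>h \<xi>\<bar> * (\<integral>\<eta>. \<bar>gauss \<eta> ?s \<xi> * (\<phi> \<eta> * gauss 0 \<tau> \<eta>)\<bar> \<partial>lborel)"
            by (simp add: abs_mult)
          also have "\<dots> \<le> \<bar>h \<xi>\<bar> * (sqrt ?s ^ 3 * (K * sqrt (2 * pi) ^ 3 * gauss 0 (2 * \<tau>) \<xi>))"
            by (intro mult_left_mono inn_n) auto
          also have "\<dots> = norm (sqrt ?s ^ 3 * K * sqrt (2 * pi) ^ 3 * (h \<xi> * gauss 0 (2 * \<tau>) \<xi>))"
            using s K0 by (simp add: abs_mult gauss_nonneg mult_ac)
          finally show "norm (\<integral>\<eta>. norm (case (\<xi>, \<eta>) of (\<xi>, \<eta>) \<Rightarrow> h \<xi> * (gauss \<eta> ?s \<xi> * (\<phi> \<eta> * gauss 0 \<tau> \<eta>))) \<partial>lborel)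
            \<le> norm (sqrt ?s ^ 3 * K * sqrt (2 * pi) ^ 3 * (h \<xi> * gauss 0 (2 * \<tau>) \<xi>))" .
        qed
      qed measurable
    qed measurable
    have "(\<integral>\<eta>. (\<integral>\<xi>. h \<xi> * gauss \<eta> ?s \<xi> \<partial>lborel) * (\<phi> \<eta> * gauss 0 \<tau> \<eta>) \<partial>lborel)
        = (\<integral>\<eta>. \<integral>\<xi>. h \<xi> * (gauss \<eta> ?s \<xi> * (\<phi> \<eta> * gauss 0 \<tau> \<eta>)) \<partial>lborel \<partial>lborel)"
      by (simp add: mult.assoc[symmetric])
    also have "\<dots> = (\<integral>\<xi>. \<integral>\<eta>. h \<xi> * (gauss \<eta> ?s \<xi> * (\<phi> \<eta> * gauss 0 \<tau> \<eta>)) \<partial>lborel \<partial>lborel)"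
      by (rule lborel_pair.Fubini_integral[OF i])
    also have "\<dots> = (\<integral>\<xi>. h \<xi> * (sqrt ?s ^ 3 * L n \<xi>) \<partial>lborel)"
      by (simp only: integral_mult_right_zero inn)
    also have "\<dots> = (\<integral>\<xi>. sqrt ?s ^ 3 * (h \<xi> * L n \<xi>) \<partial>lborel)"
      by (simp only: mult.left_commute)
    also have "\<dots> = sqrt ?s ^ 3 * (\<integral>\<xi>. h \<xi> * L n \<xi> \<partial>lborel)"
      by (rule integral_mult_right_zero)
    finally show ?thesis
      using s by (simp add: real_sqrt_mult power_mult_distrib field_simps)
  qed
  have "(\<lambda>n. \<integral>\<xi>. h \<xi> * (L n \<xi> / sqrt pi ^ 3) \<partial>lborel) \<longlonglongrightarrow> (\<integral>\<xi>. h \<xi> * \<phi> \<xi> * gauss 0 \<tau> \<xi> \<partial>lborel)"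
  proof (rule integral_dominated_convergence)
    show "integrable lborel (\<lambda>\<xi>. K * sqrt (2 * pi) ^ 3 / sqrt pi ^ 3 * \<bar>h \<xi> * gauss 0 (2 * \<tau>) \<xi>\<bar>)"
      using h[of "2 * \<tau>"] \<tau> by (intro integrable_mult_right integrable_abs) auto
    show "AE \<xi> in lborel. (\<lambda>n. h \<xi> * (L n \<xi> / sqrt pi ^ 3)) \<longlonglongrightarrow> h \<xi> * \<phi> \<xi> * gauss 0 \<tau> \<xi>"
    proof (rule AE_I2)
      fix \<xi>
      have "(\<lambda>n. h \<xi> * (L n \<xi> / sqrt pi ^ 3)) \<longlonglongrightarrow> h \<xi> * (sqrt pi ^ 3 * (\<phi> \<xi> * gauss 0 \<tau> \<xi>) / sqrt pi ^ 3)"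
        by (intro tendsto_intros L_lim) auto
      then show "(\<lambda>n. h \<xi> * (L n \<xi> / sqrt pi ^ 3)) \<longlonglongrightarrow> h \<xi> * \<phi> \<xi> * gauss 0 \<tau> \<xi>"
        by (simp add: mult.assoc)
    qed
    show "AE \<xi> in lborel. norm (h \<xi> * (L n \<xi> / sqrt pi ^ 3)) \<le> K * sqrt (2 * pi) ^ 3 / sqrt pi ^ 3 * \<bar>h \<xi> * gauss 0 (2 * \<tau>) \<xi>\<bar>" for n
    proof (rule AE_I2)
      fix \<xi>
      have "norm (h \<xi> * (L n \<xi> / sqrt pi ^ 3)) = \<bar>h \<xi>\<bar> * (\<bar>L n \<xi>\<bar> / sqrt pi ^ 3)"
        by (simp add: abs_mult)
      also have "\<dots> \<le> \<bar>h \<xi>\<bar> * ((K * sqrt (2 * pi) ^ 3 * gauss 0 (2 * \<tau>) \<xi>) / sqrt pi ^ 3)"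
        by (intro mult_left_mono divide_right_mono L_le) auto
      finally show "norm (h \<xi> * (L n \<xi> / sqrt pi ^ 3)) \<le> K * sqrt (2 * pi) ^ 3 / sqrt pi ^ 3 * \<bar>h \<xi> * gauss 0 (2 * \<tau>) \<xi>\<bar>"
        by (simp add: abs_mult gauss_nonneg mult_ac)
    qed
  qed measurable
  then show ?thesis unfolding main .
qed


section \<open>L^m and L^2 bounds for pairs satisfying \<open>is_FT\<close>\<close>

text \<open>The test function of width \<open>4 / \<sigma>\<close> has a multiple of the Gaussian of
  width \<sigma> as its transform, so the second integrability clause of \<open>is_FT\<close> says
  that \<open>f\<close> is integrable against every centred Gaussian. Measurability of
  \<open>f\<close> follows on dividing by the positive Gaussian.\<close>

lemma is_FT_measurable:
  assumes "is_FT f F"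
  shows "F \<in> borel_measurable borel" and "f \<in> borel_measurable borel"
    and "\<And>\<sigma>. 0 < \<sigma> \<Longrightarrow> integrable lborel (\<lambda>x. f x * gauss 0 \<sigma> x)"
proof -
  show "F \<in> borel_measurable borel" using assms by (simp add: is_FT_def)
  show i: "integrable lborel (\<lambda>x. f x * gauss 0 \<sigma> x)" if \<sigma>: "0 < \<sigma>" for \<sigma>
  proof -
    have s: "0 < 4 / \<sigma>" using \<sigma> by simp
    have "integrable lborel (\<lambda>x. complex_of_real (f x) * ft1 (\<lambda>\<xi>. complex_of_real (gauss 0 (4 / \<sigma>) \<xi>)) x)"
      using assms s unfolding is_FT_def by blast
    then have "integrable lborel (\<lambda>x. complex_of_real (f x) * complex_of_real (sqrt (pi * (4 / \<sigma>)) ^ 3 * gauss 0 \<sigma> x))"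
      unfolding ft1_gauss[OF s] by (simp add: gauss_def)
    then have "integrable lborel (\<lambda>x. sqrt (pi * (4 / \<sigma>)) ^ 3 * (f x * gauss 0 \<sigma> x))"
      by (subst complex_of_real_integrable_eq[symmetric]) (simp add: mult_ac)
    then show ?thesis using \<sigma> by (subst (asm) integrable_mult_left_iff) auto
  qed
  have [measurable]: "(\<lambda>x. f x * gauss 0 1 x) \<in> borel_measurable borel"
    using i[of 1] by auto
  have "(\<lambda>x. (f x * gauss 0 1 x) / gauss 0 1 x) \<in> borel_measurable borel" by measurable
  then show "f \<in> borel_measurable borel" by (simp add: gauss_def)
qed

lemma is_FT_convolution:
  assumes FT: "is_FT f F" and \<sigma>: "0 < \<sigma>"
  shows "integrable lborel (\<lambda>\<xi>. F \<xi> * complex_of_real (gauss \<eta> \<sigma> \<xi>))"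
    and "(\<integral>\<xi>. F \<xi> * complex_of_real (gauss \<eta> \<sigma> \<xi>) \<partial>lborel) =
      complex_of_real (sqrt (pi * \<sigma>) ^ 3) * ft1 (\<lambda>x. complex_of_real (f x * gauss 0 (4 / \<sigma>) x)) \<eta>"
proof -
  show "integrable lborel (\<lambda>\<xi>. F \<xi> * complex_of_real (gauss \<eta> \<sigma> \<xi>))"
    using FT \<sigma> unfolding is_FT_def by blast
  have "(\<integral>\<xi>. F \<xi> * complex_of_real (gauss \<eta> \<sigma> \<xi>) \<partial>lborel) =
      (\<integral>x. complex_of_real (f x) * ft1 (\<lambda>\<xi>. complex_of_real (gauss \<eta> \<sigma> \<xi>)) x \<partial>lborel)"
    using FT \<sigma> unfolding is_FT_def by blast
  also have "\<dots> = (\<integral>x. complex_of_real (sqrt (pi * \<sigma>) ^ 3) *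
      (complex_of_real (f x * gauss 0 (4 / \<sigma>) x) * cis (- (\<eta> \<bullet> x))) \<partial>lborel)"
    unfolding ft1_gauss[OF \<sigma>] by (simp add: gauss_def mult_ac inner_commute)
  also have "\<dots> = complex_of_real (sqrt (pi * \<sigma>) ^ 3) * ft1 (\<lambda>x. complex_of_real (f x * gauss 0 (4 / \<sigma>) x)) \<eta>"
    unfolding ft1_def by (rule integral_mult_right_zero)
  finally show "(\<integral>\<xi>. F \<xi> * complex_of_real (gauss \<eta> \<sigma> \<xi>) \<partial>lborel) =
      complex_of_real (sqrt (pi * \<sigma>) ^ 3) * ft1 (\<lambda>x. complex_of_real (f x * gauss 0 (4 / \<sigma>) x)) \<eta>" .
qed

text \<open>The duality lemma is about real functions, so \<open>P\<close> is later taken to be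
  \<open>Re\<close> and \<open>Im\<close>. The smoothed \<open>P (F _)\<close> is, up to
  normalisation, \<open>P\<close> of the classical transform of \<open>f\<close> times a Gaussian.
  The L^m norm of that product is at most that of \<open>f\<close>, so its energy is bounded
  uniformly in the width.\<close>

lemma is_FT_part_bound:
  fixes P :: "complex \<Rightarrow> real"
  assumes FT: "is_FT f F" and f: "memLp m f" and m: "1 \<le> m" "m \<le> 2" and \<epsilon>: "0 < \<epsilon>"
    and P: "bounded_linear P" "\<And>z. \<bar>P z\<bar> \<le> cmod z"
  shows "(\<integral>\<^sup>+\<xi>. ennreal ((P (F \<xi>))\<^sup>2 * gauss 0 (1 / \<epsilon>) \<xi>) \<partial>lborel) \<le>
    ennreal (HY_const * \<epsilon> powr (3/2 - 3 / m) * (\<integral>x. \<bar>f x\<bar> powr m \<partial>lborel) powr (2 / m))"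
proof -
  define M where "M = HY_const * \<epsilon> powr (3/2 - 3 / m) * (\<integral>x. \<bar>f x\<bar> powr m \<partial>lborel) powr (2 / m)"
  have M0: "0 \<le> M" unfolding M_def using HY_const_pos by (intro mult_nonneg_nonneg) auto
  have \<tau>: "0 < 1 / \<epsilon>" using \<epsilon> by simp
  interpret P: bounded_linear P by (rule P)
  have [measurable]: "P \<in> borel_measurable borel"
    by (intro borel_measurable_continuous_onI P.continuous_on continuous_on_id)
  have [measurable]: "F \<in> borel_measurable borel" "f \<in> borel_measurable borel"
    using is_FT_measurable[OF FT] by auto
  have hi: "integrable lborel (\<lambda>\<xi>. P (F \<xi>) * gauss \<eta> \<sigma> \<xi>)"
    and hI: "(\<integral>\<xi>. P (F \<xi>) * gauss \<eta> \<sigma> \<xi> \<partial>lborel) = sqrt (pi * \<sigma>) ^ 3 * P (ft1 (\<lambda>x. complex_of_real (f x * gauss 0 (4 / \<sigma>) x)) \<eta>)"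
    if \<sigma>: "0 < \<sigma>" for \<sigma> \<eta>
  proof -
    have PF: "P (F \<xi> * complex_of_real (gauss \<eta> \<sigma> \<xi>)) = P (F \<xi>) * gauss \<eta> \<sigma> \<xi>" for \<xi>
      using P.scaleR[of "gauss \<eta> \<sigma> \<xi>" "F \<xi>"] by (simp add: scaleR_conv_of_real mult.commute)
    note C = is_FT_convolution[OF FT \<sigma>, of \<eta>]
    show "integrable lborel (\<lambda>\<xi>. P (F \<xi>) * gauss \<eta> \<sigma> \<xi>)"
      using integrable_bounded_linear[OF P(1) C(1)] unfolding PF .
    have "(\<integral>\<xi>. P (F \<xi>) * gauss \<eta> \<sigma> \<xi> \<partial>lborel) = P (\<integral>\<xi>. F \<xi> * complex_of_real (gauss \<eta> \<sigma> \<xi>) \<partial>lborel)"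
      unfolding PF[symmetric] by (rule integral_bounded_linear[OF P(1) C(1)])
    also have "\<dots> = sqrt (pi * \<sigma>) ^ 3 * P (ft1 (\<lambda>x. complex_of_real (f x * gauss 0 (4 / \<sigma>) x)) \<eta>)"
      unfolding C(2) using P.scaleR[of "sqrt (pi * \<sigma>) ^ 3"] by (simp add: scaleR_conv_of_real)
    finally show "(\<integral>\<xi>. P (F \<xi>) * gauss \<eta> \<sigma> \<xi> \<partial>lborel) = sqrt (pi * \<sigma>) ^ 3 * P (ft1 (\<lambda>x. complex_of_real (f x * gauss 0 (4 / \<sigma>) x)) \<eta>)" .
  qed
  have "(\<integral>\<^sup>+\<xi>. ennreal ((P (F \<xi>))\<^sup>2 * gauss 0 (1 / \<epsilon>) \<xi>) \<partial>lborel) \<le> ennreal (4 * (M / 2) * (1 / 2))"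
  proof (rule weighted_L2_bound_by_duality)
    fix \<phi> :: "real^3 \<Rightarrow> real" and K
    assume \<phi>: "continuous_on UNIV \<phi>" "\<And>x. \<bar>\<phi> x\<bar> \<le> K"
    have [measurable]: "\<phi> \<in> borel_measurable borel" by (rule borel_measurable_continuous_onI[OF \<phi>(1)])
    \<comment> \<open>Widths tending to 0 that stay below half of the weight's width
      \<open>1 / \<epsilon>\<close>, as the mollification lemma demands.\<close>
    define \<sigma> where "\<sigma> = (\<lambda>n::nat. inverse (real (Suc n)) * (1 / (2 * \<epsilon>)))"
    have \<sigma>: "0 < \<sigma> n" "\<sigma> n \<le> (1 / \<epsilon>) / 2" for n
    proof -
      have "inverse (real (Suc n)) \<le> 1" by (simp add: field_simps)
      then have "\<sigma> n \<le> 1 * (1 / (2 * \<epsilon>))"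
        unfolding \<sigma>_def using \<epsilon> by (intro mult_right_mono) auto
      then show "\<sigma> n \<le> (1 / \<epsilon>) / 2" by simp
    qed (use \<epsilon> in \<open>simp add: \<sigma>_def\<close>)
    have "\<sigma> \<longlonglongrightarrow> 0 * (1 / (2 * \<epsilon>))" unfolding \<sigma>_def
      by (intro tendsto_mult LIMSEQ_inverse_real_of_nat tendsto_const)
    then have \<sigma>l: "\<sigma> \<longlonglongrightarrow> 0" by simp
    have "(\<lambda>n. (\<integral>\<eta>. (\<integral>\<xi>. P (F \<xi>) * gauss \<eta> (\<sigma> n) \<xi> \<partial>lborel) * (\<phi> \<eta> * gauss 0 (1 / \<epsilon>) \<eta>) \<partial>lborel) / sqrt (pi * \<sigma> n) ^ 3)
      \<longlonglongrightarrow> (\<integral>\<xi>. P (F \<xi>) * \<phi> \<xi> * gauss 0 (1 / \<epsilon>) \<xi> \<partial>lborel)"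
      by (rule gauss_mollifier_tendsto[where K=K]) (use hi \<phi> \<tau> \<sigma> \<sigma>l in auto)
    moreover have "(\<integral>\<eta>. (\<integral>\<xi>. P (F \<xi>) * gauss \<eta> (\<sigma> n) \<xi> \<partial>lborel) * (\<phi> \<eta> * gauss 0 (1 / \<epsilon>) \<eta>) \<partial>lborel) / sqrt (pi * \<sigma> n) ^ 3
      \<le> M / 2 + 1 / 2 * (\<integral>x. (\<phi> x)\<^sup>2 * gauss 0 (1 / \<epsilon>) x \<partial>lborel)" for n
    proof -
      define g where "g = (\<lambda>x. f x * gauss 0 (4 / \<sigma> n) x)"
      define G where "G = ft1 (\<lambda>x. complex_of_real (g x))"
      have s4: "0 < 4 / \<sigma> n" using \<sigma> by simp
      have g: "integrable lborel g" unfolding g_def by (rule is_FT_measurable(3)[OF FT s4])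
      then have [measurable]: "g \<in> borel_measurable borel" by auto
      have gf: "\<bar>g x\<bar> powr m \<le> \<bar>f x\<bar> powr m" for x
        using gauss_le_1[OF s4] m by (intro powr_mono2) (auto simp: g_def abs_mult gauss_nonneg intro!: mult_left_le)
      have fm: "integrable lborel (\<lambda>x. \<bar>f x\<bar> powr m)" using f by (simp add: memLp_def)
      have gm: "integrable lborel (\<lambda>x. \<bar>g x\<bar> powr m)"
        by (rule Bochner_Integration.integrable_bound[OF fm]) (use gf in auto)
      note E = ft1_gauss_energy[OF g gm m \<epsilon>, folded G_def]
      have "(\<integral>\<eta>. (cmod (G \<eta>))\<^sup>2 * gauss 0 (1 / \<epsilon>) \<eta> \<partial>lborel) \<le>
          HY_const * \<epsilon> powr (3/2 - 3 / m) * (\<integral>x. \<bar>g x\<bar> powr m \<partial>lborel) powr (2 / m)" by (rule E(2))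
      also have "\<dots> \<le> M" unfolding M_def
        using HY_const_pos m by (intro mult_left_mono powr_mono2 integral_mono gm fm gf) auto
      finally have EM: "(\<integral>\<eta>. (cmod (G \<eta>))\<^sup>2 * gauss 0 (1 / \<epsilon>) \<eta> \<partial>lborel) \<le> M" .
      have \<phi>i: "integrable lborel (\<lambda>x. (\<phi> x)\<^sup>2 * gauss 0 (1 / \<epsilon>) x)"
      proof (rule Bochner_Integration.integrable_bound[where f="\<lambda>x. K\<^sup>2 * gauss 0 (1 / \<epsilon>) x"])
        show "AE x in lborel. norm ((\<phi> x)\<^sup>2 * gauss 0 (1 / \<epsilon>) x) \<le> norm (K\<^sup>2 * gauss 0 (1 / \<epsilon>) x)"
          using order_trans[OF \<phi>(2) abs_ge_self] by (auto simp: abs_mult gauss_nonneg intro!: AE_I2 mult_right_mono abs_le_square_iff[THEN iffD1])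
      qed (use gauss_integrable[OF \<tau>] in auto)
      have [measurable]: "G \<in> borel_measurable borel"
        unfolding G_def by (rule ft1_measurable) (use g in auto)
      \<comment> \<open>Young's inequality produces the additive form of the duality test, with
        constants \<open>M / 2\<close> and \<open>1 / 2\<close>, chosen so that 4 (M/2) (1/2)
        returns exactly \<open>M\<close>.\<close>
      have pt: "P (G \<eta>) * (\<phi> \<eta> * gauss 0 (1 / \<epsilon>) \<eta>) \<le> 1/2 * ((cmod (G \<eta>))\<^sup>2 * gauss 0 (1 / \<epsilon>) \<eta>) + 1/2 * ((\<phi> \<eta>)\<^sup>2 * gauss 0 (1 / \<epsilon>) \<eta>)" for \<eta>
      proof -
        have "P (G \<eta>) * \<phi> \<eta> \<le> ((P (G \<eta>))\<^sup>2 + (\<phi> \<eta>)\<^sup>2) / 2"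
          using sum_squares_bound[of "P (G \<eta>)" "\<phi> \<eta>"] by simp
        also have "\<dots> \<le> ((cmod (G \<eta>))\<^sup>2 + (\<phi> \<eta>)\<^sup>2) / 2"
          using P(2)[of "G \<eta>"] by (auto intro!: abs_le_square_iff[THEN iffD1])
        finally have "P (G \<eta>) * \<phi> \<eta> * gauss 0 (1 / \<epsilon>) \<eta> \<le> ((cmod (G \<eta>))\<^sup>2 + (\<phi> \<eta>)\<^sup>2) / 2 * gauss 0 (1 / \<epsilon>) \<eta>"
          by (intro mult_right_mono gauss_nonneg)
        then show ?thesis by (simp add: field_simps)
      qed
      have "(\<integral>\<eta>. (\<integral>\<xi>. P (F \<xi>) * gauss \<eta> (\<sigma> n) \<xi> \<partial>lborel) * (\<phi> \<eta> * gauss 0 (1 / \<epsilon>) \<eta>) \<partial>lborel) / sqrt (pi * \<sigma> n) ^ 3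
          = (\<integral>\<eta>. P (G \<eta>) * (\<phi> \<eta> * gauss 0 (1 / \<epsilon>) \<eta>) \<partial>lborel)"
        unfolding hI[OF \<sigma>(1)] using \<sigma>[of n] by (simp add: G_def g_def mult.assoc)
      also have "\<dots> \<le> (\<integral>\<eta>. 1/2 * ((cmod (G \<eta>))\<^sup>2 * gauss 0 (1 / \<epsilon>) \<eta>) + 1/2 * ((\<phi> \<eta>)\<^sup>2 * gauss 0 (1 / \<epsilon>) \<eta>) \<partial>lborel)"
        using pt by (intro integral_mono_AE' Bochner_Integration.integrable_add integrable_mult_right E(1) \<phi>i)
          (auto intro!: AE_I2 add_nonneg_nonneg simp: gauss_nonneg)
      also have "\<dots> = 1/2 * (\<integral>\<eta>. (cmod (G \<eta>))\<^sup>2 * gauss 0 (1 / \<epsilon>) \<eta> \<partial>lborel) + 1/2 * (\<integral>x. (\<phi> x)\<^sup>2 * gauss 0 (1 / \<epsilon>) x \<partial>lborel)"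
        by (subst Bochner_Integration.integral_add) (use E(1) \<phi>i in \<open>auto intro!: integrable_mult_right\<close>)
      finally show ?thesis using EM by simp
    qed
    ultimately show "(\<integral>x. P (F x) * \<phi> x * gauss 0 (1 / \<epsilon>) x \<partial>lborel) \<le> M / 2 + 1 / 2 * (\<integral>x. (\<phi> x)\<^sup>2 * gauss 0 (1 / \<epsilon>) x \<partial>lborel)"
      by (intro LIMSEQ_le_const2) auto
  qed (use M0 hi \<tau> gauss_integrable[OF \<tau>] in \<open>auto simp: gauss_nonneg\<close>)
  also have "4 * (M / 2) * (1 / 2) = M" by simp
  finally show ?thesis unfolding M_def .
qed

lemma is_FT_gauss_bound:
  assumes FT: "is_FT f F" and f: "memLp m f" and m: "1 \<le> m" "m \<le> 2" and \<epsilon>: "0 < \<epsilon>"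
  shows "(\<integral>\<^sup>+\<xi>. ennreal ((cmod (F \<xi>))\<^sup>2 * gauss 0 (1 / \<epsilon>) \<xi>) \<partial>lborel) \<le>
    ennreal (2 * HY_const * \<epsilon> powr (3/2 - 3 / m) * (Lp_norm m f)\<^sup>2)"
proof -
  have [measurable]: "F \<in> borel_measurable borel" by (rule is_FT_measurable[OF FT])
  have N: "(\<integral>x. \<bar>f x\<bar> powr m \<partial>lborel) powr (2 / m) = (Lp_norm m f)\<^sup>2"
  proof -
    have "(\<integral>x. \<bar>f x\<bar> powr m \<partial>lborel) powr (2 / m) = ((\<integral>x. \<bar>f x\<bar> powr m \<partial>lborel) powr (1 / m)) powr 2"
      by (simp add: powr_powr)
    then show ?thesis by (simp add: Lp_norm_def)
  qed
  let ?M = "HY_const * \<epsilon> powr (3/2 - 3 / m) * (Lp_norm m f)\<^sup>2"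
  have M0: "0 \<le> ?M" using HY_const_pos by (intro mult_nonneg_nonneg) auto
  have "(\<integral>\<^sup>+\<xi>. ennreal ((cmod (F \<xi>))\<^sup>2 * gauss 0 (1 / \<epsilon>) \<xi>) \<partial>lborel) =
      (\<integral>\<^sup>+\<xi>. ennreal ((Re (F \<xi>))\<^sup>2 * gauss 0 (1 / \<epsilon>) \<xi>) + ennreal ((Im (F \<xi>))\<^sup>2 * gauss 0 (1 / \<epsilon>) \<xi>) \<partial>lborel)"
    by (intro nn_integral_cong) (simp add: ennreal_plus[symmetric] gauss_nonneg cmod_power2 distrib_right del: ennreal_plus)
  also have "\<dots> = (\<integral>\<^sup>+\<xi>. ennreal ((Re (F \<xi>))\<^sup>2 * gauss 0 (1 / \<epsilon>) \<xi>) \<partial>lborel) + (\<integral>\<^sup>+\<xi>. ennreal ((Im (F \<xi>))\<^sup>2 * gauss 0 (1 / \<epsilon>) \<xi>) \<partial>lborel)"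
    by (rule nn_integral_add) measurable
  also have "\<dots> \<le> ennreal ?M + ennreal ?M"
    using is_FT_part_bound[OF FT f m \<epsilon> bounded_linear_Re] is_FT_part_bound[OF FT f m \<epsilon> bounded_linear_Im]
    by (intro add_mono) (auto simp: N abs_Re_le_cmod abs_Im_le_cmod)
  also have "\<dots> = ennreal (2 * HY_const * \<epsilon> powr (3/2 - 3 / m) * (Lp_norm m f)\<^sup>2)"
    using M0 by (simp add: ennreal_plus[symmetric] mult_ac del: ennreal_plus)
  finally show ?thesis .
qed

text \<open>Fatou's lemma along \<epsilon> = 1/(n+1); finiteness of the unweighted integral is a
  conclusion for finite \<open>B\<close>.\<close>

lemma nn_integral_gauss_limit:
  assumes [measurable]: "g \<in> borel_measurable borel" and g0: "\<And>x. 0 \<le> g x"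
    and bound: "\<And>\<epsilon>. 0 < \<epsilon> \<Longrightarrow> (\<integral>\<^sup>+x. ennreal (g x * gauss 0 (1 / \<epsilon>) x) \<partial>lborel) \<le> B"
  shows "(\<integral>\<^sup>+x. ennreal (g x) \<partial>lborel) \<le> B"
proof -
  let ?e = "\<lambda>n::nat. inverse (real (Suc n))"
  have "(\<integral>\<^sup>+x. ennreal (g x) \<partial>lborel) = (\<integral>\<^sup>+x. liminf (\<lambda>n. ennreal (g x * gauss 0 (1 / ?e n) x)) \<partial>lborel)"
  proof (rule nn_integral_cong)
    fix x
    have "(\<lambda>n. g x * exp (- ((norm x)\<^sup>2 * ?e n))) \<longlonglongrightarrow> g x * exp (- ((norm x)\<^sup>2 * 0))"
      by (intro tendsto_intros LIMSEQ_inverse_real_of_nat)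
    then have "(\<lambda>n. g x * gauss 0 (1 / ?e n) x) \<longlonglongrightarrow> g x"
      by (simp add: gauss_def)
    then have "(\<lambda>n. ennreal (g x * gauss 0 (1 / ?e n) x)) \<longlonglongrightarrow> ennreal (g x)"
      by (rule tendsto_ennrealI)
    then show "ennreal (g x) = liminf (\<lambda>n. ennreal (g x * gauss 0 (1 / ?e n) x))"
      by (metis lim_imp_Liminf sequentially_bot)
  qed
  also have "\<dots> \<le> liminf (\<lambda>n. \<integral>\<^sup>+x. ennreal (g x * gauss 0 (1 / ?e n) x) \<partial>lborel)"
    by (rule nn_integral_liminf) measurable
  also have "\<dots> \<le> B"
    by (rule Liminf_le) (auto intro!: always_eventually bound simp del: of_nat_Suc)
  finally show ?thesis .
qed

text \<open>For m = 2 the exponent 3/2 - 3/m vanishes, so the Gaussian bound is uniform in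
  \<epsilon> and the weight can be removed. This is one half of Plancherel, up to a
  constant.\<close>

lemma is_FT_L2_bound:
  assumes FT: "is_FT f F" and f: "memLp 2 f"
  shows "(\<integral>\<^sup>+\<xi>. ennreal ((cmod (F \<xi>))\<^sup>2) \<partial>lborel) \<le> ennreal (2 * HY_const * (Lp_norm 2 f)\<^sup>2)"
proof (rule nn_integral_gauss_limit)
  show "(\<lambda>\<xi>. (cmod (F \<xi>))\<^sup>2) \<in> borel_measurable borel"
    using is_FT_measurable(1)[OF FT] by measurable
  show "(\<integral>\<^sup>+\<xi>. ennreal ((cmod (F \<xi>))\<^sup>2 * gauss 0 (1 / \<epsilon>) \<xi>) \<partial>lborel) \<le> ennreal (2 * HY_const * (Lp_norm 2 f)\<^sup>2)"
    if "0 < \<epsilon>" for \<epsilon>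
    using is_FT_gauss_bound[OF FT f _ _ that] that by simp
qed simp

text \<open>On the ball of radius \<open>R\<close> the Gaussian weight with \<epsilon> = 1 / R^2 is
  at least exp(-1).\<close>

lemma is_FT_ball_bound:
  assumes FT: "is_FT f F" and f: "memLp m f" and m: "1 \<le> m" "m \<le> 2" and R: "0 < R"
  shows "(\<integral>\<^sup>+\<xi>. ennreal ((cmod (F \<xi>))\<^sup>2) * indicator {\<xi>. norm \<xi> \<le> R} \<xi> \<partial>lborel) \<le>
    ennreal (2 * exp 1 * HY_const * R powr (6 / m - 3) * (Lp_norm m f)\<^sup>2)"
proof -
  have [measurable]: "F \<in> borel_measurable borel" by (rule is_FT_measurable[OF FT])
  have R2: "0 < 1 / R\<^sup>2" using R by simp
  have "(\<integral>\<^sup>+\<xi>. ennreal ((cmod (F \<xi>))\<^sup>2) * indicator {\<xi>. norm \<xi> \<le> R} \<xi> \<partial>lborel) \<le>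
      (\<integral>\<^sup>+\<xi>. ennreal (exp 1) * ennreal ((cmod (F \<xi>))\<^sup>2 * gauss 0 (1 / (1 / R\<^sup>2)) \<xi>) \<partial>lborel)"
  proof (rule nn_integral_mono)
    fix \<xi> :: "real^3"
    have "(cmod (F \<xi>))\<^sup>2 \<le> exp 1 * ((cmod (F \<xi>))\<^sup>2 * gauss 0 (1 / (1 / R\<^sup>2)) \<xi>)" if "norm \<xi> \<le> R"
    proof -
      have "(norm \<xi>)\<^sup>2 / R\<^sup>2 \<le> 1" using that R by (simp add: power_mono)
      then have "1 \<le> exp 1 * gauss 0 (1 / (1 / R\<^sup>2)) \<xi>" by (simp add: gauss_def exp_add[symmetric])
      then have "(cmod (F \<xi>))\<^sup>2 * 1 \<le> (cmod (F \<xi>))\<^sup>2 * (exp 1 * gauss 0 (1 / (1 / R\<^sup>2)) \<xi>)"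
        by (intro mult_left_mono) auto
      then show ?thesis by (simp add: mult_ac)
    qed
    then show "ennreal ((cmod (F \<xi>))\<^sup>2) * indicator {\<xi>. norm \<xi> \<le> R} \<xi> \<le> ennreal (exp 1) * ennreal ((cmod (F \<xi>))\<^sup>2 * gauss 0 (1 / (1 / R\<^sup>2)) \<xi>)"
      by (auto simp: indicator_def ennreal_mult[symmetric] gauss_nonneg intro!: ennreal_leI)
  qed
  also have "\<dots> = ennreal (exp 1) * (\<integral>\<^sup>+\<xi>. ennreal ((cmod (F \<xi>))\<^sup>2 * gauss 0 (1 / (1 / R\<^sup>2)) \<xi>) \<partial>lborel)"
    by (rule nn_integral_cmult) measurable
  also have "\<dots> \<le> ennreal (exp 1) * ennreal (2 * HY_const * (1 / R\<^sup>2) powr (3/2 - 3 / m) * (Lp_norm m f)\<^sup>2)"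
    by (intro mult_left_mono is_FT_gauss_bound[OF FT f m R2]) auto
  also have "\<dots> = ennreal (exp 1 * (2 * HY_const * (1 / R\<^sup>2) powr (3/2 - 3 / m) * (Lp_norm m f)\<^sup>2))"
    using HY_const_pos by (subst ennreal_mult) auto
  also have "(1 / R\<^sup>2) powr (3/2 - 3 / m) = R powr (6 / m - 3)"
  proof -
    have "1 / R\<^sup>2 = R powr (-2)" using R by (simp add: powr_minus_divide)
    then have "(1 / R\<^sup>2) powr (3/2 - 3 / m) = R powr (-2 * (3/2 - 3 / m))" by (simp add: powr_powr)
    also have "-2 * (3/2 - 3 / m) = 6 / m - 3" by simp
    finally show ?thesis .
  qed
  finally show ?thesis by (simp add: mult_ac)
qed

text \<open>The Cauchy-Schwarz inequality for the Gaussian measure of mass \<open>K\<close>, read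
  off from the nonnegative integral of (|F| - c/K)^2.\<close>

lemma norm_convolution_gauss_le:
  assumes F: "integrable lborel (\<lambda>\<xi>. (cmod (F \<xi>))\<^sup>2)" and Fg: "integrable lborel (\<lambda>\<xi>. F \<xi> * complex_of_real (gauss \<eta> \<sigma> \<xi>))"
    and \<sigma>: "0 < \<sigma>"
  shows "(cmod (\<integral>\<xi>. F \<xi> * complex_of_real (gauss \<eta> \<sigma> \<xi>) \<partial>lborel))\<^sup>2 \<le>
    sqrt (pi * \<sigma>) ^ 3 * (\<integral>\<xi>. (cmod (F \<xi>))\<^sup>2 * gauss \<eta> \<sigma> \<xi> \<partial>lborel)"
proof -
  let ?g = "gauss \<eta> \<sigma>"
  define K where "K = sqrt (pi * \<sigma>) ^ 3"
  have K: "0 < K" using \<sigma> by (simp add: K_def)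
  note gi = gauss_integrable[OF \<sigma>, of \<eta>, folded K_def]
  have i1: "integrable lborel (\<lambda>\<xi>. cmod (F \<xi>) * ?g \<xi>)"
    using integrable_norm[OF Fg] by (simp add: norm_mult gauss_nonneg)
  have i2: "integrable lborel (\<lambda>\<xi>. (cmod (F \<xi>))\<^sup>2 * ?g \<xi>)"
    by (rule integrable_of_real_mult_gauss[OF F \<sigma>])
  define c where "c = (\<integral>\<xi>. cmod (F \<xi>) * ?g \<xi> \<partial>lborel)"
  have "cmod (\<integral>\<xi>. F \<xi> * complex_of_real (?g \<xi>) \<partial>lborel) \<le> (\<integral>\<xi>. cmod (F \<xi> * complex_of_real (?g \<xi>)) \<partial>lborel)"
    by (rule integral_norm_bound)
  then have le: "cmod (\<integral>\<xi>. F \<xi> * complex_of_real (?g \<xi>) \<partial>lborel) \<le> c"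
    by (simp add: c_def norm_mult gauss_nonneg)
  have "0 \<le> (\<integral>\<xi>. (cmod (F \<xi>) - c / K)\<^sup>2 * ?g \<xi> \<partial>lborel)"
    by (intro integral_nonneg_AE AE_I2 mult_nonneg_nonneg gauss_nonneg) auto
  also have "\<dots> = (\<integral>\<xi>. (cmod (F \<xi>))\<^sup>2 * ?g \<xi> - 2 * (c / K) * (cmod (F \<xi>) * ?g \<xi>) + (c / K)\<^sup>2 * ?g \<xi> \<partial>lborel)"
    by (intro Bochner_Integration.integral_cong refl) (simp add: power2_diff algebra_simps)
  also have "\<dots> = (\<integral>\<xi>. (cmod (F \<xi>))\<^sup>2 * ?g \<xi> \<partial>lborel) - 2 * (c / K) * c + (c / K)\<^sup>2 * K"
    using i1 i2 gi by (simp add: c_def)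
  also have "\<dots> = (\<integral>\<xi>. (cmod (F \<xi>))\<^sup>2 * ?g \<xi> \<partial>lborel) - c\<^sup>2 / K"
    using K by (simp add: power_divide power2_eq_square field_simps)
  finally have "c\<^sup>2 \<le> K * (\<integral>\<xi>. (cmod (F \<xi>))\<^sup>2 * ?g \<xi> \<partial>lborel)"
    using K by (simp add: field_simps)
  moreover have "(cmod (\<integral>\<xi>. F \<xi> * complex_of_real (?g \<xi>) \<partial>lborel))\<^sup>2 \<le> c\<^sup>2"
    using le by (intro power_mono) auto
  ultimately show ?thesis unfolding K_def by linarith
qed

text \<open>The other half of Plancherel, needed to return from frequency to physical space. It is
  again a duality argument: \<open>f\<close> times a Gaussian has a classical transform whose energy
  is at most that of \<open>F\<close>, since it is a normalised Gaussian average of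
  \<open>F\<close>. The Gaussian Parseval identity pairs it with a test function, whose energy is
  controlled by \<open>ft1_gauss_energy\<close> with m = 2.\<close>

lemma is_FT_L2_inverse_bound:
  assumes FT: "is_FT f F" and F: "integrable lborel (\<lambda>\<xi>. (cmod (F \<xi>))\<^sup>2)"
  shows "(\<integral>\<^sup>+x. ennreal ((f x)\<^sup>2) \<partial>lborel) \<le> ennreal (HY_const * (\<integral>\<xi>. (cmod (F \<xi>))\<^sup>2 \<partial>lborel))"
proof (rule nn_integral_gauss_limit)
  have [measurable]: "F \<in> borel_measurable borel" "f \<in> borel_measurable borel"
    using is_FT_measurable[OF FT] by auto
  show "(\<lambda>x. (f x)\<^sup>2) \<in> borel_measurable borel" by measurable
  fix \<epsilon>0 :: real assume \<epsilon>0: "0 < \<epsilon>0"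
  \<comment> \<open>The weight exp(-4 \<delta> |x|^2) has to be shared out: \<open>h\<close> carries
    one \<delta> and appears squared, \<open>w\<close> carries two. The pairing of \<open>h\<close>,
    \<phi> and \<open>w\<close> is then also the pairing of \<open>g\<close>, with two, and
    \<open>\<psi>\<close>, with one, and the square of \<open>\<psi>\<close> is \<phi>^2 times
    \<open>w\<close>.\<close>
  define \<delta> where "\<delta> = \<epsilon>0 / 4"
  have \<delta>: "0 < \<delta>" "\<epsilon>0 = 4 * \<delta>" using \<epsilon>0 by (auto simp: \<delta>_def)
  define I where "I = (\<integral>\<xi>. (cmod (F \<xi>))\<^sup>2 \<partial>lborel)"
  have I0: "0 \<le> I" unfolding I_def by simp
  define c where "c = (2 * pi) ^ 3"
  have c1: "1 \<le> c" unfolding c_def using pi_gt3 by (intro one_le_power) auto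
  define h where "h = (\<lambda>x. f x * gauss 0 (1 / \<delta>) x)"
  define w where "w = gauss 0 (1 / (2 * \<delta>))"
  define g where "g = (\<lambda>x. f x * gauss 0 (1 / (2 * \<delta>)) x)"
  have fi: "integrable lborel (\<lambda>x. f x * gauss 0 \<sigma> x)" if "0 < \<sigma>" for \<sigma>
    by (rule is_FT_measurable(3)[OF FT that])
  have d2: "0 < 1 / (2 * \<delta>)" and d1: "0 < 1 / \<delta>" using \<delta> by auto
  have gint: "integrable lborel g" unfolding g_def by (rule fi[OF d2])
  have gE: "integrable lborel (\<lambda>\<eta>. (cmod (ft1 (\<lambda>x. complex_of_real (g x)) \<eta>))\<^sup>2)"
    "(\<integral>\<eta>. (cmod (ft1 (\<lambda>x. complex_of_real (g x)) \<eta>))\<^sup>2 \<partial>lborel) \<le> I"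
  proof -
    \<comment> \<open>The width dual to \<open>1 / (2 * \<delta>)\<close>: smoothing
      \<open>F\<close> at this width amounts to damping \<open>f\<close> to
      \<open>g\<close>.\<close>
    define \<sigma> where "\<sigma> = 8 * \<delta>"
    have \<sigma>: "0 < \<sigma>" "1 / (2 * \<delta>) = 4 / \<sigma>" using \<delta> by (auto simp: \<sigma>_def)
    define K where "K = sqrt (pi * \<sigma>) ^ 3"
    have K: "0 < K" using \<sigma> by (simp add: K_def)
    note pg = integrable_pair_gauss[OF F _ \<sigma>(1), simplified]
    have [measurable]: "ft1 (\<lambda>x. complex_of_real (g x)) \<in> borel_measurable borel"
      by (rule ft1_measurable) (use gint in auto)
    have le: "(cmod (ft1 (\<lambda>x. complex_of_real (g x)) \<eta>))\<^sup>2 \<le> (\<integral>\<xi>. (cmod (F \<xi>))\<^sup>2 * gauss \<eta> \<sigma> \<xi> \<partial>lborel) / K" for \<eta>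
    proof -
      have "(cmod (complex_of_real K * ft1 (\<lambda>x. complex_of_real (g x)) \<eta>))\<^sup>2 \<le> K * (\<integral>\<xi>. (cmod (F \<xi>))\<^sup>2 * gauss \<eta> \<sigma> \<xi> \<partial>lborel)"
        using norm_convolution_gauss_le[OF F is_FT_convolution(1)[OF FT \<sigma>(1)] \<sigma>(1), of \<eta>]
        unfolding is_FT_convolution(2)[OF FT \<sigma>(1)] g_def \<sigma>(2) K_def .
      then show ?thesis using K by (simp add: norm_mult power_mult_distrib power2_eq_square field_simps)
    qed
    have i: "integrable lborel (\<lambda>\<eta>. (\<integral>\<xi>. (cmod (F \<xi>))\<^sup>2 * gauss \<eta> \<sigma> \<xi> \<partial>lborel) / K)"
      using lborel_pair.integrable_fst[OF pg(3)] by simp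
    show "integrable lborel (\<lambda>\<eta>. (cmod (ft1 (\<lambda>x. complex_of_real (g x)) \<eta>))\<^sup>2)"
    proof (rule Bochner_Integration.integrable_bound[OF i])
      show "AE \<eta> in lborel. norm ((cmod (ft1 (\<lambda>x. complex_of_real (g x)) \<eta>))\<^sup>2) \<le>
          norm ((\<integral>\<xi>. (cmod (F \<xi>))\<^sup>2 * gauss \<eta> \<sigma> \<xi> \<partial>lborel) / K)"
        using order_trans[OF le abs_ge_self] by (intro AE_I2) (simp only: real_norm_def abs_power2)
    qed measurable
    then have "(\<integral>\<eta>. (cmod (ft1 (\<lambda>x. complex_of_real (g x)) \<eta>))\<^sup>2 \<partial>lborel) \<le> (\<integral>\<eta>. (\<integral>\<xi>. (cmod (F \<xi>))\<^sup>2 * gauss \<eta> \<sigma> \<xi> \<partial>lborel) / K \<partial>lborel)"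
      by (intro integral_mono i le)
    also have "\<dots> = I"
      using lborel_pair.integral_fst[OF pg(3)] pg(4) K \<sigma>(1) by (simp add: I_def K_def)
    finally show "(\<integral>\<eta>. (cmod (ft1 (\<lambda>x. complex_of_real (g x)) \<eta>))\<^sup>2 \<partial>lborel) \<le> I" .
  qed
  have prods: "gauss 0 (1 / \<delta>) x * gauss 0 (1 / (2 * \<delta>)) x = gauss 0 (1 / (3 * \<delta>)) x"
     "(gauss 0 (1 / \<delta>) x)\<^sup>2 = gauss 0 (1 / (2 * \<delta>)) x"
     "gauss 0 (1 / (2 * \<delta>)) x * gauss 0 (1 / (2 * \<delta>)) x = gauss 0 (1 / \<epsilon>0) x" for x
    by (simp_all add: gauss_def exp_add[symmetric] power2_eq_square \<delta> algebra_simps)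
  have "(\<integral>\<^sup>+x. ennreal ((h x)\<^sup>2 * w x) \<partial>lborel) \<le> ennreal (4 * (I / (2 * c)) * (HY_const / (2 * c)))"
  proof (rule weighted_L2_bound_by_duality)
    show "h \<in> borel_measurable borel" unfolding h_def by measurable
    show "integrable lborel w" "\<And>x. 0 \<le> w x"
      unfolding w_def using gauss_integrable[OF d2] by (auto simp: gauss_nonneg)
    show "integrable lborel (\<lambda>x. h x * w x)"
      using fi[of "1 / (3 * \<delta>)"] \<delta> by (simp add: h_def w_def mult.assoc prods)
    show "0 < HY_const / (2 * c)" "0 \<le> I / (2 * c)" using c1 HY_const_pos I0 by auto
    fix \<phi> :: "real^3 \<Rightarrow> real" and B
    assume \<phi>: "continuous_on UNIV \<phi>" "\<And>x. \<bar>\<phi> x\<bar> \<le> B"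
    have [measurable]: "\<phi> \<in> borel_measurable borel" by (rule borel_measurable_continuous_onI[OF \<phi>(1)])
    define \<psi> where "\<psi> = (\<lambda>x. \<phi> x * gauss 0 (1 / \<delta>) x)"
    have \<psi>1: "integrable lborel \<psi>"
    proof (rule Bochner_Integration.integrable_bound[where f="\<lambda>x. B * gauss 0 (1 / \<delta>) x"])
      show "AE x in lborel. norm (\<psi> x) \<le> norm (B * gauss 0 (1 / \<delta>) x)"
        using order_trans[OF \<phi>(2) abs_ge_self] by (auto simp: \<psi>_def abs_mult gauss_nonneg intro!: AE_I2 mult_right_mono)
    qed (use gauss_integrable[OF d1] in \<open>auto simp: \<psi>_def\<close>)
    have \<psi>sq: "(\<psi> x)\<^sup>2 = (\<phi> x)\<^sup>2 * w x" for x
      by (simp add: \<psi>_def w_def power_mult_distrib prods)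
    have \<psi>2: "integrable lborel (\<lambda>x. (\<psi> x)\<^sup>2)"
      unfolding \<psi>sq
    proof (rule Bochner_Integration.integrable_bound[where f="\<lambda>x. B\<^sup>2 * w x"])
      show "AE x in lborel. norm ((\<phi> x)\<^sup>2 * w x) \<le> norm (B\<^sup>2 * w x)"
        using order_trans[OF \<phi>(2) abs_ge_self] by (auto simp: abs_mult intro!: AE_I2 mult_right_mono abs_le_square_iff[THEN iffD1])
    qed (use gauss_integrable[OF d2] in \<open>auto simp: w_def\<close>)
    define Q where "Q = (\<integral>x. (\<phi> x)\<^sup>2 * w x \<partial>lborel)"
    define \<epsilon> where "\<epsilon> = (\<lambda>n::nat. inverse (real (Suc n)) * (1 / (8 * \<delta>)))"
    have \<epsilon>: "0 < \<epsilon> n" "0 < 4 * \<epsilon> n" "4 * \<epsilon> n \<le> (1 / \<delta>) / 2" for n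
    proof -
      have "inverse (real (Suc n)) \<le> 1" by (simp add: field_simps)
      then have "\<epsilon> n \<le> 1 * (1 / (8 * \<delta>))"
        unfolding \<epsilon>_def using \<delta> by (intro mult_right_mono) auto
      then show "4 * \<epsilon> n \<le> (1 / \<delta>) / 2" by simp
    qed (use \<delta> in \<open>simp_all add: \<epsilon>_def\<close>)
    have "(\<lambda>n. 4 * \<epsilon> n) \<longlonglongrightarrow> 4 * (0 * (1 / (8 * \<delta>)))" unfolding \<epsilon>_def
      by (intro tendsto_mult LIMSEQ_inverse_real_of_nat tendsto_const)
    then have \<epsilon>l: "(\<lambda>n. 4 * \<epsilon> n) \<longlonglongrightarrow> 0" by simp
    have gg: "integrable lborel (\<lambda>x. g x * gauss 0 \<sigma> x)" if "0 < \<sigma>" for \<sigma>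
      by (rule integrable_of_real_mult_gauss[OF gint that])
    have [measurable]: "g \<in> borel_measurable borel" using gint by auto
    have "(\<lambda>n. (\<integral>\<eta>. (\<integral>\<xi>. g \<xi> * gauss \<eta> (4 * \<epsilon> n) \<xi> \<partial>lborel) * (\<phi> \<eta> * gauss 0 (1 / \<delta>) \<eta>) \<partial>lborel) / sqrt (pi * (4 * \<epsilon> n)) ^ 3)
      \<longlonglongrightarrow> (\<integral>\<xi>. g \<xi> * \<phi> \<xi> * gauss 0 (1 / \<delta>) \<xi> \<partial>lborel)"
      by (rule gauss_mollifier_tendsto[where K=B]) (use gg \<phi> d1 \<epsilon> \<epsilon>l in auto)
    moreover have "(\<integral>\<eta>. (\<integral>\<xi>. g \<xi> * gauss \<eta> (4 * \<epsilon> n) \<xi> \<partial>lborel) * (\<phi> \<eta> * gauss 0 (1 / \<delta>) \<eta>) \<partial>lborel) / sqrt (pi * (4 * \<epsilon> n)) ^ 3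
        \<le> I / (2 * c) + HY_const / (2 * c) * Q" for n
    proof -
      let ?e = "\<epsilon> n" and ?G = "ft1 (\<lambda>x. complex_of_real (g x))" and ?P = "ft1 (\<lambda>x. complex_of_real (\<psi> x))"
      let ?k = "gauss 0 (1 / ?e)"
      have e: "0 < 1 / ?e" using \<epsilon>(1)[of n] by simp
      have \<psi>p: "integrable lborel (\<lambda>x. \<bar>\<psi> x\<bar> powr 2)" using \<psi>2 by simp
      note E = ft1_gauss_energy[OF \<psi>1 \<psi>p _ _ \<epsilon>(1)[of n], simplified]
      note Pa = parseval_gauss[OF \<psi>1 gint \<epsilon>(1)[of n]]
      have EP: "(\<integral>\<eta>. (cmod (?P \<eta>))\<^sup>2 * ?k \<eta> \<partial>lborel) \<le> HY_const * Q"
        using E(2) \<epsilon>(1)[of n] by (simp add: Q_def \<psi>sq)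
      have i1: "integrable lborel (\<lambda>\<eta>. (cmod (?G \<eta>))\<^sup>2 * ?k \<eta>)"
        by (rule integrable_of_real_mult_gauss[OF gE(1) e])
      have "(\<integral>\<eta>. (cmod (?G \<eta>))\<^sup>2 * ?k \<eta> \<partial>lborel) \<le> (\<integral>\<eta>. (cmod (?G \<eta>))\<^sup>2 \<partial>lborel)"
        by (intro integral_mono i1 gE(1) mult_left_le gauss_le_1[OF e]) auto
      then have EG: "(\<integral>\<eta>. (cmod (?G \<eta>))\<^sup>2 * ?k \<eta> \<partial>lborel) \<le> I" using gE(2) by linarith
      have pt: "Re (?P \<eta> * cnj (?G \<eta>)) * ?k \<eta> \<le> 1/2 * ((cmod (?G \<eta>))\<^sup>2 * ?k \<eta>) + 1/2 * ((cmod (?P \<eta>))\<^sup>2 * ?k \<eta>)" for \<eta>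
      proof -
        have "Re (?P \<eta> * cnj (?G \<eta>)) \<le> cmod (?P \<eta>) * cmod (?G \<eta>)"
          using complex_Re_le_cmod[of "?P \<eta> * cnj (?G \<eta>)"] by (simp add: norm_mult)
        also have "\<dots> \<le> ((cmod (?G \<eta>))\<^sup>2 + (cmod (?P \<eta>))\<^sup>2) / 2"
          using sum_squares_bound[of "cmod (?P \<eta>)" "cmod (?G \<eta>)"] by simp
        finally have "Re (?P \<eta> * cnj (?G \<eta>)) * ?k \<eta> \<le> ((cmod (?G \<eta>))\<^sup>2 + (cmod (?P \<eta>))\<^sup>2) / 2 * ?k \<eta>"
          by (intro mult_right_mono gauss_nonneg)
        then show ?thesis by (simp add: field_simps)
      qed
      have "(\<integral>\<eta>. Re (?P \<eta> * cnj (?G \<eta>)) * ?k \<eta> \<partial>lborel) \<le>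
          (\<integral>\<eta>. 1/2 * ((cmod (?G \<eta>))\<^sup>2 * ?k \<eta>) + 1/2 * ((cmod (?P \<eta>))\<^sup>2 * ?k \<eta>) \<partial>lborel)"
        by (intro integral_mono Pa(1) pt Bochner_Integration.integrable_add integrable_mult_right i1 E(1))
      also have "\<dots> = 1/2 * (\<integral>\<eta>. (cmod (?G \<eta>))\<^sup>2 * ?k \<eta> \<partial>lborel) + 1/2 * (\<integral>\<eta>. (cmod (?P \<eta>))\<^sup>2 * ?k \<eta> \<partial>lborel)"
        by (subst Bochner_Integration.integral_add) (use E(1) i1 in \<open>auto intro!: integrable_mult_right\<close>)
      finally have main: "(\<integral>\<eta>. Re (?P \<eta> * cnj (?G \<eta>)) * ?k \<eta> \<partial>lborel) \<le> (I + HY_const * Q) / 2"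
        using EP EG by simp
      let ?X = "\<integral>\<eta>. \<psi> \<eta> * (\<integral>\<xi>. g \<xi> * gauss \<eta> (4 * ?e) \<xi> \<partial>lborel) \<partial>lborel"
      \<comment> \<open>The Parseval factor and the mollifier mass multiply to the (2 pi)^3 of
        Plancherel's formula. Only \<open>1 \<le> c\<close> is used afterwards.\<close>
      have cc: "sqrt (pi / ?e) ^ 3 * sqrt (pi * (4 * ?e)) ^ 3 = c"
      proof -
        have "sqrt (pi / ?e) * sqrt (pi * (4 * ?e)) = sqrt ((2 * pi)\<^sup>2)"
          using \<epsilon>(1)[of n] unfolding real_sqrt_mult[symmetric] by (simp add: power2_eq_square)
        also have "\<dots> = 2 * pi" by (simp only: real_sqrt_abs) simp
        finally show ?thesis unfolding c_def power_mult_distrib[symmetric] by simp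
      qed
      have "?X / sqrt (pi * (4 * ?e)) ^ 3 = (sqrt (pi / ?e) ^ 3 * ?X) / c"
        using \<epsilon>(1)[of n] c1 unfolding cc[symmetric] by simp
      also have "\<dots> \<le> ((I + HY_const * Q) / 2) / c"
        using main unfolding Pa(2) using c1 by (intro divide_right_mono) auto
      also have "\<dots> = I / (2 * c) + HY_const / (2 * c) * Q" by (simp add: add_divide_distrib)
      finally show ?thesis by (simp add: \<psi>_def mult.commute)
    qed
    ultimately have "(\<integral>\<xi>. g \<xi> * \<phi> \<xi> * gauss 0 (1 / \<delta>) \<xi> \<partial>lborel) \<le> I / (2 * c) + HY_const / (2 * c) * Q"
      by (intro LIMSEQ_le_const2) auto
    also have "(\<integral>\<xi>. g \<xi> * \<phi> \<xi> * gauss 0 (1 / \<delta>) \<xi> \<partial>lborel) = (\<integral>x. h x * \<phi> x * w x \<partial>lborel)"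
      by (simp add: g_def h_def w_def mult_ac)
    finally show "(\<integral>x. h x * \<phi> x * w x \<partial>lborel) \<le> I / (2 * c) + HY_const / (2 * c) * (\<integral>x. (\<phi> x)\<^sup>2 * w x \<partial>lborel)"
      by (simp add: Q_def)
  qed
  also have "\<dots> \<le> ennreal (HY_const * I)"
  proof (rule ennreal_leI)
    have "4 * (I / (2 * c)) * (HY_const / (2 * c)) = HY_const * I * (1 / (c * c))" by simp
    also have "\<dots> \<le> HY_const * I * 1"
    proof (rule mult_left_mono)
      have "1 * 1 \<le> c * c" using c1 by (intro mult_mono) auto
      then show "1 / (c * c) \<le> 1" by simp
    qed (use I0 HY_const_pos in auto)
    finally show "4 * (I / (2 * c)) * (HY_const / (2 * c)) \<le> HY_const * I" by simp
  qed
  finally show "(\<integral>\<^sup>+x. ennreal ((f x)\<^sup>2 * gauss 0 (1 / \<epsilon>0) x) \<partial>lborel) \<le> ennreal (HY_const * (\<integral>\<xi>. (cmod (F \<xi>))\<^sup>2 \<partial>lborel))"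
    by (simp add: h_def w_def power_mult_distrib mult.assoc prods I_def)
qed simp

section \<open>Damped second order systems\<close>


text \<open>Gronwall's argument: exp(\<kappa> t) f(t) has nonpositive derivative in the interior and
  is continuous up to 0, where only a one-sided derivative exists.\<close>

lemma exp_decay_of_deriv_le:
  fixes f :: "real \<Rightarrow> real"
  assumes f: "\<And>t. 0 \<le> t \<Longrightarrow> (f has_real_derivative f' t) (at t within {0..})"
    and le: "\<And>t. 0 \<le> t \<Longrightarrow> f' t \<le> - \<kappa> * f t" and t: "0 \<le> t"
  shows "f t \<le> exp (- \<kappa> * t) * f 0"
proof -
  have d: "((\<lambda>t. exp (\<kappa> * t) * f t) has_real_derivative exp (\<kappa> * x) * (\<kappa> * f x + f' x)) (at x within {0..})"
    if "0 \<le> x" for x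
    by (rule derivative_eq_intros f[OF that] refl)+ (simp add: algebra_simps)
  have "exp (\<kappa> * t) * f t \<le> exp (\<kappa> * 0) * f 0"
  proof (rule DERIV_nonpos_imp_decreasing_open[OF t])
    fix x assume x: "0 < x" "x < t"
    have "at x within {0..} = at x" using x by (intro at_within_interior) auto
    moreover have "exp (\<kappa> * x) * (\<kappa> * f x + f' x) \<le> 0"
      using le[of x] x by (intro mult_nonneg_nonpos) auto
    ultimately show "\<exists>y. ((\<lambda>t. exp (\<kappa> * t) * f t) has_real_derivative y) (at x) \<and> y \<le> 0"
      using d[of x] x by auto
  next
    show "continuous_on {0..t} (\<lambda>t. exp (\<kappa> * t) * f t)"
    proof (rule continuous_on_subset)
      show "continuous_on {0..} (\<lambda>t. exp (\<kappa> * t) * f t)"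
        by (rule DERIV_continuous_on[OF d]) auto
    qed auto
  qed
  then have "exp (- \<kappa> * t) * (exp (\<kappa> * t) * f t) \<le> exp (- \<kappa> * t) * f 0"
    by (intro mult_left_mono) auto
  then show ?thesis by (simp add: mult.assoc[symmetric] exp_add[symmetric])
qed

section \<open>Constants and Lyapunov estimates for a single frequency\<close>

locale damping_constants =
  fixes a2 b2 :: real
  assumes a2_pos: "0 < a2" and a2_le: "a2 \<le> b2"
begin

text \<open>The bound 2/3 lets the dissipation of the velocity absorb the coefficient 3/2 of
  \<open>\<Phi>_upper\<close>; the bound a2 / (b2 + 1) does the same for the displacement.\<close>

definition \<kappa> :: real where "\<kappa> = min (2 / 3) (a2 / (b2 + 1))"
text \<open>Quotient of the constant b2 + 2, by which the Lyapunov functionals are bounded above at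
  time 0, and the smaller of their lower constants 1/6 and \<open>a2\<close>.\<close>

definition K :: real where "K = (b2 + 2) / min (1 / 6) a2"
text \<open>The factors arise for short times in \<open>U_decay_time\<close>: integrating the
  velocity gives 2 (1 + sqrt K)^2, and inserting the decaying exponential costs exp 1.\<close>

definition K' :: real where "K' = 2 * exp 1 * (1 + sqrt K)\<^sup>2"

lemma \<kappa>: "0 < \<kappa>" "\<kappa> \<le> 2 / 3" "\<kappa> * (b2 + 1) \<le> a2"
proof -
  show "0 < \<kappa>" using a2_pos a2_le by (simp add: \<kappa>_def)
  show "\<kappa> \<le> 2 / 3" by (simp only: \<kappa>_def min.cobounded1)
  have "\<kappa> * (b2 + 1) \<le> a2 / (b2 + 1) * (b2 + 1)"
    using a2_pos a2_le by (intro mult_right_mono) (auto simp: \<kappa>_def)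
  then show "\<kappa> * (b2 + 1) \<le> a2" using a2_pos a2_le by simp
qed

lemma K_ge: "1 \<le> K" "b2 + 2 \<le> K * (1 / 6)" "b2 + 2 \<le> K * a2"
proof -
  have mn: "0 < min (1 / 6) a2" using a2_pos a2_le by simp
  then have Km: "K * min (1 / 6) a2 = b2 + 2"
    unfolding K_def by (intro nonzero_eq_divide_eq[THEN iffD1]) auto
  have K0: "0 \<le> K" unfolding K_def using mn a2_pos a2_le by (intro divide_nonneg_pos) auto
  have "K * min (1 / 6) a2 \<le> K * (1 / 6)" "K * min (1 / 6) a2 \<le> K * a2"
    by (rule mult_left_mono[OF min.cobounded1 K0], rule mult_left_mono[OF min.cobounded2 K0])
  then show "b2 + 2 \<le> K * (1 / 6)" "b2 + 2 \<le> K * a2" unfolding Km .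
  then show "1 \<le> K" using a2_pos a2_le by linarith
qed

lemma K'_ge: "K \<le> K'" "1 \<le> K'"
proof -
  have "K \<le> (1 + sqrt K)\<^sup>2"
    using K_ge by (simp add: power2_sum)
  also have "\<dots> = 1 * (1 + sqrt K)\<^sup>2" by simp
  also have "\<dots> \<le> K'" unfolding K'_def
    using exp_ge_add_one_self[of "1::real"] by (intro mult_right_mono) auto
  finally show "K \<le> K'" .
  then show "1 \<le> K'" using K_ge by linarith
qed

end

text \<open>One frequency of the problem: \<open>r\<close> is |\<xi>|, \<open>p\<close> is its power
  2\<theta>, and the state space will be \<open>complex^3\<close> as a real Euclidean space. Apart
  from linearity and symmetry, \<open>A\<close> is known only through its bounds relative to r^2,
  which is why the resulting constants do not depend on the frequency.\<close>

locale damped_system = damping_constants a2 b2 for a2 b2 :: real +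
  fixes A :: "'a::euclidean_space \<Rightarrow> 'a" and p r :: real and U V :: "real \<Rightarrow> 'a"
  assumes lin: "linear A" and sym: "A x \<bullet> y = x \<bullet> A y"
    and lower: "a2 * r\<^sup>2 * (norm x)\<^sup>2 \<le> A x \<bullet> x" and upper: "norm (A x) \<le> b2 * r\<^sup>2 * norm x"
    and p_pos: "0 < p" and r_pos: "0 < r"
    and dU: "0 \<le> t \<Longrightarrow> (U has_vector_derivative V t) (at t within {0..})"
    and dV: "0 \<le> t \<Longrightarrow> (V has_vector_derivative - (A (U t) + p *\<^sub>R V t)) (at t within {0..})"
begin

lemmas pos = p_pos r_pos a2_pos a2_le

definition rate :: real where "rate = min p (r\<^sup>2 / p)"
text \<open>A family of Lyapunov functionals: \<open>d = rate / 2\<close> yields decay of the energy at all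
  frequencies, while \<open>d = p / 2\<close> also controls \<open>p * norm U\<close>, which is the larger quantity
  in the overdamped regime \<open>r \<le> p\<close>.\<close>
definition \<Phi> :: "real \<Rightarrow> real \<Rightarrow> real" where
  "\<Phi> d t = (norm (V t))\<^sup>2 + A (U t) \<bullet> U t + d * (2 * (U t \<bullet> V t) + p * (norm (U t))\<^sup>2)"

lemma rate: "0 < rate" "rate \<le> p" "rate * p \<le> r\<^sup>2"
  using pos by (auto simp: rate_def min_def field_simps)

lemma energy_upper: "A x \<bullet> x \<le> b2 * r\<^sup>2 * (norm x)\<^sup>2"
proof -
  have "A x \<bullet> x \<le> norm (A x) * norm x" by (rule norm_cauchy_schwarz)
  also have "\<dots> \<le> (b2 * r\<^sup>2 * norm x) * norm x" by (intro mult_right_mono upper) auto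
  finally show ?thesis by (simp add: power2_eq_square mult.assoc)
qed

text \<open>The term d p |U|^2 in \<open>\<Phi>\<close> is there to cancel the cross term -2 d p (U,
  V) from differentiating 2 d (U, V); symmetry of \<open>A\<close> cancels the remaining cross
  terms, and pure dissipation is left.\<close>

lemma \<Phi>_deriv:
  assumes "0 \<le> t"
  shows "(\<Phi> d has_real_derivative (- 2 * (p - d) * (norm (V t))\<^sup>2 - 2 * d * (A (U t) \<bullet> U t))) (at t within {0..})"
proof -
  interpret A: bounded_linear A using lin by (rule linear_conv_bounded_linear[THEN iffD1])
  have s: "U t \<bullet> A (V t) = V t \<bullet> A (U t)" by (metis sym inner_commute)
  note dU' = dU[OF assms, unfolded has_vector_derivative_def]
    and dV' = dV[OF assms, unfolded has_vector_derivative_def]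
  have "((\<lambda>t. V t \<bullet> V t + A (U t) \<bullet> U t + d * (2 * (U t \<bullet> V t) + p * (U t \<bullet> U t))) has_derivative
     (\<lambda>h. h * (- 2 * (p - d) * (norm (V t))\<^sup>2 - 2 * d * (A (U t) \<bullet> U t)))) (at t within {0..})"
    apply (rule derivative_eq_intros dU' dV' A.has_derivative refl)+
    apply (rule ext)
    apply (simp add: A.scaleR power2_norm_eq_inner inner_add_left inner_add_right s algebra_simps inner_commute)
    done
  moreover have "(\<lambda>h. h * (- 2 * (p - d) * (norm (V t))\<^sup>2 - 2 * d * (A (U t) \<bullet> U t))) =
      (*) (- 2 * (p - d) * (norm (V t))\<^sup>2 - 2 * d * (A (U t) \<bullet> U t))"
    by (rule ext) (rule mult.commute)
  ultimately show ?thesis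
    by (simp only: has_field_derivative_def \<Phi>_def[abs_def] power2_norm_eq_inner)
qed

lemma \<Phi>_upper:
  assumes "0 \<le> d" "d \<le> p / 2"
  shows "\<Phi> d t \<le> 3 / 2 * (norm (V t))\<^sup>2 + (b2 * r\<^sup>2 + 2 * d * p) * (norm (U t))\<^sup>2"
proof -
  have "2 * d * (U t \<bullet> V t) \<le> 2 * d * (norm (U t) * norm (V t))"
    using assms by (intro mult_left_mono norm_cauchy_schwarz) auto
  moreover have "2 * d * (norm (U t) * norm (V t)) \<le> 2 * d\<^sup>2 * (norm (U t))\<^sup>2 + 1 / 2 * (norm (V t))\<^sup>2"
    using sum_squares_bound[of "2 * d * norm (U t)" "norm (V t)"] by (simp add: power_mult_distrib)
  moreover have "2 * d\<^sup>2 * (norm (U t))\<^sup>2 \<le> d * p * (norm (U t))\<^sup>2"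
  proof (rule mult_right_mono)
    have "d * (2 * d) \<le> d * p" using assms by (intro mult_left_mono) auto
    then show "2 * d\<^sup>2 \<le> d * p" by (simp add: power2_eq_square)
  qed auto
  ultimately show ?thesis using energy_upper[of "U t"] unfolding \<Phi>_def by (simp add: algebra_simps)
qed

text \<open>Dissipation is compared with \<open>\<Phi>_upper\<close> coefficient by coefficient. The
  velocity part needs only d <= p/2; the displacement part is the hypothesis \<open>dr\<close>, left
  open because the two choices of \<open>d\<close> satisfy it for different reasons.\<close>

lemma \<Phi>_decay:
  assumes d: "0 \<le> d" "d \<le> p / 2" and dr: "\<kappa> * rate * (b2 * r\<^sup>2 + 2 * d * p) \<le> 2 * d * (a2 * r\<^sup>2)" and t: "0 \<le> t"
  shows "\<Phi> d t \<le> exp (- (\<kappa> * rate) * t) * \<Phi> d 0"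
proof (rule exp_decay_of_deriv_le[OF \<Phi>_deriv _ t])
  fix t :: real
  have "\<kappa> * rate * \<Phi> d t \<le> \<kappa> * rate * (3 / 2 * (norm (V t))\<^sup>2 + (b2 * r\<^sup>2 + 2 * d * p) * (norm (U t))\<^sup>2)"
    using \<kappa> rate by (intro mult_left_mono \<Phi>_upper d) auto
  also have "\<dots> = (\<kappa> * rate * (3 / 2)) * (norm (V t))\<^sup>2 + (\<kappa> * rate * (b2 * r\<^sup>2 + 2 * d * p)) * (norm (U t))\<^sup>2"
    by (simp add: algebra_simps)
  also have "\<dots> \<le> p * (norm (V t))\<^sup>2 + (2 * d * (a2 * r\<^sup>2)) * (norm (U t))\<^sup>2"
  proof (intro add_mono mult_right_mono dr)
    have "\<kappa> * rate \<le> 2 / 3 * p" using \<kappa> rate by (intro mult_mono) auto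
    then show "\<kappa> * rate * (3 / 2) \<le> p" by simp
  qed auto
  also have "\<dots> \<le> 2 * (p - d) * (norm (V t))\<^sup>2 + 2 * d * (A (U t) \<bullet> U t)"
  proof (intro add_mono mult_right_mono)
    have "2 * d * (a2 * r\<^sup>2 * (norm (U t))\<^sup>2) \<le> 2 * d * (A (U t) \<bullet> U t)"
      using d by (intro mult_left_mono lower) auto
    then show "2 * d * (a2 * r\<^sup>2) * (norm (U t))\<^sup>2 \<le> 2 * d * (A (U t) \<bullet> U t)" by (simp add: mult.assoc)
  qed (use d in auto)
  finally show "- 2 * (p - d) * (norm (V t))\<^sup>2 - 2 * d * (A (U t) \<bullet> U t) \<le> - (\<kappa> * rate) * \<Phi> d t"
    by (simp add: algebra_simps)
qed

text \<open>For d = rate/2 the extra terms of \<open>\<Phi>\<close> are of size rate * p <= r^2 on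
  the displacement, so \<open>\<Phi>\<close> is comparable to the natural energy in both damping
  regimes.\<close>

lemma energy_decay:
  assumes t: "0 \<le> t"
  shows "(norm (V t))\<^sup>2 + r\<^sup>2 * (norm (U t))\<^sup>2 \<le> K * exp (- (\<kappa> * rate) * t) * ((norm (V 0))\<^sup>2 + r\<^sup>2 * (norm (U 0))\<^sup>2)"
proof -
  let ?d = "rate / 2"
  have d: "0 \<le> ?d" "?d \<le> p / 2" using rate by auto
  have dr: "\<kappa> * rate * (b2 * r\<^sup>2 + 2 * ?d * p) \<le> 2 * ?d * (a2 * r\<^sup>2)"
  proof -
    have "\<kappa> * rate * (b2 * r\<^sup>2 + 2 * ?d * p) \<le> \<kappa> * rate * (b2 * r\<^sup>2 + r\<^sup>2)"
      using \<kappa> rate by (intro mult_left_mono) auto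
    also have "\<dots> = rate * r\<^sup>2 * (\<kappa> * (b2 + 1))" by (simp add: algebra_simps)
    also have "\<dots> \<le> rate * r\<^sup>2 * a2" using \<kappa> rate by (intro mult_left_mono) auto
    finally show ?thesis by (simp add: mult_ac)
  qed
  have lo: "1 / 2 * (norm (V t))\<^sup>2 + a2 * r\<^sup>2 * (norm (U t))\<^sup>2 \<le> \<Phi> ?d t"
  proof -
    have "rate * (norm (U t) * norm (V t)) \<le> 1 / 2 * (rate\<^sup>2 * (norm (U t))\<^sup>2) + 1 / 2 * (norm (V t))\<^sup>2"
      using sum_squares_bound[of "rate * norm (U t)" "norm (V t)"] by (simp add: power_mult_distrib)
    moreover have "- (rate * (U t \<bullet> V t)) \<le> rate * (norm (U t) * norm (V t))"
      using mult_left_mono[OF norm_cauchy_schwarz[of "- U t" "V t"], of rate] rate by simp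
    moreover have "rate\<^sup>2 * (norm (U t))\<^sup>2 \<le> rate * p * (norm (U t))\<^sup>2"
      using rate by (intro mult_right_mono) (auto simp: power2_eq_square)
    ultimately show ?thesis using lower[of "U t"] unfolding \<Phi>_def by (simp add: algebra_simps)
  qed
  have up: "\<Phi> ?d 0 \<le> (b2 + 2) * ((norm (V 0))\<^sup>2 + r\<^sup>2 * (norm (U 0))\<^sup>2)"
  proof -
    have "(b2 * r\<^sup>2 + 2 * ?d * p) * (norm (U 0))\<^sup>2 \<le> ((b2 + 2) * r\<^sup>2) * (norm (U 0))\<^sup>2"
    proof (rule mult_right_mono)
      have "2 * ?d * p = rate * p" by simp
      then show "b2 * r\<^sup>2 + 2 * ?d * p \<le> (b2 + 2) * r\<^sup>2"
        using rate(3) zero_le_power2[of r] unfolding distrib_right by linarith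
    qed auto
    moreover have "3 / 2 * (norm (V 0))\<^sup>2 \<le> (b2 + 2) * (norm (V 0))\<^sup>2"
      using pos by (intro mult_right_mono) auto
    ultimately show ?thesis using \<Phi>_upper[OF d, of 0] by (simp add: algebra_simps)
  qed
  have "(b2 + 2) * ((norm (V t))\<^sup>2 + r\<^sup>2 * (norm (U t))\<^sup>2) \<le> K * (1 / 2 * (norm (V t))\<^sup>2 + a2 * r\<^sup>2 * (norm (U t))\<^sup>2)"
  proof -
    have "(b2 + 2) * (norm (V t))\<^sup>2 \<le> (K * (1 / 2)) * (norm (V t))\<^sup>2"
      using K_ge by (intro mult_right_mono) auto
    moreover have "(b2 + 2) * (r\<^sup>2 * (norm (U t))\<^sup>2) \<le> (K * a2) * (r\<^sup>2 * (norm (U t))\<^sup>2)"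
      using K_ge by (intro mult_right_mono) auto
    ultimately show ?thesis by (simp add: algebra_simps)
  qed
  also have "\<dots> \<le> K * (exp (- (\<kappa> * rate) * t) * ((b2 + 2) * ((norm (V 0))\<^sup>2 + r\<^sup>2 * (norm (U 0))\<^sup>2)))"
    using K_ge by (intro mult_left_mono order_trans[OF lo] order_trans[OF \<Phi>_decay[OF d dr t]] up) auto
  finally have "(b2 + 2) * ((norm (V t))\<^sup>2 + r\<^sup>2 * (norm (U t))\<^sup>2) \<le>
      (b2 + 2) * (K * exp (- (\<kappa> * rate) * t) * ((norm (V 0))\<^sup>2 + r\<^sup>2 * (norm (U 0))\<^sup>2))"
    by (simp add: mult_ac)
  then show ?thesis using pos by simp
qed

text \<open>For d = p/2 the term d p |U|^2 dominates r^2 |U|^2 and \<open>\<Phi>\<close> is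
  comparable to the larger quantity with p^2. This is where r <= p enters.\<close>

lemma overdamped_decay:
  assumes pr: "r \<le> p" and t: "0 \<le> t"
  shows "(norm (V t))\<^sup>2 + p\<^sup>2 * (norm (U t))\<^sup>2 \<le> K * exp (- (\<kappa> * rate) * t) * ((norm (V 0))\<^sup>2 + p\<^sup>2 * (norm (U 0))\<^sup>2)"
proof -
  let ?d = "p / 2"
  have d: "0 \<le> ?d" "?d \<le> p / 2" using pos by auto
  have rp: "r\<^sup>2 \<le> p\<^sup>2" using pr pos by (intro power_mono) auto
  have dr: "\<kappa> * rate * (b2 * r\<^sup>2 + 2 * ?d * p) \<le> 2 * ?d * (a2 * r\<^sup>2)"
  proof -
    have "rate * (b2 * r\<^sup>2 + 2 * ?d * p) = b2 * r\<^sup>2 * rate + p * (rate * p)" by (simp add: algebra_simps)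
    also have "\<dots> \<le> b2 * r\<^sup>2 * p + p * r\<^sup>2"
      using rate pos by (intro add_mono mult_left_mono) auto
    finally have "\<kappa> * (rate * (b2 * r\<^sup>2 + 2 * ?d * p)) \<le> \<kappa> * (b2 * r\<^sup>2 * p + p * r\<^sup>2)"
      using \<kappa> by (intro mult_left_mono) auto
    also have "\<dots> = p * r\<^sup>2 * (\<kappa> * (b2 + 1))" by (simp add: algebra_simps)
    also have "\<dots> \<le> p * r\<^sup>2 * a2" using \<kappa> pos by (intro mult_left_mono) auto
    finally show ?thesis by (simp add: mult_ac)
  qed
  have lo: "1 / 6 * ((norm (V t))\<^sup>2 + p\<^sup>2 * (norm (U t))\<^sup>2) \<le> \<Phi> ?d t"
  proof -
    \<comment> \<open>Equal weights in Young's inequality would use up the whole term p^2 |U|^2 / 2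
      of \<open>\<Phi>\<close>; the weights 1/3 and 3/4 leave 1/6 and 1/4.\<close>
    have "p * (norm (U t) * norm (V t)) \<le> 1 / 3 * (p\<^sup>2 * (norm (U t))\<^sup>2) + 3 / 4 * (norm (V t))\<^sup>2"
      using sum_squares_bound[of "p * norm (U t)" "3 / 2 * norm (V t)"] by (simp add: power_mult_distrib power_divide)
    moreover have "- (p * (U t \<bullet> V t)) \<le> p * (norm (U t) * norm (V t))"
      using mult_left_mono[OF norm_cauchy_schwarz[of "- U t" "V t"], of p] pos by simp
    moreover have "0 \<le> a2 * r\<^sup>2 * (norm (U t))\<^sup>2" using pos by simp
    moreover have "0 \<le> (norm (V t))\<^sup>2" by simp
    moreover have "?d * (2 * (U t \<bullet> V t) + p * (norm (U t))\<^sup>2) = p * (U t \<bullet> V t) + 1 / 2 * (p\<^sup>2 * (norm (U t))\<^sup>2)"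
      by (simp add: algebra_simps power2_eq_square)
    ultimately show ?thesis using lower[of "U t"] unfolding \<Phi>_def distrib_left by linarith
  qed
  have up: "\<Phi> ?d 0 \<le> (b2 + 2) * ((norm (V 0))\<^sup>2 + p\<^sup>2 * (norm (U 0))\<^sup>2)"
  proof -
    have "b2 * r\<^sup>2 \<le> b2 * p\<^sup>2" using rp pos by (intro mult_left_mono) auto
    then have "(b2 * r\<^sup>2 + 2 * ?d * p) * (norm (U 0))\<^sup>2 \<le> ((b2 + 2) * p\<^sup>2) * (norm (U 0))\<^sup>2"
    proof (intro mult_right_mono)
      assume "b2 * r\<^sup>2 \<le> b2 * p\<^sup>2"
      moreover have "2 * ?d * p = p\<^sup>2" by (simp add: power2_eq_square)
      ultimately show "b2 * r\<^sup>2 + 2 * ?d * p \<le> (b2 + 2) * p\<^sup>2"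
        using zero_le_power2[of p] unfolding distrib_right by linarith
    qed auto
    moreover have "3 / 2 * (norm (V 0))\<^sup>2 \<le> (b2 + 2) * (norm (V 0))\<^sup>2"
      using pos by (intro mult_right_mono) auto
    ultimately show ?thesis using \<Phi>_upper[OF d, of 0] by (simp add: algebra_simps)
  qed
  have "(b2 + 2) * ((norm (V t))\<^sup>2 + p\<^sup>2 * (norm (U t))\<^sup>2) \<le> K * (1 / 6) * ((norm (V t))\<^sup>2 + p\<^sup>2 * (norm (U t))\<^sup>2)"
    using K_ge by (intro mult_right_mono) auto
  also have "\<dots> = K * (1 / 6 * ((norm (V t))\<^sup>2 + p\<^sup>2 * (norm (U t))\<^sup>2))" by simp
  also have "\<dots> \<le> K * (exp (- (\<kappa> * rate) * t) * ((b2 + 2) * ((norm (V 0))\<^sup>2 + p\<^sup>2 * (norm (U 0))\<^sup>2)))"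
    using K_ge by (intro mult_left_mono order_trans[OF lo] order_trans[OF \<Phi>_decay[OF d dr t]] up) auto
  finally have "(b2 + 2) * ((norm (V t))\<^sup>2 + p\<^sup>2 * (norm (U t))\<^sup>2) \<le>
      (b2 + 2) * (K * exp (- (\<kappa> * rate) * t) * ((norm (V 0))\<^sup>2 + p\<^sup>2 * (norm (U 0))\<^sup>2))"
    by (simp add: mult_ac)
  then show ?thesis using pos by simp
qed

lemma max_decay:
  assumes t: "0 \<le> t"
  shows "(norm (V t))\<^sup>2 + (max p r)\<^sup>2 * (norm (U t))\<^sup>2 \<le> K * exp (- (\<kappa> * rate) * t) * ((norm (V 0))\<^sup>2 + (max p r)\<^sup>2 * (norm (U 0))\<^sup>2)"
proof (cases "r \<le> p")
  case True
  then have "max p r = p" by simp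
  then show ?thesis using overdamped_decay[OF True t] by simp
next
  case False
  then have "max p r = r" by simp
  then show ?thesis using energy_decay[OF t] by simp
qed

lemma U_decay:
  assumes t: "0 \<le> t"
  shows "(norm (U t))\<^sup>2 \<le> K * exp (- (\<kappa> * rate) * t) * ((norm (U 0))\<^sup>2 + (norm (V 0) / max p r)\<^sup>2)"
proof -
  let ?M = "max p r"
  have M: "0 < ?M" using pos by simp
  have "?M\<^sup>2 * (norm (U t))\<^sup>2 \<le> K * exp (- (\<kappa> * rate) * t) * ((norm (V 0))\<^sup>2 + ?M\<^sup>2 * (norm (U 0))\<^sup>2)"
    using max_decay[OF t] zero_le_power2[of "norm (V t)"] by linarith
  also have "(norm (V 0))\<^sup>2 + ?M\<^sup>2 * (norm (U 0))\<^sup>2 = ?M\<^sup>2 * ((norm (U 0))\<^sup>2 + (norm (V 0) / ?M)\<^sup>2)"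
    using M by (simp add: power_divide algebra_simps)
  finally have "?M\<^sup>2 * (norm (U t))\<^sup>2 \<le> ?M\<^sup>2 * (K * exp (- (\<kappa> * rate) * t) * ((norm (U 0))\<^sup>2 + (norm (V 0) / ?M)\<^sup>2))"
    by (simp add: mult_ac)
  then show ?thesis using M by simp
qed

lemma U_cont: "continuous_on {0..} U" and V_cont: "continuous_on {0..} V"
  by (rule continuous_on_vector_derivative[OF dU] continuous_on_vector_derivative[OF dV]; simp)+

lemma interior_deriv:
  assumes "0 < x"
  shows "(U has_vector_derivative V x) (at x)" and "(V has_vector_derivative - (A (U x) + p *\<^sub>R V x)) (at x)"
proof -
  have "at x within {0..} = at x" using assms by (intro at_within_interior) auto
  then show "(U has_vector_derivative V x) (at x)" "(V has_vector_derivative - (A (U x) + p *\<^sub>R V x)) (at x)"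
    using dU[of x] dV[of x] assms by auto
qed

text \<open>The factor 1 / max p r of \<open>U_decay\<close> on the velocity datum is unbounded as
  the frequency tends to 0 (for \<theta> > 0); here it is traded for the factor \<open>t\<close>. If
  max p r * t > 1, then \<open>t\<close> is the larger factor and \<open>U_decay\<close> suffices.
  Otherwise \<open>U\<close> is \<open>U 0\<close> plus an integral of the velocity over a short
  time.\<close>

lemma U_decay_time:
  assumes t: "0 \<le> t"
  shows "(norm (U t))\<^sup>2 \<le> K' * exp (- (\<kappa> * rate) * t) * ((norm (U 0))\<^sup>2 + (t * norm (V 0))\<^sup>2)"
proof (cases "max p r * t \<le> 1")
  case True
  let ?M = "max p r"
  have M: "0 < ?M" using pos by simp
  have Vb: "norm (V x) \<le> sqrt K * (norm (V 0) + ?M * norm (U 0))" if "0 \<le> x" for x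
  proof (rule power2_le_imp_le)
    have "(norm (V x))\<^sup>2 \<le> K * exp (- (\<kappa> * rate) * x) * ((norm (V 0))\<^sup>2 + ?M\<^sup>2 * (norm (U 0))\<^sup>2)"
    proof -
      have "0 \<le> ?M\<^sup>2 * (norm (U x))\<^sup>2" by simp
      then show ?thesis using max_decay[OF that] by linarith
    qed
    also have "\<dots> \<le> K * 1 * ((norm (V 0) + ?M * norm (U 0))\<^sup>2)"
      using K_ge \<kappa> rate that M by (intro mult_mono mult_left_mono) (auto simp: power2_sum power_mult_distrib)
    finally show "(norm (V x))\<^sup>2 \<le> (sqrt K * (norm (V 0) + ?M * norm (U 0)))\<^sup>2"
      using K_ge by (simp add: power_mult_distrib)
  qed (use M K_ge in auto)
  have "norm (U t - U 0) \<le> (sqrt K * (norm (V 0) + ?M * norm (U 0))) * t"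
  proof (cases "t = 0")
    case False
    then have "0 < t" using t by simp
    then have "norm (U t - U 0) \<le> (sqrt K * (norm (V 0) + ?M * norm (U 0))) * t - (sqrt K * (norm (V 0) + ?M * norm (U 0))) * 0"
    proof (rule differentiable_bound_general)
      show "continuous_on {0..t} U" by (rule continuous_on_subset[OF U_cont]) auto
      show "continuous_on {0..t} (\<lambda>t. (sqrt K * (norm (V 0) + ?M * norm (U 0))) * t)" by (intro continuous_intros)
      show "(U has_vector_derivative V x) (at x)" if "0 < x" for x by (rule interior_deriv[OF that])
      show "((\<lambda>t. (sqrt K * (norm (V 0) + ?M * norm (U 0))) * t) has_vector_derivative sqrt K * (norm (V 0) + ?M * norm (U 0))) (at x)" for x
        by (auto intro!: derivative_eq_intros simp: has_real_derivative_iff_has_vector_derivative[symmetric])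
      show "norm (V x) \<le> sqrt K * (norm (V 0) + ?M * norm (U 0))" if "0 < x" for x
        using Vb[of x] that by simp
    qed
    then show ?thesis by simp
  qed simp
  also have "\<dots> = sqrt K * (t * norm (V 0)) + sqrt K * (?M * t) * norm (U 0)" by (simp add: algebra_simps)
  also have "\<dots> \<le> sqrt K * (t * norm (V 0)) + sqrt K * 1 * norm (U 0)"
    using True K_ge by (intro add_left_mono mult_right_mono mult_left_mono) auto
  finally have "norm (U t) \<le> norm (U 0) + (sqrt K * (t * norm (V 0)) + sqrt K * norm (U 0))"
    using norm_triangle_sub[of "U t" "U 0"] by simp
  also have "\<dots> \<le> (1 + sqrt K) * (norm (U 0) + t * norm (V 0))"
    using t by (simp add: algebra_simps)
  finally have "(norm (U t))\<^sup>2 \<le> ((1 + sqrt K) * (norm (U 0) + t * norm (V 0)))\<^sup>2"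
    by (intro power_mono) auto
  also have "\<dots> = (1 + sqrt K)\<^sup>2 * (norm (U 0) + t * norm (V 0))\<^sup>2" by (rule power_mult_distrib)
  also have "\<dots> \<le> (1 + sqrt K)\<^sup>2 * (2 * ((norm (U 0))\<^sup>2 + (t * norm (V 0))\<^sup>2))"
  proof (rule mult_left_mono)
    show "(norm (U 0) + t * norm (V 0))\<^sup>2 \<le> 2 * ((norm (U 0))\<^sup>2 + (t * norm (V 0))\<^sup>2)"
      using sum_squares_bound[of "norm (U 0)" "t * norm (V 0)"] by (simp add: power2_sum)
  qed simp
  finally have le: "(norm (U t))\<^sup>2 \<le> 2 * (1 + sqrt K)\<^sup>2 * ((norm (U 0))\<^sup>2 + (t * norm (V 0))\<^sup>2)" by (simp only: mult_ac)
  \<comment> \<open>For such short times the exponential is at least exp(-1), so it may be inserted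
    at the price of exp 1.\<close>
  have "\<kappa> * rate * t \<le> 1"
  proof -
    have "\<kappa> * (rate * t) \<le> 1 * (?M * t)" using \<kappa> rate t by (intro mult_mono) auto
    then show ?thesis using True by simp
  qed
  then have e: "1 \<le> exp 1 * exp (- (\<kappa> * rate) * t)" by (simp add: exp_add[symmetric])
  have "2 * (1 + sqrt K)\<^sup>2 * ((norm (U 0))\<^sup>2 + (t * norm (V 0))\<^sup>2) * 1 \<le>
      2 * (1 + sqrt K)\<^sup>2 * ((norm (U 0))\<^sup>2 + (t * norm (V 0))\<^sup>2) * (exp 1 * exp (- (\<kappa> * rate) * t))"
    using e by (intro mult_left_mono) auto
  then show ?thesis using le unfolding K'_def by (simp add: mult_ac)
next
  case False
  let ?M = "max p r"
  have M: "0 < ?M" using pos by simp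
  have "norm (V 0) / ?M \<le> t * norm (V 0)"
  proof -
    have "norm (V 0) * 1 \<le> norm (V 0) * (?M * t)" using False by (intro mult_left_mono) auto
    then show ?thesis using M by (simp add: field_simps)
  qed
  then have sq: "(norm (V 0) / ?M)\<^sup>2 \<le> (t * norm (V 0))\<^sup>2" using M by (intro power_mono) auto
  have "(norm (U t))\<^sup>2 \<le> K * exp (- (\<kappa> * rate) * t) * ((norm (U 0))\<^sup>2 + (norm (V 0) / ?M)\<^sup>2)"
    by (rule U_decay[OF t])
  also have "\<dots> \<le> K' * exp (- (\<kappa> * rate) * t) * ((norm (U 0))\<^sup>2 + (t * norm (V 0))\<^sup>2)"
    using K'_ge K_ge sq by (intro mult_mono add_left_mono) auto
  finally show ?thesis .
qed

text \<open>Duhamel's formula for V' + p V = - A U: the datum is damped at the fast rate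
  \<open>p\<close>, and the slowly decaying source A U, of size r^2, is divided by \<open>p\<close>.
  The gain r^2 / p is invisible in the energy estimates.\<close>

lemma V_decay:
  assumes pr: "r \<le> p" and t: "0 \<le> t"
  shows "(norm (V t))\<^sup>2 \<le> 2 * (exp (- p * t) * norm (V 0))\<^sup>2 +
    16 * b2\<^sup>2 * K * (r\<^sup>2 / p)\<^sup>2 * exp (- (\<kappa> * rate) * t) * ((norm (U 0))\<^sup>2 + (norm (V 0) / p)\<^sup>2)"
proof -
  define D where "D = sqrt ((norm (U 0))\<^sup>2 + (norm (V 0) / p)\<^sup>2)"
  \<comment> \<open>Growth rate of the source after multiplication by exp(p t). It stays above p/2
    because \<kappa> * rate <= p, so dividing by it costs at most a factor 2.\<close>
  define c where "c = p - \<kappa> * rate / 2"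
  have "\<kappa> * rate \<le> 1 * p" using \<kappa> rate by (intro mult_mono) auto
  then have c: "p / 2 \<le> c" "0 < c" using pos by (auto simp: c_def)
  have mx: "max p r = p" using pr by simp
  have Ub: "norm (U x) \<le> sqrt K * exp (- (\<kappa> * rate / 2) * x) * D" if "0 \<le> x" for x
  proof (rule power2_le_imp_le)
    have "(exp (- (\<kappa> * rate / 2) * x))\<^sup>2 = exp (- (\<kappa> * rate) * x)"
      by (simp add: exp_double[symmetric])
    then have "(sqrt K * exp (- (\<kappa> * rate / 2) * x) * D)\<^sup>2 = K * exp (- (\<kappa> * rate) * x) * ((norm (U 0))\<^sup>2 + (norm (V 0) / p)\<^sup>2)"
      using K_ge by (simp add: power_mult_distrib D_def)
    then show "(norm (U x))\<^sup>2 \<le> (sqrt K * exp (- (\<kappa> * rate / 2) * x) * D)\<^sup>2"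
      using U_decay[OF that] mx by simp
  qed (use K_ge in \<open>auto simp: D_def\<close>)
  define B where "B = b2 * r\<^sup>2 * sqrt K * D"
  have B: "0 \<le> B" using pos K_ge by (simp add: B_def D_def)
  \<comment> \<open>In place of a Duhamel integral, the derivative of exp(p t) V is compared with
    that of the explicit majorant (B / c) exp(c t).\<close>
  have main: "norm (exp (p * t) *\<^sub>R V t - exp (p * 0) *\<^sub>R V 0) \<le> B / c * exp (c * t) - B / c * exp (c * 0)" if "0 < t"
    using that
  proof (rule differentiable_bound_general)
    show "continuous_on {0..t} (\<lambda>t. exp (p * t) *\<^sub>R V t)"
      by (intro continuous_intros continuous_on_subset[OF V_cont]) auto
    show "continuous_on {0..t} (\<lambda>t. B / c * exp (c * t))" by (intro continuous_intros)
    show "((\<lambda>t. exp (p * t) *\<^sub>R V t) has_vector_derivative (- exp (p * x) *\<^sub>R A (U x))) (at x)" if "0 < x" for x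
      by (rule derivative_eq_intros interior_deriv(2)[OF that] refl | simp add: algebra_simps)+
    show "((\<lambda>t. B / c * exp (c * t)) has_vector_derivative B * exp (c * x)) (at x)" for x
      unfolding has_real_derivative_iff_has_vector_derivative[symmetric]
      using c by (auto intro!: derivative_eq_intros)
    show "norm (- exp (p * x) *\<^sub>R A (U x)) \<le> B * exp (c * x)" if "0 < x" for x
    proof -
      have "norm (- exp (p * x) *\<^sub>R A (U x)) = exp (p * x) * norm (A (U x))" by simp
      also have "\<dots> \<le> exp (p * x) * (b2 * r\<^sup>2 * (sqrt K * exp (- (\<kappa> * rate / 2) * x) * D))"
        using that pos by (intro mult_left_mono order_trans[OF upper] Ub) auto
      also have "\<dots> = B * (exp (p * x) * exp (- (\<kappa> * rate / 2) * x))" by (simp add: B_def mult_ac)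
      also have "\<dots> = B * exp (c * x)" by (simp add: c_def exp_add[symmetric] algebra_simps)
      finally show ?thesis .
    qed
  qed
  have "exp (p * t) * norm (V t) \<le> norm (V 0) + B / c * exp (c * t)"
  proof (cases "t = 0")
    case True then show ?thesis using B c by simp
  next
    case False
    then have "norm (exp (p * t) *\<^sub>R V t - V 0) \<le> B / c * exp (c * t) - B / c"
      using main t by simp
    moreover have "0 \<le> B / c" using B c by simp
    ultimately have "norm (exp (p * t) *\<^sub>R V t - V 0) \<le> B / c * exp (c * t)" by linarith
    then show ?thesis using norm_triangle_sub[of "exp (p * t) *\<^sub>R V t" "V 0"] by simp
  qed
  then have "exp (- p * t) * (exp (p * t) * norm (V t)) \<le> exp (- p * t) * (norm (V 0) + B / c * exp (c * t))"
    by (intro mult_left_mono) auto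
  also have "exp (- p * t) * (exp (p * t) * norm (V t)) = norm (V t)"
    by (simp add: mult.assoc[symmetric] exp_add[symmetric])
  also have "exp (- p * t) * (norm (V 0) + B / c * exp (c * t)) = exp (- p * t) * norm (V 0) + B / c * (exp (- p * t) * exp (c * t))"
    by (simp add: algebra_simps)
  also have "exp (- p * t) * exp (c * t) = exp (- (\<kappa> * rate / 2) * t)"
    by (simp add: c_def exp_add[symmetric] algebra_simps)
  also have "exp (- p * t) * norm (V 0) + B / c * exp (- (\<kappa> * rate / 2) * t) \<le> exp (- p * t) * norm (V 0) + B / (p / 2) * exp (- (\<kappa> * rate / 2) * t)"
    using c pos B by (intro add_left_mono mult_right_mono divide_left_mono) auto
  finally have "(norm (V t))\<^sup>2 \<le> (exp (- p * t) * norm (V 0) + B / (p / 2) * exp (- (\<kappa> * rate / 2) * t))\<^sup>2"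
    by (intro power_mono) auto
  also have "\<dots> \<le> 2 * (exp (- p * t) * norm (V 0))\<^sup>2 + 2 * (B / (p / 2) * exp (- (\<kappa> * rate / 2) * t))\<^sup>2"
    using sum_squares_bound[of "exp (- p * t) * norm (V 0)" "B / (p / 2) * exp (- (\<kappa> * rate / 2) * t)"] by (simp add: power2_sum)
  also have "2 * (B / (p / 2) * exp (- (\<kappa> * rate / 2) * t))\<^sup>2 = 8 * b2\<^sup>2 * K * (r\<^sup>2 / p)\<^sup>2 * exp (- (\<kappa> * rate) * t) * D\<^sup>2"
  proof -
    have "(exp (- (\<kappa> * rate / 2) * t))\<^sup>2 = exp (- (\<kappa> * rate) * t)"
      by (simp add: exp_double[symmetric])
    then show ?thesis using K_ge unfolding B_def by (simp add: power_mult_distrib power_divide)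
  qed
  also have "D\<^sup>2 = (norm (U 0))\<^sup>2 + (norm (V 0) / p)\<^sup>2" by (simp add: D_def)
  also have "8 * b2\<^sup>2 * K * (r\<^sup>2 / p)\<^sup>2 * exp (- (\<kappa> * rate) * t) * ((norm (U 0))\<^sup>2 + (norm (V 0) / p)\<^sup>2)
     \<le> 16 * b2\<^sup>2 * K * (r\<^sup>2 / p)\<^sup>2 * exp (- (\<kappa> * rate) * t) * ((norm (U 0))\<^sup>2 + (norm (V 0) / p)\<^sup>2)"
    using K_ge by (intro mult_right_mono) auto
  finally show ?thesis by simp
qed

end

section \<open>Low frequencies\<close>


text \<open>Taking logarithms reduces the claim to ln y <= y/c - 1 + ln c for y = z^\<beta>, with
  \<open>c\<close> so large that the linear term is absorbed by the exponential.\<close>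

lemma powr_mult_exp_bounded:
  fixes k \<beta> \<kappa> :: real
  assumes k: "0 \<le> k" and \<beta>: "0 < \<beta>" and \<kappa>: "0 < \<kappa>"
  obtains C where "0 < C" "\<And>z. 0 < z \<Longrightarrow> z powr k * exp (- \<kappa> * z powr \<beta>) \<le> C"
proof
  \<comment> \<open>Any \<open>c\<close> with k / \<beta> <= \<kappa> c would do; the added 1 keeps
    \<open>c\<close> positive when k = 0.\<close>
  define c where "c = (k / \<beta> + 1) / \<kappa>"
  have c: "0 < c" using k \<beta> \<kappa> by (simp add: c_def add_nonneg_pos)
  show "0 < exp (k / \<beta> * ln c)" by simp
  fix z :: real assume z: "0 < z"
  define y where "y = z powr \<beta>"
  have y: "0 < y" using z by (simp add: y_def)
  have "ln (y / c) \<le> y / c - 1" using y c by (intro ln_le_minus_one) auto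
  then have "ln y \<le> y / c + ln c" using y c by (simp add: ln_div)
  then have "k / \<beta> * ln y \<le> k / \<beta> * (y / c + ln c)" using k \<beta> by (intro mult_left_mono) auto
  also have "\<dots> = (k / \<beta> / c) * y + k / \<beta> * ln c" by (simp add: algebra_simps)
  also have "\<dots> \<le> \<kappa> * y + k / \<beta> * ln c"
  proof (intro add_right_mono mult_right_mono)
    have "k / \<beta> \<le> \<kappa> * c" using \<kappa> by (simp add: c_def)
    then have "k / \<beta> / c \<le> \<kappa> * c / c" using c by (intro divide_right_mono) auto
    then show "k / \<beta> / c \<le> \<kappa>" using c by simp
  qed (use y in auto)
  finally have "k * ln z \<le> \<kappa> * y + k / \<beta> * ln c" using z \<beta> by (simp add: y_def ln_powr)
  then have "exp (k * ln z + - \<kappa> * y) \<le> exp (k / \<beta> * ln c)" by simp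
  then show "z powr k * exp (- \<kappa> * z powr \<beta>) \<le> exp (k / \<beta> * ln c)"
    using z by (simp add: powr_def[of z k] exp_add[symmetric] y_def)
qed

lemma exp_decay_le_powr:
  fixes e \<kappa> :: real
  assumes \<kappa>: "0 < \<kappa>"
  obtains C where "0 < C" "\<And>t. 0 \<le> t \<Longrightarrow> exp (- \<kappa> * t) \<le> C * (1 + t) powr e"
proof -
  obtain C where C: "0 < C" "\<And>z. 0 < z \<Longrightarrow> z powr \<bar>e\<bar> * exp (- \<kappa> * z powr 1) \<le> C"
    using powr_mult_exp_bounded[of "\<bar>e\<bar>" 1 \<kappa>] \<kappa> by auto
  show ?thesis
  proof
    show "0 < exp \<kappa> * C" using C by simp
    fix t :: real assume t: "0 \<le> t"
    have "1 = (1 + t) powr (- e) * (1 + t) powr e" using t by (simp add: powr_add[symmetric])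
    also have "\<dots> \<le> (1 + t) powr \<bar>e\<bar> * (1 + t) powr e"
      using t by (intro mult_right_mono powr_mono) auto
    finally have "exp (- \<kappa> * t) * 1 \<le> exp (- \<kappa> * t) * ((1 + t) powr \<bar>e\<bar> * (1 + t) powr e)"
      by (intro mult_left_mono) auto
    also have "\<dots> = exp \<kappa> * ((1 + t) powr \<bar>e\<bar> * exp (- \<kappa> * (1 + t) powr 1)) * (1 + t) powr e"
      using t by (simp add: algebra_simps exp_add[symmetric])
    also have "\<dots> \<le> exp \<kappa> * C * (1 + t) powr e"
      using t C by (intro mult_right_mono mult_left_mono) auto
    finally show "exp (- \<kappa> * t) \<le> exp \<kappa> * C * (1 + t) powr e" by simp
  qed
qed

text \<open>The summands are dominated by increments of the bounded monotone function
  \<open>z \<mapsto> z\<^sup>\<mu> / (1 + z\<^sup>\<mu>)\<close>, so the sum telescopes.\<close>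
lemma dyadic_sum_bounded:
  fixes \<mu> \<beta> \<kappa> :: real
  assumes \<mu>: "0 < \<mu>" and \<beta>: "0 < \<beta>" and \<kappa>: "0 < \<kappa>"
  obtains C where "0 < C" "\<And>T n. 0 < T \<Longrightarrow> (\<Sum>j<n. (T / 2 ^ j) powr \<mu> * exp (- \<kappa> * (T / 2 ^ j) powr \<beta>)) \<le> C"
proof -
  define g where "g = (\<lambda>z::real. z powr \<mu> / (1 + z powr \<mu>))"
  define l where "l = (1 / 2 :: real) powr \<mu>"
  have "1 < (2::real) powr \<mu>" using powr_less_mono[of 0 \<mu> 2] \<mu> by simp
  then have l: "0 < l" "l < 1" by (auto simp: l_def powr_divide)
  obtain C0 where C0: "0 < C0" "\<And>z. 0 < z \<Longrightarrow> z powr 0 * exp (- \<kappa> * z powr \<beta>) \<le> C0"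
    using powr_mult_exp_bounded[of 0 \<beta> \<kappa>] \<beta> \<kappa> by auto
  obtain C2 where C2: "0 < C2" "\<And>z. 0 < z \<Longrightarrow> z powr (2 * \<mu>) * exp (- \<kappa> * z powr \<beta>) \<le> C2"
    using powr_mult_exp_bounded[of "2 * \<mu>" \<beta> \<kappa>] \<mu> \<beta> \<kappa> by auto
  define C where "C = (2 * (C0 + C2)) / (1 - l)"
  have C: "0 < C" using C0 C2 l by (simp add: C_def)
  \<comment> \<open>With x = z^\<mu> and l = (1/2)^\<mu> the increment of \<open>g\<close> is at
    least (1 - l) x / (1 + x)^2. The exponential absorbs the denominator (1 + x)^2 <= 2 (1 + x^2),
    which is what \<open>C0\<close> and \<open>C2\<close> are for.\<close>
  have step: "z powr \<mu> * exp (- \<kappa> * z powr \<beta>) \<le> C * (g z - g (z / 2))" if z: "0 < z" for z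
  proof -
    define x where "x = z powr \<mu>"
    have x: "0 < x" using z by (simp add: x_def)
    have x2: "z powr (2 * \<mu>) = x\<^sup>2" using z by (simp add: x_def powr_power mult.commute)
    have half: "(z / 2) powr \<mu> = l * x" using z by (simp add: x_def l_def powr_divide)
    have lx: "0 < l * x" "l * x \<le> x" using l x by auto
    have "g z - g (z / 2) = (x - l * x) / ((1 + x) * (1 + l * x))"
      unfolding g_def half x_def[symmetric] using x lx by (simp add: field_simps)
    also have "\<dots> \<ge> (x - l * x) / (1 + x)\<^sup>2"
      using x lx by (intro divide_left_mono) (auto simp: power2_eq_square intro!: mult_pos_pos)
    finally have "(x - l * x) / (1 + x)\<^sup>2 \<le> g z - g (z / 2)" .
    moreover have "0 < (1 + x)\<^sup>2" using x by simp
    ultimately have "x - l * x \<le> (g z - g (z / 2)) * (1 + x)\<^sup>2"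
      by (simp only: pos_divide_le_eq)
    then have inc: "(1 - l) * x \<le> (g z - g (z / 2)) * (1 + x)\<^sup>2"
      by (simp only: left_diff_distrib mult_1)
    have g0: "0 \<le> g z - g (z / 2)"
    proof -
      have "0 \<le> (1 - l) * x" using l x by simp
      then have "0 \<le> (g z - g (z / 2)) * (1 + x)\<^sup>2" using inc by linarith
      then have "0 * (1 + x)\<^sup>2 \<le> (g z - g (z / 2)) * (1 + x)\<^sup>2" by simp
      then show ?thesis by (rule mult_right_le_imp_le) (use x in simp)
    qed
    have ex: "(1 + x)\<^sup>2 * exp (- \<kappa> * z powr \<beta>) \<le> 2 * (C0 + C2)"
    proof -
      have "(1 + x)\<^sup>2 \<le> 2 * (1 + x\<^sup>2)" using sum_squares_bound[of 1 x] by (simp add: power2_sum)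
      then have "(1 + x)\<^sup>2 * exp (- \<kappa> * z powr \<beta>) \<le> 2 * (1 + x\<^sup>2) * exp (- \<kappa> * z powr \<beta>)"
        by (intro mult_right_mono) auto
      also have "\<dots> = 2 * (z powr 0 * exp (- \<kappa> * z powr \<beta>) + z powr (2 * \<mu>) * exp (- \<kappa> * z powr \<beta>))"
        using z by (simp add: x2 distrib_left distrib_right)
      also have "\<dots> \<le> 2 * (C0 + C2)" using C0(2)[OF z] C2(2)[OF z] by simp
      finally show ?thesis .
    qed
    have "(1 - l) * (x * exp (- \<kappa> * z powr \<beta>)) \<le> (g z - g (z / 2)) * (1 + x)\<^sup>2 * exp (- \<kappa> * z powr \<beta>)"
      using mult_right_mono[OF inc, of "exp (- \<kappa> * z powr \<beta>)"] by (simp add: mult.assoc)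
    also have "\<dots> = (g z - g (z / 2)) * ((1 + x)\<^sup>2 * exp (- \<kappa> * z powr \<beta>))" by simp
    also have "\<dots> \<le> (g z - g (z / 2)) * (2 * (C0 + C2))" by (intro mult_left_mono ex g0)
    finally have "x * exp (- \<kappa> * z powr \<beta>) \<le> (g z - g (z / 2)) * (2 * (C0 + C2)) / (1 - l)"
      using l by (simp add: pos_le_divide_eq mult.commute)
    then show ?thesis by (simp add: x_def C_def mult.commute)
  qed
  show ?thesis
  proof
    show "0 < C" by (rule C)
    fix T :: real and n :: nat assume T: "0 < T"
    have "(\<Sum>j<n. (T / 2 ^ j) powr \<mu> * exp (- \<kappa> * (T / 2 ^ j) powr \<beta>)) \<le> (\<Sum>j<n. C * (g (T / 2 ^ j) - g (T / 2 ^ Suc j)))"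
      using T step[of "T / 2 ^ _"] by (intro sum_mono) (simp add: mult.commute)
    also have "\<dots> = C * (g T - g (T / 2 ^ n))"
      using sum_lessThan_telescope'[of "\<lambda>j. g (T / 2 ^ j)" n] by (simp add: sum_distrib_left[symmetric])
    also have "\<dots> \<le> C * 1"
    proof (intro mult_left_mono)
      have "g T \<le> 1" "0 \<le> g (T / 2 ^ n)" by (auto simp: g_def divide_le_eq add_pos_nonneg)
      then show "g T - g (T / 2 ^ n) \<le> 1" by linarith
    qed (use C in auto)
    finally show "(\<Sum>j<n. (T / 2 ^ j) powr \<mu> * exp (- \<kappa> * (T / 2 ^ j) powr \<beta>)) \<le> C" by simp
  qed
qed

lemma dyadic_scale:
  fixes r :: real
  assumes r: "0 < r" "r \<le> 1"
  obtains j :: nat where "1 / 2 ^ Suc j < r" "r \<le> 1 / 2 ^ j"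
proof -
  define P where "P = (\<lambda>j::nat. 1 / 2 ^ j < r)"
  obtain n where "(1 / 2) ^ n < r" using real_arch_pow_inv[of r "1/2"] r by auto
  then have ex: "P n" by (simp add: P_def power_divide)
  define k where "k = (LEAST j. P j)"
  have Pk: "P k" unfolding k_def by (rule LeastI[of P, OF ex])
  have "k \<noteq> 0"
  proof
    assume "k = 0"
    then show False using Pk r by (simp add: P_def)
  qed
  then obtain j where j: "k = Suc j" by (cases k) auto
  have "\<not> P j" using not_less_Least[of j P] j unfolding k_def by auto
  then show ?thesis using that[of j] Pk unfolding j P_def by auto
qed

text \<open>The squared multiplier with which a datum enters at low frequencies. The order
  \<open>\<alpha>\<close> is negative when the velocity datum acts on the displacement, and at least
  \<open>s\<close> in the energy estimates.\<close>

definition low_weight :: "real \<Rightarrow> real \<Rightarrow> real \<Rightarrow> real \<Rightarrow> real^3 \<Rightarrow> real" where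
  "low_weight \<alpha> \<kappa> \<beta> t \<xi> =
     indicator {\<xi>. norm \<xi> \<le> 1} \<xi> * (norm \<xi> powr (2 * \<alpha>) * exp (- \<kappa> * norm \<xi> powr \<beta> * t))"

lemma low_weight_nonneg [simp]: "0 \<le> low_weight \<alpha> \<kappa> \<beta> t \<xi>"
  by (simp add: low_weight_def)

lemma low_weight_measurable [measurable]: "low_weight \<alpha> \<kappa> \<beta> t \<in> borel_measurable borel"
  unfolding low_weight_def[abs_def] by measurable

text \<open>On the shell |\<xi>| ~ 2^-j the weight is nearly constant and the integral of |F|^2 is
  at most a multiple of 2^(-j q), q = 6/m - 3. With T = (1 + t)^(1/\<beta>) everything depends on T
  2^-j up to the factor T^-(2 \<alpha> + q), and the remaining dyadic sum is bounded uniformly in T.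
  Positivity of 2 \<alpha> + q makes that sum converge at the origin.\<close>

lemma low_frequency_decay:
  fixes m \<alpha> \<beta> \<kappa> :: real
  assumes m: "1 \<le> m" "m \<le> 2" and \<beta>: "0 < \<beta>" and \<kappa>: "0 < \<kappa>" and \<mu>: "0 < 2 * \<alpha> + (6 / m - 3)"
  obtains C where "0 < C" "\<And>f F t. is_FT f F \<Longrightarrow> memLp m f \<Longrightarrow> 0 \<le> t \<Longrightarrow>
    (\<integral>\<^sup>+\<xi>. ennreal (low_weight \<alpha> \<kappa> \<beta> t \<xi> * (cmod (F \<xi>))\<^sup>2) \<partial>lborel)
    \<le> ennreal (C * (1 + t) powr (- (2 * \<alpha> + (6 / m - 3)) / \<beta>) * (Lp_norm m f)\<^sup>2)"
proof -
  define q where "q = 6 / m - 3"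
  define \<mu>' where "\<mu>' = 2 * \<alpha> + q"
  have \<mu>': "0 < \<mu>'" using \<mu> by (simp add: \<mu>'_def q_def)
  \<comment> \<open>Absorbs the replacement of |\<xi>| by half of its dyadic scale inside the
    exponential.\<close>
  define \<kappa>' where "\<kappa>' = \<kappa> * (1 / 2) powr \<beta>"
  have \<kappa>': "0 < \<kappa>'" using \<kappa> by (simp add: \<kappa>'_def)
  obtain S where S: "0 < S" "\<And>T n. 0 < T \<Longrightarrow> (\<Sum>j<n. (T / 2 ^ j) powr \<mu>' * exp (- \<kappa>' * (T / 2 ^ j) powr \<beta>)) \<le> S"
    using dyadic_sum_bounded[OF \<mu>' \<beta> \<kappa>'] by blast
  define D where "D = 2 * exp 1 * HY_const"
  have D: "0 < D" using HY_const_pos by (simp add: D_def)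
  \<comment> \<open>\<open>exp \<kappa>\<close> pays for replacing t by 1 + t, which is legitimate
    since |\<xi>| <= 1; the power of 2 pays for replacing |\<xi>| by its dyadic scale, with the
    absolute value covering negative \<alpha>.\<close>
  define E where "E = exp \<kappa> * 2 powr (2 * \<bar>\<alpha>\<bar>)"
  have E: "0 < E" by (simp add: E_def)
  show ?thesis
  proof (rule that)
    show "0 < E * D * S" using E D S by simp
    fix f F and t :: real
    assume FT: "is_FT f F" and f: "memLp m f" and t: "0 \<le> t"
    have [measurable]: "F \<in> borel_measurable borel" by (rule is_FT_measurable[OF FT])
    define T where "T = (1 + t) powr (1 / \<beta>)"
    have T: "0 < T" using t by (simp add: T_def)
    have T\<beta>: "T powr \<beta> = 1 + t" using t \<beta> by (simp add: T_def powr_powr)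
    define x where "x = (\<lambda>j::nat. 1 / 2 ^ j :: real)"
    have x: "0 < x j" for j by (simp add: x_def)
    define w where "w = (\<lambda>j. E * (x j powr (2 * \<alpha>) * exp (- \<kappa>' * (T * x j) powr \<beta>)))"
    have w: "0 \<le> w j" for j using E by (simp add: w_def)
    have pt: "ennreal (low_weight \<alpha> \<kappa> \<beta> t \<xi> * (cmod (F \<xi>))\<^sup>2)
        \<le> (\<Sum>j. ennreal (w j) * (ennreal ((cmod (F \<xi>))\<^sup>2) * indicator {\<xi>. norm \<xi> \<le> x j} \<xi>))" for \<xi> :: "real^3"
    proof (cases "0 < norm \<xi> \<and> norm \<xi> \<le> 1")
      case True
      let ?r = "norm \<xi>"
      obtain j where j: "1 / 2 ^ Suc j < ?r" "?r \<le> 1 / 2 ^ j" using dyadic_scale[of ?r] True by blast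
      have jx: "x j / 2 \<le> ?r" "?r \<le> x j" using j by (auto simp: x_def field_simps)
      have r0: "0 < ?r" using True by simp
      have p1: "?r powr (2 * \<alpha>) \<le> 2 powr (2 * \<bar>\<alpha>\<bar>) * x j powr (2 * \<alpha>)"
      proof (cases "0 \<le> \<alpha>")
        case True
        have "?r powr (2 * \<alpha>) \<le> x j powr (2 * \<alpha>)" using True jx r0 by (intro powr_mono2) auto
        also have "\<dots> = 1 * x j powr (2 * \<alpha>)" by simp
        also have "\<dots> \<le> 2 powr (2 * \<bar>\<alpha>\<bar>) * x j powr (2 * \<alpha>)"
          using ge_one_powr_ge_zero[of 2 "2 * \<bar>\<alpha>\<bar>"] by (intro mult_right_mono) auto
        finally show ?thesis .
      next
        case False
        have "?r powr (2 * \<alpha>) \<le> (x j / 2) powr (2 * \<alpha>)" using False jx x[of j] by (intro powr_mono2') auto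
        also have "\<dots> = 2 powr (2 * \<bar>\<alpha>\<bar>) * x j powr (2 * \<alpha>)"
          using False x[of j] by (simp add: powr_divide powr_minus_divide)
        finally show ?thesis .
      qed
      have p2: "exp (- \<kappa> * ?r powr \<beta> * t) \<le> exp \<kappa> * exp (- \<kappa>' * (T * x j) powr \<beta>)"
      proof -
        have "?r powr \<beta> \<le> 1" using True \<beta> by (simp add: powr_le1)
        then have "\<kappa> * ?r powr \<beta> \<le> \<kappa> * 1" using \<kappa> by (intro mult_left_mono) auto
        then have "- \<kappa> * ?r powr \<beta> * t \<le> \<kappa> - \<kappa> * ?r powr \<beta> * (1 + t)" by (simp add: algebra_simps)
        also have "\<dots> \<le> \<kappa> - \<kappa> * (x j / 2) powr \<beta> * (1 + t)"
          using jx x[of j] \<kappa> \<beta> t by (intro diff_left_mono mult_right_mono mult_left_mono powr_mono2) auto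
        also have "\<kappa> * (x j / 2) powr \<beta> * (1 + t) = \<kappa>' * (T * x j) powr \<beta>"
          using x[of j] T T\<beta> by (simp add: \<kappa>'_def powr_mult powr_divide)
        finally show ?thesis by (simp add: exp_add[symmetric])
      qed
      have "?r powr (2 * \<alpha>) * exp (- \<kappa> * ?r powr \<beta> * t) \<le>
          (2 powr (2 * \<bar>\<alpha>\<bar>) * x j powr (2 * \<alpha>)) * (exp \<kappa> * exp (- \<kappa>' * (T * x j) powr \<beta>))"
        by (intro mult_mono p1 p2) auto
      also have "\<dots> = w j" by (simp add: w_def E_def mult_ac)
      finally have "ennreal ((?r powr (2 * \<alpha>) * exp (- \<kappa> * ?r powr \<beta> * t)) * (cmod (F \<xi>))\<^sup>2) \<le> ennreal (w j * (cmod (F \<xi>))\<^sup>2)"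
        by (intro ennreal_leI mult_right_mono) auto
      also have "\<dots> = ennreal (w j) * (ennreal ((cmod (F \<xi>))\<^sup>2) * indicator {\<xi>. norm \<xi> \<le> x j} \<xi>)"
        using jx w by (simp add: ennreal_mult)
      also have "\<dots> \<le> (\<Sum>j. ennreal (w j) * (ennreal ((cmod (F \<xi>))\<^sup>2) * indicator {\<xi>. norm \<xi> \<le> x j} \<xi>))"
        using sum_le_suminf[OF summableI, of "{j}" "\<lambda>j. ennreal (w j) * (ennreal ((cmod (F \<xi>))\<^sup>2) * indicator {\<xi>. norm \<xi> \<le> x j} \<xi>)"]
        by simp
      finally show ?thesis using True by (simp add: low_weight_def)
    qed (auto simp: low_weight_def)
    have "(\<integral>\<^sup>+\<xi>. ennreal (low_weight \<alpha> \<kappa> \<beta> t \<xi> * (cmod (F \<xi>))\<^sup>2) \<partial>lborel)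
        \<le> (\<integral>\<^sup>+\<xi>. (\<Sum>j. ennreal (w j) * (ennreal ((cmod (F \<xi>))\<^sup>2) * indicator {\<xi>. norm \<xi> \<le> x j} \<xi>)) \<partial>lborel)"
      by (intro nn_integral_mono pt)
    also have "\<dots> = (\<Sum>j. \<integral>\<^sup>+\<xi>. ennreal (w j) * (ennreal ((cmod (F \<xi>))\<^sup>2) * indicator {\<xi>. norm \<xi> \<le> x j} \<xi>) \<partial>lborel)"
      by (rule nn_integral_suminf) measurable
    also have "\<dots> = (\<Sum>j. ennreal (w j) * (\<integral>\<^sup>+\<xi>. ennreal ((cmod (F \<xi>))\<^sup>2) * indicator {\<xi>. norm \<xi> \<le> x j} \<xi> \<partial>lborel))"
      by (intro suminf_cong nn_integral_cmult) measurable
    also have "\<dots> \<le> ennreal (E * D * S * T powr (- \<mu>') * (Lp_norm m f)\<^sup>2)"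
    proof (rule suminf_le_const[OF summableI])
      fix n
      have "(\<Sum>j<n. ennreal (w j) * (\<integral>\<^sup>+\<xi>. ennreal ((cmod (F \<xi>))\<^sup>2) * indicator {\<xi>. norm \<xi> \<le> x j} \<xi> \<partial>lborel))
         \<le> (\<Sum>j<n. ennreal (w j) * ennreal (D * x j powr q * (Lp_norm m f)\<^sup>2))"
        unfolding D_def q_def by (intro sum_mono mult_left_mono is_FT_ball_bound[OF FT f m x]) auto
      also have "\<dots> = ennreal (\<Sum>j<n. w j * (D * x j powr q * (Lp_norm m f)\<^sup>2))"
        using w D by (simp add: ennreal_mult[symmetric] sum_ennreal)
      also have "(\<Sum>j<n. w j * (D * x j powr q * (Lp_norm m f)\<^sup>2)) =
          E * D * T powr (- \<mu>') * (Lp_norm m f)\<^sup>2 * (\<Sum>j<n. (T / 2 ^ j) powr \<mu>' * exp (- \<kappa>' * (T / 2 ^ j) powr \<beta>))"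
        unfolding sum_distrib_left
      proof (intro sum.cong refl)
        fix j
        have e: "x j powr (2 * \<alpha>) * x j powr q = T powr (- \<mu>') * (T / 2 ^ j) powr \<mu>'"
        proof -
          have "x j powr (2 * \<alpha>) * x j powr q = x j powr \<mu>'" by (simp add: powr_add \<mu>'_def)
          also have "\<dots> = T powr (- \<mu>') * (T powr \<mu>' * x j powr \<mu>')"
            using T by (simp add: mult.assoc[symmetric] powr_add[symmetric])
          also have "T powr \<mu>' * x j powr \<mu>' = (T / 2 ^ j) powr \<mu>'"
            using T x[of j] by (simp add: powr_mult[symmetric] x_def)
          finally show ?thesis .
        qed
        have "w j * (D * x j powr q * (Lp_norm m f)\<^sup>2) =
            E * D * (Lp_norm m f)\<^sup>2 * exp (- \<kappa>' * (T * x j) powr \<beta>) * (x j powr (2 * \<alpha>) * x j powr q)"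
          by (simp add: w_def mult_ac)
        also have "\<dots> = E * D * T powr (- \<mu>') * (Lp_norm m f)\<^sup>2 * ((T / 2 ^ j) powr \<mu>' * exp (- \<kappa>' * (T / 2 ^ j) powr \<beta>))"
          unfolding e by (simp add: x_def mult_ac)
        finally show "w j * (D * x j powr q * (Lp_norm m f)\<^sup>2) =
          E * D * T powr (- \<mu>') * (Lp_norm m f)\<^sup>2 * ((T / 2 ^ j) powr \<mu>' * exp (- \<kappa>' * (T / 2 ^ j) powr \<beta>))" .
      qed
      also have "ennreal \<dots> \<le> ennreal (E * D * T powr (- \<mu>') * (Lp_norm m f)\<^sup>2 * S)"
        using E D S(2)[OF T] by (intro ennreal_leI mult_left_mono) auto
      finally show "(\<Sum>j<n. ennreal (w j) * (\<integral>\<^sup>+\<xi>. ennreal ((cmod (F \<xi>))\<^sup>2) * indicator {\<xi>. norm \<xi> \<le> x j} \<xi> \<partial>lborel))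
         \<le> ennreal (E * D * S * T powr (- \<mu>') * (Lp_norm m f)\<^sup>2)" by (simp add: mult_ac)
    qed
    also have "T powr (- \<mu>') = (1 + t) powr (- (2 * \<alpha> + (6 / m - 3)) / \<beta>)"
      unfolding T_def powr_powr by (simp add: \<mu>'_def q_def)
    finally show "(\<integral>\<^sup>+\<xi>. ennreal (low_weight \<alpha> \<kappa> \<beta> t \<xi> * (cmod (F \<xi>))\<^sup>2) \<partial>lborel)
        \<le> ennreal (E * D * S * (1 + t) powr (- (2 * \<alpha> + (6 / m - 3)) / \<beta>) * (Lp_norm m f)\<^sup>2)" .
  qed
qed

section \<open>The symbol of the Lame operator as a damped system\<close>

text \<open>The matrix a^2 |\<xi>|^2 I + (b^2 - a^2) \<xi> \<xi>^T: it has the eigenvalue b^2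
  |\<xi>|^2 along \<xi> (pressure waves) and a^2 |\<xi>|^2 across it (shear waves).\<close>

definition lame_symbol :: "real \<Rightarrow> real \<Rightarrow> real^3 \<Rightarrow> complex^3 \<Rightarrow> complex^3" where
  "lame_symbol a b \<xi> W = (a\<^sup>2 * (norm \<xi>)\<^sup>2) *\<^sub>R W +
     (b\<^sup>2 - a\<^sup>2) *\<^sub>R (\<chi> k. complex_of_real (\<xi> $ k) * (\<Sum>j\<in>UNIV. complex_of_real (\<xi> $ j) * W $ j))"

lemma lame_rhs_eq: "lame_rhs a b \<theta> \<xi> W Z = - (lame_symbol a b \<xi> W + (norm \<xi> powr (2 * \<theta>)) *\<^sub>R Z)"
  by (simp add: vec_eq_iff lame_rhs_def lame_symbol_def) (simp add: scaleR_conv_of_real mult.assoc)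

lemma norm_divergence_symbol_le:
  fixes W :: "complex^3"
  shows "cmod (\<Sum>j\<in>UNIV. complex_of_real (\<xi> $ j) * W $ j) \<le> norm \<xi> * norm W"
proof -
  have "cmod (\<Sum>j\<in>UNIV. complex_of_real (\<xi> $ j) * W $ j) \<le> (\<Sum>j\<in>UNIV. \<bar>\<xi> $ j\<bar> * \<bar>cmod (W $ j)\<bar>)"
    by (rule order_trans[OF norm_sum]) (simp add: norm_mult)
  also have "\<dots> \<le> L2_set (($) \<xi>) UNIV * L2_set (\<lambda>j. cmod (W $ j)) UNIV"
    by (rule L2_set_mult_ineq)
  also have "L2_set (($) \<xi>) UNIV = norm \<xi>" by (simp add: norm_vec_def L2_set_def)
  also have "L2_set (\<lambda>j. cmod (W $ j)) UNIV = norm W" by (simp add: norm_vec_def)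
  finally show ?thesis .
qed

text \<open>The rank-one part becomes an inner product of two divergences. Symmetry and, for a^2 <=
  b^2, the lower bound can be read off from this form.\<close>

lemma lame_symbol_inner:
  "lame_symbol a b \<xi> W \<bullet> Z = a\<^sup>2 * (norm \<xi>)\<^sup>2 * (W \<bullet> Z) + (b\<^sup>2 - a\<^sup>2) *
     ((\<Sum>j\<in>UNIV. complex_of_real (\<xi> $ j) * W $ j) \<bullet> (\<Sum>j\<in>UNIV. complex_of_real (\<xi> $ j) * Z $ j))"
proof -
  define s where "s = (\<Sum>j\<in>UNIV. complex_of_real (\<xi> $ j) * W $ j)"
  have "(\<chi> k. complex_of_real (\<xi> $ k) * s) \<bullet> Z = (\<Sum>k\<in>UNIV. s \<bullet> (complex_of_real (\<xi> $ k) * Z $ k))"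
    unfolding inner_vec_def by (intro sum.cong refl) (simp add: inner_complex_def algebra_simps)
  then have "(\<chi> k. complex_of_real (\<xi> $ k) * s) \<bullet> Z = s \<bullet> (\<Sum>k\<in>UNIV. complex_of_real (\<xi> $ k) * Z $ k)"
    by (simp add: inner_sum_right)
  then show ?thesis
    unfolding lame_symbol_def s_def[symmetric] by (simp add: inner_add_left)
qed

lemma damped_system_lame:
  assumes ab: "0 < a\<^sup>2" "a\<^sup>2 \<le> b\<^sup>2" and \<xi>: "\<xi> \<noteq> 0"
    and ode: "\<And>t. 0 \<le> t \<Longrightarrow> (U has_vector_derivative V t) (at t within {0..})"
      "\<And>t. 0 \<le> t \<Longrightarrow> (V has_vector_derivative lame_rhs a b \<theta> \<xi> (U t) (V t)) (at t within {0..})"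
  shows "damped_system (a\<^sup>2) (b\<^sup>2) (lame_symbol a b \<xi>) (norm \<xi> powr (2 * \<theta>)) (norm \<xi>) U V"
proof (intro damped_system.intro damping_constants.intro damped_system_axioms.intro)
  let ?s = "\<lambda>W::complex^3. \<Sum>j\<in>UNIV. complex_of_real (\<xi> $ j) * W $ j"
  show "linear (lame_symbol a b \<xi>)"
  proof (rule linearI)
    fix W Z :: "complex^3" and c :: real
    show "lame_symbol a b \<xi> (W + Z) = lame_symbol a b \<xi> W + lame_symbol a b \<xi> Z"
      by (simp add: vec_eq_iff lame_symbol_def algebra_simps sum.distrib)
    show "lame_symbol a b \<xi> (c *\<^sub>R W) = c *\<^sub>R lame_symbol a b \<xi> W"
      by (simp add: vec_eq_iff lame_symbol_def algebra_simps scaleR_sum_right[symmetric])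
  qed
  fix W Z :: "complex^3"
  show "lame_symbol a b \<xi> W \<bullet> Z = W \<bullet> lame_symbol a b \<xi> Z"
    unfolding inner_commute[of W "lame_symbol a b \<xi> Z"] lame_symbol_inner
    by (simp add: inner_commute)
  show "a\<^sup>2 * (norm \<xi>)\<^sup>2 * (norm W)\<^sup>2 \<le> lame_symbol a b \<xi> W \<bullet> W"
    unfolding lame_symbol_inner power2_norm_eq_inner[of W] using ab by simp
  show "norm (lame_symbol a b \<xi> W) \<le> b\<^sup>2 * (norm \<xi>)\<^sup>2 * norm W"
  proof -
    have "norm (\<chi> k. complex_of_real (\<xi> $ k) * ?s W) = L2_set (\<lambda>k. cmod (?s W) * \<bar>\<xi> $ k\<bar>) UNIV"
      by (simp add: norm_vec_def norm_mult mult.commute)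
    also have "\<dots> = cmod (?s W) * norm \<xi>"
      by (simp add: L2_set_right_distrib[symmetric] norm_vec_def)
    also have "\<dots> \<le> (norm \<xi> * norm W) * norm \<xi>"
      by (intro mult_right_mono norm_divergence_symbol_le) auto
    finally have 1: "norm (\<chi> k. complex_of_real (\<xi> $ k) * ?s W) \<le> (norm \<xi>)\<^sup>2 * norm W"
      by (simp add: power2_eq_square mult_ac)
    have "norm (lame_symbol a b \<xi> W) \<le> norm ((a\<^sup>2 * (norm \<xi>)\<^sup>2) *\<^sub>R W) + norm ((b\<^sup>2 - a\<^sup>2) *\<^sub>R (\<chi> k. complex_of_real (\<xi> $ k) * ?s W))"
      unfolding lame_symbol_def by (rule norm_triangle_ineq)
    also have "\<dots> = a\<^sup>2 * (norm \<xi>)\<^sup>2 * norm W + (b\<^sup>2 - a\<^sup>2) * norm (\<chi> k. complex_of_real (\<xi> $ k) * ?s W)"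
      using ab by simp
    also have "\<dots> \<le> a\<^sup>2 * (norm \<xi>)\<^sup>2 * norm W + (b\<^sup>2 - a\<^sup>2) * ((norm \<xi>)\<^sup>2 * norm W)"
      using ab 1 by (intro add_left_mono mult_left_mono) auto
    also have "\<dots> = b\<^sup>2 * (norm \<xi>)\<^sup>2 * norm W" by (simp add: algebra_simps)
    finally show ?thesis .
  qed
next
  fix t :: real assume t: "0 \<le> t"
  show "(U has_vector_derivative V t) (at t within {0..})" by (rule ode(1)[OF t])
  show "(V has_vector_derivative - (lame_symbol a b \<xi> (U t) + norm \<xi> powr (2 * \<theta>) *\<^sub>R V t)) (at t within {0..})"
    using ode(2)[OF t] unfolding lame_rhs_eq .
qed (use ab \<xi> in auto)


section \<open>Bounds at each frequency in terms of powers of its modulus\<close>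

lemma min_le_powr_interpolation:
  fixes x y k :: real
  assumes "0 < x" "0 < y" "0 \<le> k" "k \<le> 1"
  shows "min x y \<le> x powr k * y powr (1 - k)"
proof (cases "x \<le> y")
  case True
  have "x = x powr k * x powr (1 - k)" using assms by (simp add: powr_add[symmetric])
  also have "\<dots> \<le> x powr k * y powr (1 - k)" using assms True by (intro mult_left_mono powr_mono2) auto
  finally show ?thesis by simp
next
  case False
  have "y = y powr k * y powr (1 - k)" using assms by (simp add: powr_add[symmetric])
  also have "\<dots> \<le> x powr k * y powr (1 - k)" using assms False by (intro mult_right_mono powr_mono2) auto
  finally show ?thesis by simp
qed

context damped_system
begin

lemma high_frequency_decay:
  assumes r1: "1 \<le> r" and p: "p = r powr (2 * \<theta>)" and \<theta>: "0 \<le> \<theta>" "\<theta> \<le> 1" and t: "0 \<le> t"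
  shows "(norm (V t))\<^sup>2 + r\<^sup>2 * (norm (U t))\<^sup>2 \<le> K * exp (- \<kappa> * t) * ((norm (V 0))\<^sup>2 + r\<^sup>2 * (norm (U 0))\<^sup>2)"
proof -
  have "r\<^sup>2 / p = r powr (2 - 2 * \<theta>)" using pos p by (simp add: powr_diff)
  then have "1 \<le> r\<^sup>2 / p" "1 \<le> p" using r1 p \<theta> by (simp_all add: ge_one_powr_ge_zero)
  then have "1 \<le> rate" by (simp add: rate_def)
  then have "\<kappa> * 1 * t \<le> \<kappa> * rate * t" using \<kappa> t by (intro mult_right_mono mult_left_mono) auto
  then have "exp (- (\<kappa> * rate) * t) \<le> exp (- \<kappa> * t)" by simp
  then have "K * exp (- (\<kappa> * rate) * t) * ((norm (V 0))\<^sup>2 + r\<^sup>2 * (norm (U 0))\<^sup>2) \<le> K * exp (- \<kappa> * t) * ((norm (V 0))\<^sup>2 + r\<^sup>2 * (norm (U 0))\<^sup>2)"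
    using K_ge by (intro mult_right_mono mult_left_mono) auto
  then show ?thesis using energy_decay[OF t] by linarith
qed

text \<open>Powers of r <= 1 decrease in the exponent, so the minimum defining the rate becomes a
  maximum of exponents and conversely.\<close>

lemma low_frequency_rate:
  assumes r1: "r \<le> 1" and p: "p = r powr (2 * \<theta>)"
  shows "rate = r powr max (2 * \<theta>) (2 - 2 * \<theta>)" and "max p r = r powr min 1 (2 * \<theta>)"
proof -
  have anti: "r powr y \<le> r powr x" if "x \<le> y" for x y using that r1 pos by (intro powr_mono') auto
  have eq: "r\<^sup>2 / p = r powr (2 - 2 * \<theta>)" using pos p by (simp add: powr_diff)
  have "rate = min (r powr (2 * \<theta>)) (r powr (2 - 2 * \<theta>))"
    unfolding rate_def eq p[symmetric] by (rule refl)
  then show "rate = r powr max (2 * \<theta>) (2 - 2 * \<theta>)"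
    using anti[of "2 * \<theta>" "2 - 2 * \<theta>"] anti[of "2 - 2 * \<theta>" "2 * \<theta>"]
    by (cases "2 * \<theta> \<le> 2 - 2 * \<theta>") (auto simp: max_def min_def)
  have "r = r powr 1" using pos by simp
  then show "max p r = r powr min 1 (2 * \<theta>)"
    unfolding p using anti[of "2 * \<theta>" 1] anti[of 1 "2 * \<theta>"]
    by (cases "2 * \<theta> \<le> 1") (auto simp: max_def min_def)
qed

text \<open>The squared coefficient of the velocity datum is at most the smaller of (1 + t)^2 and (1
  / max p r)^2, hence at most any geometric mean of them. Writing 1 + t for t keeps the base of the
  powers positive.\<close>

lemma low_frequency_U:
  assumes r1: "r \<le> 1" and p: "p = r powr (2 * \<theta>)" and k: "0 \<le> k" "k \<le> 1" and t: "0 \<le> t"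
  shows "(norm (U t))\<^sup>2 \<le> K' * exp (- \<kappa> * r powr max (2 * \<theta>) (2 - 2 * \<theta>) * t) *
    ((norm (U 0))\<^sup>2 + (1 + t) powr (2 * k) * r powr (2 * - (min 1 (2 * \<theta>) * (1 - k))) * (norm (V 0))\<^sup>2)"
proof -
  define M where "M = max p r"
  have M: "0 < M" using pos by (simp add: M_def)
  define X where "X = K' * exp (- (\<kappa> * rate) * t)"
  have X: "0 \<le> X" using K'_ge by (simp add: X_def)
  have t1: "0 < 1 + t" using t by simp
  have "(norm (U t))\<^sup>2 \<le> X * ((norm (U 0))\<^sup>2 + (1 + t)\<^sup>2 * (norm (V 0))\<^sup>2)"
  proof -
    have "(norm (U t))\<^sup>2 \<le> X * ((norm (U 0))\<^sup>2 + (t * norm (V 0))\<^sup>2)"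
      unfolding X_def by (rule U_decay_time[OF t])
    also have "\<dots> \<le> X * ((norm (U 0))\<^sup>2 + ((1 + t) * norm (V 0))\<^sup>2)"
      using t X by (intro mult_left_mono add_left_mono power_mono mult_right_mono) auto
    finally show ?thesis by (simp add: power_mult_distrib)
  qed
  moreover have "(norm (U t))\<^sup>2 \<le> X * ((norm (U 0))\<^sup>2 + (1 / M)\<^sup>2 * (norm (V 0))\<^sup>2)"
  proof -
    have "(norm (U t))\<^sup>2 \<le> K * exp (- (\<kappa> * rate) * t) * ((norm (U 0))\<^sup>2 + (norm (V 0) / M)\<^sup>2)"
      unfolding M_def by (rule U_decay[OF t])
    also have "\<dots> \<le> X * ((norm (U 0))\<^sup>2 + (norm (V 0) / M)\<^sup>2)"
      unfolding X_def using K'_ge by (intro mult_right_mono) auto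
    finally show ?thesis by (simp add: power_divide)
  qed
  ultimately have "(norm (U t))\<^sup>2 \<le> X * ((norm (U 0))\<^sup>2 + min ((1 + t)\<^sup>2) ((1 / M)\<^sup>2) * (norm (V 0))\<^sup>2)"
    by (auto simp: min_def)
  also have "\<dots> \<le> X * ((norm (U 0))\<^sup>2 + (((1 + t)\<^sup>2) powr k * ((1 / M)\<^sup>2) powr (1 - k)) * (norm (V 0))\<^sup>2)"
    using t1 M k X by (intro mult_left_mono add_left_mono mult_right_mono min_le_powr_interpolation) auto
  also have "((1 + t)\<^sup>2) powr k = (1 + t) powr (2 * k)"
    using t1 by (simp add: powr_powr flip: powr_numeral)
  also have "((1 / M)\<^sup>2) powr (1 - k) = r powr (2 * - (min 1 (2 * \<theta>) * (1 - k)))"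
  proof -
    have "(1 / M)\<^sup>2 = M powr (- 2)" using M by (simp add: powr_minus_divide power_divide)
    then show ?thesis unfolding M_def low_frequency_rate(2)[OF r1 p] by (simp add: powr_powr mult_ac)
  qed
  finally show ?thesis unfolding X_def low_frequency_rate(1)[OF r1 p] by simp
qed

lemma low_frequency_energy_underdamped:
  assumes r1: "r \<le> 1" and p: "p = r powr (2 * \<theta>)" and \<theta>: "1 / 2 \<le> \<theta>" and t: "0 \<le> t"
  shows "(norm (V t))\<^sup>2 + r\<^sup>2 * (norm (U t))\<^sup>2 \<le> K * exp (- \<kappa> * r powr (2 * \<theta>) * t) * ((norm (U 0))\<^sup>2 + (norm (V 0))\<^sup>2)"
proof -
  have "max (2 * \<theta>) (2 - 2 * \<theta>) = 2 * \<theta>" using \<theta> by simp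
  then have rate: "rate = r powr (2 * \<theta>)" using low_frequency_rate(1)[OF r1 p] by (simp only:)
  have "(norm (V t))\<^sup>2 + r\<^sup>2 * (norm (U t))\<^sup>2 \<le> K * exp (- (\<kappa> * rate) * t) * ((norm (V 0))\<^sup>2 + r\<^sup>2 * (norm (U 0))\<^sup>2)"
    by (rule energy_decay[OF t])
  also have "\<dots> \<le> K * exp (- (\<kappa> * rate) * t) * ((norm (V 0))\<^sup>2 + 1 * (norm (U 0))\<^sup>2)"
    using r1 pos K_ge by (intro mult_left_mono add_left_mono mult_right_mono) (auto simp: power_le_one)
  finally show ?thesis unfolding rate by (simp add: add.commute)
qed

text \<open>The velocity is split by \<open>V_decay\<close>. Its slow part and r |U| both gain
  r^(1-2\<theta>) over the data, as \<open>U_decay\<close> with max p r = p bounds the displacement;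
  the fast part has no gain but decays like exp(-p t).\<close>

lemma low_frequency_energy_overdamped:
  assumes r1: "r \<le> 1" and p: "p = r powr (2 * \<theta>)" and \<theta>: "0 \<le> \<theta>" "\<theta> < 1 / 2" and t: "0 \<le> t"
  shows "(norm (V t))\<^sup>2 + r\<^sup>2 * (norm (U t))\<^sup>2 \<le>
    (16 * b2\<^sup>2 + 1) * K * (r powr (2 * (1 - 2 * \<theta>)) * exp (- \<kappa> * r powr (2 - 2 * \<theta>) * t)) * ((norm (U 0))\<^sup>2 + (norm (V 0))\<^sup>2) +
    2 * exp (- 1 * r powr (2 * \<theta>) * t) * (norm (V 0))\<^sup>2"
proof -
  have anti: "r powr y \<le> r powr x" if "x \<le> y" for x y using that r1 pos by (intro powr_mono') auto
  have "max (2 * \<theta>) (2 - 2 * \<theta>) = 2 - 2 * \<theta>" using \<theta> by simp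
  then have rate: "rate = r powr (2 - 2 * \<theta>)" using low_frequency_rate(1)[OF r1 p] by (simp only:)
  have "min 1 (2 * \<theta>) = 2 * \<theta>" using \<theta> by simp
  then have "max p r = r powr (2 * \<theta>)" using low_frequency_rate(2)[OF r1 p] by (simp only:)
  then have mx: "max p r = p" by (rule trans[OF _ p[symmetric]])
  then have rp: "r \<le> p" by simp
  have rsq: "r\<^sup>2 = r powr 2" using pos by simp
  define E where "E = exp (- \<kappa> * r powr (2 - 2 * \<theta>) * t)"
  define x where "x = r powr (2 * (1 - 2 * \<theta>))"
  have E: "exp (- (\<kappa> * rate) * t) = E" by (simp add: E_def rate)
  have E0: "0 \<le> E" by (simp add: E_def)
  have x0: "0 \<le> x" by (simp add: x_def)
  define S where "S = (norm (U 0))\<^sup>2 + (norm (V 0))\<^sup>2"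
  have S0: "0 \<le> S" by (simp add: S_def)
  have p2: "p\<^sup>2 = r powr (4 * \<theta>)" unfolding p using pos by (simp add: powr_power mult.commute)
  \<comment> \<open>Applied with d = 2 for r^2 |U|^2 and d = 4 - 4\<theta> for the slow part of the
    velocity. The velocity datum loses p^-2 = r^(-4\<theta>); in both cases at least the exponent 2
    - 4\<theta> remains, since \<theta> < 1/2.\<close>
  have uv: "c * ((norm (U 0))\<^sup>2 + (norm (V 0) / p)\<^sup>2) \<le> x * S" if c: "c = r powr d" "2 - 4 * \<theta> \<le> d - 4 * \<theta>" for c d
  proof -
    have "c * ((norm (U 0))\<^sup>2 + (norm (V 0) / p)\<^sup>2) = r powr d * (norm (U 0))\<^sup>2 + r powr (d - 4 * \<theta>) * (norm (V 0))\<^sup>2"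
      unfolding c(1) using pos by (simp add: power_divide p2 powr_diff algebra_simps)
    also have "\<dots> \<le> x * (norm (U 0))\<^sup>2 + x * (norm (V 0))\<^sup>2"
      unfolding x_def using c(2) \<theta> by (intro add_mono mult_right_mono anti) auto
    finally show ?thesis by (simp add: S_def algebra_simps)
  qed
  have "(norm (U t))\<^sup>2 \<le> K * E * ((norm (U 0))\<^sup>2 + (norm (V 0) / p)\<^sup>2)"
    using U_decay[OF t] unfolding mx E .
  then have "r\<^sup>2 * (norm (U t))\<^sup>2 \<le> r\<^sup>2 * (K * E * ((norm (U 0))\<^sup>2 + (norm (V 0) / p)\<^sup>2))"
    by (intro mult_left_mono) auto
  also have "\<dots> = K * E * (r\<^sup>2 * ((norm (U 0))\<^sup>2 + (norm (V 0) / p)\<^sup>2))" by simp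
  also have "\<dots> \<le> K * E * (x * S)"
    using K_ge E0 by (intro mult_left_mono uv[OF rsq]) auto
  finally have Ub: "r\<^sup>2 * (norm (U t))\<^sup>2 \<le> K * E * (x * S)" .
  have rp4: "(r\<^sup>2 / p)\<^sup>2 = r powr (4 - 4 * \<theta>)"
  proof -
    have "r\<^sup>2 / p = r powr (2 - 2 * \<theta>)" using pos p by (simp add: powr_diff)
    then show ?thesis using pos by (simp add: powr_power algebra_simps)
  qed
  have "16 * b2\<^sup>2 * K * (r\<^sup>2 / p)\<^sup>2 * E * ((norm (U 0))\<^sup>2 + (norm (V 0) / p)\<^sup>2) =
      16 * b2\<^sup>2 * K * E * ((r\<^sup>2 / p)\<^sup>2 * ((norm (U 0))\<^sup>2 + (norm (V 0) / p)\<^sup>2))" by simp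
  also have "\<dots> \<le> 16 * b2\<^sup>2 * K * E * (x * S)"
    using K_ge E0 \<theta> by (intro mult_left_mono uv[OF rp4]) auto
  finally have "(norm (V t))\<^sup>2 \<le> 2 * (exp (- p * t) * norm (V 0))\<^sup>2 + 16 * b2\<^sup>2 * K * E * (x * S)"
    using V_decay[OF rp t] unfolding E by linarith
  moreover have "2 * (exp (- p * t) * norm (V 0))\<^sup>2 \<le> 2 * exp (- 1 * r powr (2 * \<theta>) * t) * (norm (V 0))\<^sup>2"
  proof -
    have "(exp (- p * t))\<^sup>2 = exp (- p * t) * exp (- p * t)" by (simp add: power2_eq_square)
    also have "\<dots> \<le> exp (- p * t) * 1" using pos t by (intro mult_left_mono) auto
    finally have "(exp (- p * t))\<^sup>2 * (norm (V 0))\<^sup>2 \<le> exp (- p * t) * (norm (V 0))\<^sup>2" by (intro mult_right_mono) auto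
    then show ?thesis by (simp add: power_mult_distrib p)
  qed
  moreover have "(16 * b2\<^sup>2 + 1) * K * (x * E) * S = 16 * b2\<^sup>2 * K * E * (x * S) + K * E * (x * S)"
    by (simp add: algebra_simps)
  ultimately show ?thesis using Ub unfolding S_def[symmetric] E_def[symmetric] x_def[symmetric] by linarith
qed

end

section \<open>Bounded integrals of nonnegative functions and the homogeneous norms\<close>

text \<open>Integrability is a conclusion of the estimates, and a Bochner integral is 0 by default
  when it fails. Bounding the nonnegative integral gives integrability and the numerical bound
  together, and the predicate is stable under sums, scaling and domination.\<close>

definition nn_integral_bounded :: "(real^3 \<Rightarrow> real) \<Rightarrow> real \<Rightarrow> bool" where
  "nn_integral_bounded f B \<longleftrightarrow> f \<in> borel_measurable borel \<and> (\<forall>x. 0 \<le> f x) \<and> 0 \<le> B \<and>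
     (\<integral>\<^sup>+x. ennreal (f x) \<partial>lborel) \<le> ennreal B"

lemma nn_integral_bounded_add:
  assumes "nn_integral_bounded f A" "nn_integral_bounded g B"
  shows "nn_integral_bounded (\<lambda>x. f x + g x) (A + B)"
proof -
  have [measurable]: "f \<in> borel_measurable borel" "g \<in> borel_measurable borel" using assms by (auto simp: nn_integral_bounded_def)
  have "(\<integral>\<^sup>+x. ennreal (f x + g x) \<partial>lborel) = (\<integral>\<^sup>+x. ennreal (f x) + ennreal (g x) \<partial>lborel)"
    using assms by (intro nn_integral_cong) (auto simp: nn_integral_bounded_def)
  also have "\<dots> = (\<integral>\<^sup>+x. ennreal (f x) \<partial>lborel) + (\<integral>\<^sup>+x. ennreal (g x) \<partial>lborel)"
    by (rule nn_integral_add) measurable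
  also have "\<dots> \<le> ennreal A + ennreal B" using assms by (intro add_mono) (auto simp: nn_integral_bounded_def)
  finally show ?thesis using assms by (auto simp: nn_integral_bounded_def)
qed

lemma nn_integral_bounded_cmult:
  assumes "nn_integral_bounded f B" "0 \<le> c"
  shows "nn_integral_bounded (\<lambda>x. c * f x) (c * B)"
proof -
  have [measurable]: "f \<in> borel_measurable borel" using assms by (auto simp: nn_integral_bounded_def)
  have "(\<integral>\<^sup>+x. ennreal (c * f x) \<partial>lborel) = ennreal c * (\<integral>\<^sup>+x. ennreal (f x) \<partial>lborel)"
    using assms by (simp add: nn_integral_bounded_def ennreal_mult nn_integral_cmult)
  also have "\<dots> \<le> ennreal c * ennreal B" using assms by (intro mult_left_mono) (auto simp: nn_integral_bounded_def)
  finally show ?thesis using assms by (auto simp: nn_integral_bounded_def ennreal_mult)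
qed

lemma nn_integral_bounded_sum:
  assumes "finite I" "\<And>i. i \<in> I \<Longrightarrow> nn_integral_bounded (f i) (B i)"
  shows "nn_integral_bounded (\<lambda>x. \<Sum>i\<in>I. f i x) (\<Sum>i\<in>I. B i)"
  using assms
proof (induction I rule: finite_induct)
  case empty then show ?case by (simp add: nn_integral_bounded_def)
next
  case (insert i I)
  then show ?case using nn_integral_bounded_add[of "f i" "B i" "\<lambda>x. \<Sum>i\<in>I. f i x" "\<Sum>i\<in>I. B i"] by simp
qed

lemma nn_integral_bounded_mono:
  assumes f: "nn_integral_bounded f A" and g: "g \<in> borel_measurable borel" "\<And>x. 0 \<le> g x"
    and le: "AE x in lborel. g x \<le> f x" and AB: "A \<le> B"
  shows "nn_integral_bounded g B"
proof -
  have "(\<integral>\<^sup>+x. ennreal (g x) \<partial>lborel) \<le> (\<integral>\<^sup>+x. ennreal (f x) \<partial>lborel)"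
    using le by (intro nn_integral_mono_AE) (auto intro: ennreal_leI)
  also have "\<dots> \<le> ennreal A" using f by (simp add: nn_integral_bounded_def)
  also have "\<dots> \<le> ennreal B" by (intro ennreal_leI AB)
  finally show ?thesis using f g AB by (auto simp: nn_integral_bounded_def)
qed

lemma nn_integral_bounded_integrable:
  assumes "nn_integral_bounded f B"
  shows "integrable lborel f" and "(\<integral>x. f x \<partial>lborel) \<le> B"
proof -
  have [measurable]: "f \<in> borel_measurable borel" using assms by (auto simp: nn_integral_bounded_def)
  have f0: "0 \<le> f x" for x using assms by (simp add: nn_integral_bounded_def)
  have le: "(\<integral>\<^sup>+x. ennreal (f x) \<partial>lborel) \<le> ennreal B" "0 \<le> B" using assms by (auto simp: nn_integral_bounded_def)
  show i: "integrable lborel f"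
    by (rule integrableI_nonneg) (use f0 le in \<open>auto simp: less_top[symmetric] top_unique intro: le_less_trans\<close>)
  have "ennreal (\<integral>x. f x \<partial>lborel) \<le> ennreal B"
    using le nn_integral_eq_integral[OF i] f0 by simp
  then show "(\<integral>x. f x \<partial>lborel) \<le> B" using le by simp
qed

lemma nn_integral_bounded_of_integrable:
  assumes "integrable lborel f" "\<And>x. 0 \<le> f x" "(\<integral>x. f x \<partial>lborel) \<le> B"
  shows "nn_integral_bounded f B"
proof -
  have "0 \<le> (\<integral>x. f x \<partial>lborel)" using assms by simp
  then have "0 \<le> B" using assms(3) by linarith
  then show ?thesis using assms by (auto simp: nn_integral_bounded_def nn_integral_eq_integral intro!: ennreal_leI)
qed

lemma memHdot_bounded:
  assumes "memHdot \<sigma> F"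
  shows "nn_integral_bounded (\<lambda>\<xi>. norm \<xi> powr (2 * \<sigma>) * (cmod (F \<xi>))\<^sup>2) ((2 * pi) ^ 3 * (Hdot_norm \<sigma> F)\<^sup>2)"
proof (rule nn_integral_bounded_of_integrable)
  have "(x powr (3 / 2))\<^sup>2 = x ^ 3" if "0 < x" for x :: real
    using that by (simp add: powr_power)
  from this[of "2 * pi"] have "(2 * pi) ^ 3 * (Hdot_norm \<sigma> F)\<^sup>2 = (\<integral>\<xi>. norm \<xi> powr (2 * \<sigma>) * (cmod (F \<xi>))\<^sup>2 \<partial>lborel)"
    by (simp add: Hdot_norm_def power_divide)
  then show "(\<integral>\<xi>. norm \<xi> powr (2 * \<sigma>) * (cmod (F \<xi>))\<^sup>2 \<partial>lborel) \<le> (2 * pi) ^ 3 * (Hdot_norm \<sigma> F)\<^sup>2" by simp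
qed (use assms in \<open>auto simp: memHdot_def\<close>)

lemma memHdot_of_bounded:
  assumes b: "nn_integral_bounded (\<lambda>\<xi>. norm \<xi> powr (2 * \<sigma>) * (cmod (F \<xi>))\<^sup>2) (B\<^sup>2)" and B: "0 \<le> B"
  shows "memHdot \<sigma> F" and "Hdot_norm \<sigma> F \<le> B"
proof -
  note I = nn_integral_bounded_integrable[OF b]
  show "memHdot \<sigma> F" using I by (simp add: memHdot_def)
  \<comment> \<open>The Plancherel factor in \<open>Hdot_norm\<close> is a divisor at least 1, so
    for upper bounds it may be dropped.\<close>
  have "1 \<le> (2 * pi) powr (3 / 2)" using pi_gt3 by (intro ge_one_powr_ge_zero) auto
  then have "Hdot_norm \<sigma> F \<le> sqrt (\<integral>\<xi>. norm \<xi> powr (2 * \<sigma>) * (cmod (F \<xi>))\<^sup>2 \<partial>lborel) / 1"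
    unfolding Hdot_norm_def by (intro divide_left_mono) auto
  also have "\<dots> \<le> B" using I B by (simp add: real_le_lsqrt)
  finally show "Hdot_norm \<sigma> F \<le> B" .
qed

lemma memLp2_of_bounded:
  assumes b: "nn_integral_bounded (\<lambda>x. (f x)\<^sup>2) (B\<^sup>2)" and B: "0 \<le> B" and f: "f \<in> borel_measurable borel"
  shows "memLp 2 f" and "Lp_norm 2 f \<le> B"
proof -
  note I = nn_integral_bounded_integrable[OF b]
  show "memLp 2 f" using I f by (simp add: memLp_def)
  show "Lp_norm 2 f \<le> B" using I B by (simp add: Lp_norm_def powr_half_sqrt real_le_lsqrt)
qed

text \<open>Low frequencies are controlled by the L^m bound on the unit ball, high ones by the
  higher order norm. It makes the norms of order 1 and 0 in the first estimate finite, although the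
  data are only assumed to lie in the spaces of order s + 1 and s.\<close>

lemma memHdot_lower_order:
  assumes FT: "is_FT f F" and f: "memLp m f" and m: "1 \<le> m" "m \<le> 2" and F: "memHdot \<sigma>' F" and \<sigma>: "0 \<le> \<sigma>" "\<sigma> \<le> \<sigma>'"
  shows "memHdot \<sigma> F"
proof -
  have [measurable]: "F \<in> borel_measurable borel" by (rule is_FT_measurable[OF FT])
  let ?A = "2 * exp 1 * HY_const * 1 powr (6 / m - 3) * (Lp_norm m f)\<^sup>2"
  have 1: "nn_integral_bounded (\<lambda>\<xi>. (cmod (F \<xi>))\<^sup>2 * indicator {\<xi>. norm \<xi> \<le> 1} \<xi>) ?A"
    using is_FT_ball_bound[OF FT f m, of 1] HY_const_pos
    by (auto simp: nn_integral_bounded_def ennreal_mult ennreal_indicator)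
  have "nn_integral_bounded (\<lambda>\<xi>. norm \<xi> powr (2 * \<sigma>) * (cmod (F \<xi>))\<^sup>2) (?A + (2 * pi) ^ 3 * (Hdot_norm \<sigma>' F)\<^sup>2)"
  proof (rule nn_integral_bounded_mono[OF nn_integral_bounded_add[OF 1 memHdot_bounded[OF F]]])
    show "AE \<xi> in lborel. norm \<xi> powr (2 * \<sigma>) * (cmod (F \<xi>))\<^sup>2 \<le>
        (cmod (F \<xi>))\<^sup>2 * indicator {\<xi>. norm \<xi> \<le> 1} \<xi> + norm \<xi> powr (2 * \<sigma>') * (cmod (F \<xi>))\<^sup>2"
    proof (rule AE_I2)
      fix \<xi> :: "real^3"
      show "norm \<xi> powr (2 * \<sigma>) * (cmod (F \<xi>))\<^sup>2 \<le>
        (cmod (F \<xi>))\<^sup>2 * indicator {\<xi>. norm \<xi> \<le> 1} \<xi> + norm \<xi> powr (2 * \<sigma>') * (cmod (F \<xi>))\<^sup>2"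
      proof (cases "norm \<xi> \<le> 1")
        case True
        then have "norm \<xi> powr (2 * \<sigma>) * (cmod (F \<xi>))\<^sup>2 \<le> 1 * (cmod (F \<xi>))\<^sup>2"
          using \<sigma> by (intro mult_right_mono powr_le1) auto
        moreover have "0 \<le> norm \<xi> powr (2 * \<sigma>') * (cmod (F \<xi>))\<^sup>2" by simp
        moreover have "(cmod (F \<xi>))\<^sup>2 * indicator {\<xi>. norm \<xi> \<le> 1} \<xi> = (cmod (F \<xi>))\<^sup>2" using True by simp
        ultimately show ?thesis by linarith
      next
        case False
        then have "norm \<xi> powr (2 * \<sigma>) * (cmod (F \<xi>))\<^sup>2 \<le> norm \<xi> powr (2 * \<sigma>') * (cmod (F \<xi>))\<^sup>2"
          using \<sigma> by (intro mult_right_mono powr_mono) auto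
        then show ?thesis using False by simp
      qed
    qed
  qed auto
  then show ?thesis using nn_integral_bounded_integrable(1) by (simp add: memHdot_def)
qed


section \<open>Estimates for the Lame system\<close>


lemma norm_vec_complex_sq: "(norm (W :: complex^'n))\<^sup>2 = (\<Sum>j\<in>UNIV. (cmod (W $ j))\<^sup>2)"
  by (simp add: norm_vec_def L2_set_def sum_nonneg)

lemma sum_squares_le_square_sum:
  fixes D :: "'i \<Rightarrow> real"
  assumes "finite I" "\<And>i. i \<in> I \<Longrightarrow> 0 \<le> D i"
  shows "(\<Sum>i\<in>I. (D i)\<^sup>2) \<le> (\<Sum>i\<in>I. D i)\<^sup>2"
proof -
  have "(\<Sum>i\<in>I. (D i)\<^sup>2) \<le> (\<Sum>i\<in>I. D i * (\<Sum>i\<in>I. D i))"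
    unfolding power2_eq_square using assms by (intro sum_mono mult_left_mono member_le_sum) auto
  then show ?thesis by (simp add: power2_eq_square sum_distrib_right)
qed

lemma Lp_norm_nonneg: "0 \<le> Lp_norm p f"
  by (simp add: Lp_norm_def)

lemma Hdot_norm_nonneg: "0 \<le> Hdot_norm \<sigma> F"
  by (simp add: Hdot_norm_def)

text \<open>\<open>e\<close> is the decay exponent of the norm, so the squared quantities carry
  \<open>2 * e\<close>. The constant \<open>C\<close> is fixed before the data and the time.\<close>

definition low_frequency_estimate :: "real \<Rightarrow> (real \<Rightarrow> real^3 \<Rightarrow> real) \<Rightarrow> real \<Rightarrow> real \<Rightarrow> bool" where
  "low_frequency_estimate m w e C \<longleftrightarrow> 0 < C \<and> (\<forall>f F t. is_FT f F \<longrightarrow> memLp m f \<longrightarrow> 0 \<le> t \<longrightarrow>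
     nn_integral_bounded (\<lambda>\<xi>. w t \<xi> * (cmod (F \<xi>))\<^sup>2) (C * (1 + t) powr (2 * e) * (Lp_norm m f)\<^sup>2))"

lemma low_frequency_estimateD:
  assumes "low_frequency_estimate m w e C"
  shows "0 < C" and "is_FT f F \<Longrightarrow> memLp m f \<Longrightarrow> 0 \<le> t \<Longrightarrow>
    nn_integral_bounded (\<lambda>\<xi>. w t \<xi> * (cmod (F \<xi>))\<^sup>2) (C * (1 + t) powr (2 * e) * (Lp_norm m f)\<^sup>2)"
  using assms unfolding low_frequency_estimate_def by blast+

lemma low_frequency_estimate_exists:
  fixes m \<alpha> \<beta> \<kappa> e :: real
  assumes m: "1 \<le> m" "m \<le> 2" and \<beta>: "0 < \<beta>" and \<kappa>: "0 < \<kappa>" and \<mu>: "0 < 2 * \<alpha> + (6 / m - 3)"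
    and e: "- (2 * \<alpha> + (6 / m - 3)) / \<beta> \<le> 2 * e"
  shows "\<exists>C. low_frequency_estimate m (low_weight \<alpha> \<kappa> \<beta>) e C"
proof -
  obtain C where C: "0 < C" "\<And>f F t. is_FT f F \<Longrightarrow> memLp m f \<Longrightarrow> 0 \<le> t \<Longrightarrow>
    (\<integral>\<^sup>+\<xi>. ennreal (low_weight \<alpha> \<kappa> \<beta> t \<xi> * (cmod (F \<xi>))\<^sup>2) \<partial>lborel)
    \<le> ennreal (C * (1 + t) powr (- (2 * \<alpha> + (6 / m - 3)) / \<beta>) * (Lp_norm m f)\<^sup>2)"
    using low_frequency_decay[OF m \<beta> \<kappa> \<mu>] by blast
  show ?thesis
    unfolding low_frequency_estimate_def
  proof (intro exI[of _ C] conjI[OF C(1)] allI impI)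
    fix f F and t :: real
    assume FT: "is_FT f F" and f: "memLp m f" and t: "0 \<le> t"
    have [measurable]: "F \<in> borel_measurable borel" by (rule is_FT_measurable[OF FT])
    have "ennreal (C * (1 + t) powr (- (2 * \<alpha> + (6 / m - 3)) / \<beta>) * (Lp_norm m f)\<^sup>2) \<le> ennreal (C * (1 + t) powr (2 * e) * (Lp_norm m f)\<^sup>2)"
      using C(1) t e by (intro ennreal_leI mult_right_mono mult_left_mono powr_mono) auto
    note le = order_trans[OF C(2)[OF FT f t] this]
    have "(\<lambda>\<xi>. low_weight \<alpha> \<kappa> \<beta> t \<xi> * (cmod (F \<xi>))\<^sup>2) \<in> borel_measurable borel" by measurable
    then show "nn_integral_bounded (\<lambda>\<xi>. low_weight \<alpha> \<kappa> \<beta> t \<xi> * (cmod (F \<xi>))\<^sup>2) (C * (1 + t) powr (2 * e) * (Lp_norm m f)\<^sup>2)"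
      using le C(1) unfolding nn_integral_bounded_def by simp
  qed
qed

locale lame_problem = damping_constants "a\<^sup>2" "b\<^sup>2" for a b :: real +
  fixes \<theta> s m :: real
  assumes \<theta>: "0 \<le> \<theta>" "\<theta> \<le> 1" and s: "0 \<le> s" and m: "1 \<le> m" "m < 2"
begin

lemma m_le_2: "m \<le> 2"
  using m by simp

lemma m_exponent_pos: "0 < 6 / m - 3"
  using m by (simp add: field_simps)

lemma K_pos: "0 < K" and K'_pos: "0 < K'"
  using K_ge K'_ge by auto

definition solution :: "(real \<Rightarrow> real^3 \<Rightarrow> real^3) \<Rightarrow> (real \<Rightarrow> real^3 \<Rightarrow> real^3) \<Rightarrow>
    (real \<Rightarrow> real^3 \<Rightarrow> complex^3) \<Rightarrow> (real \<Rightarrow> real^3 \<Rightarrow> complex^3) \<Rightarrow> bool" where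
  "solution u v U V \<longleftrightarrow>
     (\<forall>t\<ge>0. \<forall>k. is_FT (\<lambda>x. u t x $ k) (\<lambda>\<xi>. U t \<xi> $ k) \<and> is_FT (\<lambda>x. v t x $ k) (\<lambda>\<xi>. V t \<xi> $ k)) \<and>
     (AE \<xi> in lborel. \<forall>t\<ge>0.
        ((\<lambda>\<tau>. U \<tau> \<xi>) has_vector_derivative V t \<xi>) (at t within {0..}) \<and>
        ((\<lambda>\<tau>. V \<tau> \<xi>) has_vector_derivative lame_rhs a b \<theta> \<xi> (U t \<xi>) (V t \<xi>)) (at t within {0..})) \<and>
     (\<forall>k. memHdot (s + 1) (\<lambda>\<xi>. U 0 \<xi> $ k) \<and> memLp m (\<lambda>x. u 0 x $ k) \<and>
        memHdot s (\<lambda>\<xi>. V 0 \<xi> $ k) \<and> memLp m (\<lambda>x. v 0 x $ k))"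

lemma solutionD:
  assumes "solution u v U V"
  shows "0 \<le> t \<Longrightarrow> is_FT (\<lambda>x. u t x $ k) (\<lambda>\<xi>. U t \<xi> $ k)"
    and "0 \<le> t \<Longrightarrow> is_FT (\<lambda>x. v t x $ k) (\<lambda>\<xi>. V t \<xi> $ k)"
    and "memHdot (s + 1) (\<lambda>\<xi>. U 0 \<xi> $ k)" "memLp m (\<lambda>x. u 0 x $ k)"
    and "memHdot s (\<lambda>\<xi>. V 0 \<xi> $ k)" "memLp m (\<lambda>x. v 0 x $ k)"
  using assms by (auto simp: solution_def)

text \<open>The origin is a null set and is discarded, because \<open>damped_system\<close> requires
  positive \<open>r\<close> and \<open>p\<close>.\<close>

lemma solution_damped_system:
  assumes sol: "solution u v U V"
  shows "AE \<xi> in lborel. \<xi> \<noteq> 0 \<and>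
    damped_system (a\<^sup>2) (b\<^sup>2) (lame_symbol a b \<xi>) (norm \<xi> powr (2 * \<theta>)) (norm \<xi>) (\<lambda>t. U t \<xi>) (\<lambda>t. V t \<xi>)"
proof -
  have "AE \<xi> in lborel. \<forall>t\<ge>0.
        ((\<lambda>\<tau>. U \<tau> \<xi>) has_vector_derivative V t \<xi>) (at t within {0..}) \<and>
        ((\<lambda>\<tau>. V \<tau> \<xi>) has_vector_derivative lame_rhs a b \<theta> \<xi> (U t \<xi>) (V t \<xi>)) (at t within {0..})"
    using sol by (simp add: solution_def)
  moreover have "AE \<xi> in lborel. \<xi> \<noteq> (0::real^3)" by (rule AE_lborel_singleton)
  ultimately show ?thesis
  proof eventually_elim
    case (elim \<xi>)
    then show ?case
      using damped_system_lame[OF a2_pos a2_le, of \<xi> "\<lambda>t. U t \<xi>" "\<lambda>t. V t \<xi>" \<theta>] by auto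
  qed
qed

text \<open>The parameter \<open>k\<close> is the share of the factor 1 + t in the interpolated
  weight of the velocity datum. The condition \<open>kq\<close> keeps that weight summable at the
  origin. The last hypothesis compares the target with the growth (1 + t)^(2k) reduced by the low
  frequency decay that the weight still allows.\<close>

lemma displacement_bound:
  fixes k e :: real
  assumes k: "0 \<le> k" "k \<le> 1" and kq: "2 * (min 1 (2 * \<theta>) * (1 - k)) < 6 / m - 3"
    and e: "2 * k - (6 / m - 3 - 2 * (min 1 (2 * \<theta>) * (1 - k))) / max (2 * \<theta>) (2 - 2 * \<theta>) \<le> 2 * e"
  shows "\<exists>C>0. \<forall>u v U V t k. solution u v U V \<longrightarrow> 0 \<le> t \<longrightarrow>
    nn_integral_bounded (\<lambda>\<xi>. (cmod (U t \<xi> $ k))\<^sup>2) (C * (1 + t) powr (2 * e) *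
      (\<Sum>j\<in>UNIV. Hdot_norm 1 (\<lambda>\<xi>. U 0 \<xi> $ j) + Lp_norm m (\<lambda>x. u 0 x $ j)
        + Lp_norm 2 (\<lambda>x. v 0 x $ j) + Lp_norm m (\<lambda>x. v 0 x $ j))\<^sup>2)"
proof -
  define \<tau> where "\<tau> = min 1 (2 * \<theta>)"
  define \<beta> where "\<beta> = max (2 * \<theta>) (2 - 2 * \<theta>)"
  define \<alpha> where "\<alpha> = - (\<tau> * (1 - k))"
  have \<beta>: "0 < \<beta>" by (simp add: \<beta>_def)
  have \<tau>k: "0 \<le> \<tau> * (1 - k)" using \<theta> k by (simp add: \<tau>_def)
  have e0: "- (2 * 0 + (6 / m - 3)) / \<beta> \<le> 2 * e"
  proof -
    have "(6 / m - 3 - 2 * (\<tau> * (1 - k))) / \<beta> \<le> (6 / m - 3) / \<beta>"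
      using \<tau>k \<beta> by (intro divide_right_mono) auto
    moreover have "- (2 * 0 + (6 / m - 3)) / \<beta> = - ((6 / m - 3) / \<beta>)" unfolding minus_divide_left by simp
    ultimately show ?thesis using e k unfolding \<tau>_def[symmetric] \<beta>_def[symmetric] by linarith
  qed
  obtain C1 where C1: "low_frequency_estimate m (low_weight 0 \<kappa> \<beta>) e C1"
    using low_frequency_estimate_exists[OF m(1) m_le_2 \<beta> \<kappa>(1) _ e0] m_exponent_pos by force
  have \<alpha>1: "0 < 2 * \<alpha> + (6 / m - 3)" using kq by (simp add: \<alpha>_def \<tau>_def)
  have \<alpha>2: "- (2 * \<alpha> + (6 / m - 3)) / \<beta> \<le> 2 * (e - k)"
  proof -
    define Y where "Y = (6 / m - 3 - 2 * (\<tau> * (1 - k))) / \<beta>"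
    have "- (2 * \<alpha> + (6 / m - 3)) / \<beta> = - Y"
      unfolding Y_def \<alpha>_def minus_divide_left by simp
    moreover have "2 * k - Y \<le> 2 * e" using e unfolding Y_def \<tau>_def \<beta>_def .
    ultimately show ?thesis by (simp only: right_diff_distrib)
  qed
  obtain C2 where C2: "low_frequency_estimate m (low_weight \<alpha> \<kappa> \<beta>) (e - k) C2"
    using low_frequency_estimate_exists[OF m(1) m_le_2 \<beta> \<kappa>(1) \<alpha>1 \<alpha>2] by blast
  obtain C3 where C3: "0 < C3" "\<And>t. 0 \<le> t \<Longrightarrow> exp (- \<kappa> * t) \<le> C3 * (1 + t) powr (2 * e)"
    using exp_decay_le_powr[OF \<kappa>(1), of "2 * e"] by blast
  note C12 = low_frequency_estimateD(1)[OF C1] low_frequency_estimateD(1)[OF C2]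
  define C where "C = K' * C1 + K' * C2 + K * C3 * (2 * pi) ^ 3 + K * C3 * (2 * HY_const)"
  have Cp: "0 < K' * C1" "0 < K' * C2" "0 < K * C3 * (2 * pi) ^ 3" "0 < K * C3 * (2 * HY_const)"
    using K_pos K'_pos C12 C3(1) HY_const_pos by auto
  show ?thesis
  proof (intro exI[of _ C] conjI allI impI)
    show C: "0 < C" unfolding C_def using Cp by linarith
    fix u v :: "real \<Rightarrow> real^3 \<Rightarrow> real^3" and U V :: "real \<Rightarrow> real^3 \<Rightarrow> complex^3" and t :: real and i :: 3
    assume sol: "solution u v U V" and t: "0 \<le> t"
    note S = solutionD[OF sol]
    define X E T where "X = (1 + t) powr (2 * e)" and "E = exp (- \<kappa> * t)" and "T = (1 + t) powr (2 * k)"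
    have X: "0 \<le> X" and E: "0 \<le> E" "E \<le> C3 * X" and T: "0 \<le> T"
      using C3(2)[OF t] by (simp_all add: E_def X_def T_def)
    \<comment> \<open>The growth from the interpolation is compensated by having estimated the
      weighted velocity datum with the exponent e - k.\<close>
    have TX: "T * (1 + t) powr (2 * (e - k)) = X"
      using t unfolding T_def X_def powr_add[symmetric] by (simp add: algebra_simps)
    define h0 h1 l0 l1 where "h0 = (\<lambda>j. Hdot_norm 1 (\<lambda>\<xi>. U 0 \<xi> $ j))" and "h1 = (\<lambda>j. Lp_norm 2 (\<lambda>x. v 0 x $ j))"
      and "l0 = (\<lambda>j. Lp_norm m (\<lambda>x. u 0 x $ j))" and "l1 = (\<lambda>j. Lp_norm m (\<lambda>x. v 0 x $ j))"
    have nn0: "0 \<le> h0 j" "0 \<le> h1 j" "0 \<le> l0 j" "0 \<le> l1 j" for j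
      by (auto simp: h0_def h1_def l0_def l1_def Lp_norm_nonneg Hdot_norm_nonneg)
    define D where "D = (\<lambda>j. h0 j + l0 j + h1 j + l1 j)"
    have D0: "0 \<le> D j" for j using nn0[of j] by (simp add: D_def)
    define f1 f2 where "f1 = (\<lambda>j \<xi>. low_weight 0 \<kappa> \<beta> t \<xi> * (cmod (U 0 \<xi> $ j))\<^sup>2)"
      and "f2 = (\<lambda>j \<xi>. low_weight \<alpha> \<kappa> \<beta> t \<xi> * (cmod (V 0 \<xi> $ j))\<^sup>2)"
    define f3 f4 where "f3 = (\<lambda>j (\<xi>::real^3). norm \<xi> powr (2 * 1) * (cmod (U 0 \<xi> $ j))\<^sup>2)"
      and "f4 = (\<lambda>j (\<xi>::real^3). (cmod (V 0 \<xi> $ j))\<^sup>2)"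
    define G where "G = (\<lambda>j \<xi>. K' * f1 j \<xi> + K' * T * f2 j \<xi> + K * E * f3 j \<xi> + K * E * f4 j \<xi>)"
    have nn: "0 \<le> K' * f1 j \<xi>" "0 \<le> K' * T * f2 j \<xi>" "0 \<le> K * E * f3 j \<xi>" "0 \<le> K * E * f4 j \<xi>" for j \<xi>
      using K_pos K'_pos E T by (auto simp: f1_def f2_def f3_def f4_def)
    have b1: "nn_integral_bounded (f1 j) (C1 * X * (l0 j)\<^sup>2)" for j
      unfolding f1_def X_def l0_def by (rule low_frequency_estimateD(2)[OF C1 S(1)[OF order_refl] S(4) t])
    have b2: "nn_integral_bounded (f2 j) (C2 * (1 + t) powr (2 * (e - k)) * (l1 j)\<^sup>2)" for j
      unfolding f2_def l1_def by (rule low_frequency_estimateD(2)[OF C2 S(2)[OF order_refl] S(6) t])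
    have b3: "nn_integral_bounded (f3 j) ((2 * pi) ^ 3 * (h0 j)\<^sup>2)" for j
      unfolding f3_def h0_def using s
      by (intro memHdot_bounded memHdot_lower_order[OF S(1)[OF order_refl] S(4) m(1) m_le_2 S(3)]) auto
    have b4: "nn_integral_bounded (f4 j) (2 * HY_const * (h1 j)\<^sup>2)" for j
    proof -
      note FT = S(2)[OF order_refl, of j]
      have [measurable]: "(\<lambda>\<xi>. V 0 \<xi> $ j) \<in> borel_measurable borel" by (rule is_FT_measurable[OF FT])
      have "memHdot 0 (\<lambda>\<xi>. V 0 \<xi> $ j)"
        using s by (intro memHdot_lower_order[OF FT S(6) m(1) m_le_2 S(5)]) auto
      \<comment> \<open>Order 0 is the unweighted square only away from the origin, because
        \<open>0 powr 0 = 0\<close>; hence the appeal to a null set.\<close>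
      then have "nn_integral_bounded (f4 j) ((2 * pi) ^ 3 * (Hdot_norm 0 (\<lambda>\<xi>. V 0 \<xi> $ j))\<^sup>2)"
        unfolding f4_def using AE_lborel_singleton[of "0::real^3"]
        by (intro nn_integral_bounded_mono[OF memHdot_bounded]) auto
      note I = nn_integral_bounded_integrable(1)[OF this, unfolded f4_def]
      \<comment> \<open>\<open>Lp_norm 2\<close> of a function that is not square integrable would
        be 0 by default. So the velocity datum is first shown to be in L^2, from its transform,
        before its transform is bounded by that norm.\<close>
      let ?B = "sqrt (HY_const * (\<integral>\<xi>. (cmod (V 0 \<xi> $ j))\<^sup>2 \<partial>lborel))"
      have "memLp 2 (\<lambda>x. v 0 x $ j)"
      proof (rule memLp2_of_bounded)
        show "nn_integral_bounded (\<lambda>x. (v 0 x $ j)\<^sup>2) (?B\<^sup>2)"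
          using is_FT_L2_inverse_bound[OF FT I] is_FT_measurable(2)[OF FT] HY_const_pos
          by (auto simp: nn_integral_bounded_def)
        show "0 \<le> ?B" using HY_const_pos by simp
      qed (rule is_FT_measurable(2)[OF FT])
      from is_FT_L2_bound[OF FT this] show ?thesis
        using HY_const_pos unfolding f4_def h1_def nn_integral_bounded_def by auto
    qed
    have bG: "nn_integral_bounded (G j) (C * X * (D j)\<^sup>2)" for j
    proof -
      let ?B = "K' * (C1 * X * (l0 j)\<^sup>2) + K' * T * (C2 * (1 + t) powr (2 * (e - k)) * (l1 j)\<^sup>2) +
         K * E * ((2 * pi) ^ 3 * (h0 j)\<^sup>2) + K * E * (2 * HY_const * (h1 j)\<^sup>2)"
      have b: "nn_integral_bounded (G j) ?B"
        unfolding G_def using K_pos K'_pos E T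
        by (intro nn_integral_bounded_add nn_integral_bounded_cmult b1 b2 b3 b4) auto
      have le: "(l0 j)\<^sup>2 \<le> (D j)\<^sup>2" "(l1 j)\<^sup>2 \<le> (D j)\<^sup>2" "(h0 j)\<^sup>2 \<le> (D j)\<^sup>2" "(h1 j)\<^sup>2 \<le> (D j)\<^sup>2"
        using nn0[of j] by (auto simp: D_def intro!: power_mono)
      have 1: "K' * (C1 * X * (l0 j)\<^sup>2) \<le> K' * C1 * X * (D j)\<^sup>2"
      proof -
        have "0 \<le> K' * C1 * X" by (rule mult_nonneg_nonneg[OF less_imp_le[OF Cp(1)] X])
        from mult_left_mono[OF le(1) this] show ?thesis by (simp only: mult.assoc)
      qed
      have "K' * T * (C2 * (1 + t) powr (2 * (e - k)) * (l1 j)\<^sup>2) = K' * C2 * (T * (1 + t) powr (2 * (e - k))) * (l1 j)\<^sup>2" by simp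
      also have "\<dots> \<le> K' * C2 * X * (D j)\<^sup>2" unfolding TX using Cp X le by (intro mult_left_mono) auto
      finally have 2: "K' * T * (C2 * (1 + t) powr (2 * (e - k)) * (l1 j)\<^sup>2) \<le> K' * C2 * X * (D j)\<^sup>2" .
      have 3: "K * E * (c * h\<^sup>2) \<le> K * C3 * c * X * (D j)\<^sup>2" if "h\<^sup>2 \<le> (D j)\<^sup>2" "0 < c" for h c
      proof -
        have "K * E * (c * h\<^sup>2) \<le> K * (C3 * X) * (c * (D j)\<^sup>2)"
          using K_pos E X C3(1) that by (intro mult_mono mult_left_mono) auto
        then show ?thesis by (simp only: mult_ac)
      qed
      have pos: "0 < (2 * pi) ^ 3" "0 < 2 * HY_const" using HY_const_pos by auto
      have "?B \<le> C * X * (D j)\<^sup>2"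
        using 1 2 3[OF le(3) pos(1)] 3[OF le(4) pos(2)] unfolding C_def distrib_right by linarith
      then show ?thesis
        by (rule nn_integral_bounded_mono[OF b, rotated -1]) (use b in \<open>auto simp: nn_integral_bounded_def\<close>)
    qed
    have "nn_integral_bounded (\<lambda>\<xi>. (cmod (U t \<xi> $ i))\<^sup>2) (C * X * (\<Sum>j\<in>UNIV. D j)\<^sup>2)"
    proof (rule nn_integral_bounded_mono[OF nn_integral_bounded_sum[OF finite bG, where I=UNIV]])
      show "(\<lambda>\<xi>. (cmod (U t \<xi> $ i))\<^sup>2) \<in> borel_measurable borel"
        using is_FT_measurable(1)[OF S(1)[OF t, of i]] by measurable
      show "AE \<xi> in lborel. (cmod (U t \<xi> $ i))\<^sup>2 \<le> (\<Sum>j\<in>UNIV. G j \<xi>)"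
        using solution_damped_system[OF sol]
      proof eventually_elim
        case (elim \<xi>)
        then have \<xi>: "\<xi> \<noteq> 0" by simp
        interpret d: damped_system "a\<^sup>2" "b\<^sup>2" "lame_symbol a b \<xi>" "norm \<xi> powr (2 * \<theta>)" "norm \<xi>" "\<lambda>t. U t \<xi>" "\<lambda>t. V t \<xi>"
          using elim by simp
        have "(cmod (U t \<xi> $ i))\<^sup>2 \<le> (norm (U t \<xi>))\<^sup>2"
          by (intro power_mono Finite_Cartesian_Product.norm_nth_le) auto
        also have "\<dots> \<le> (\<Sum>j\<in>UNIV. G j \<xi>)"
        proof (cases "norm \<xi> \<le> 1")
          case True
          define Q where "Q = exp (- \<kappa> * norm \<xi> powr \<beta> * t)"
          have "(norm (U t \<xi>))\<^sup>2 \<le> K' * Q * ((norm (U 0 \<xi>))\<^sup>2 + T * norm \<xi> powr (2 * \<alpha>) * (norm (V 0 \<xi>))\<^sup>2)"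
            using d.low_frequency_U[OF True refl k t] unfolding Q_def T_def \<alpha>_def \<beta>_def \<tau>_def .
          also have "\<dots> = (\<Sum>j\<in>UNIV. K' * Q * ((cmod (U 0 \<xi> $ j))\<^sup>2 + T * norm \<xi> powr (2 * \<alpha>) * (cmod (V 0 \<xi> $ j))\<^sup>2))"
            unfolding norm_vec_complex_sq by (simp add: sum.distrib sum_distrib_left[symmetric])
          also have "\<dots> = (\<Sum>j\<in>UNIV. K' * f1 j \<xi> + K' * T * f2 j \<xi>)"
            using True \<xi> by (intro sum.cong refl) (simp add: f1_def f2_def low_weight_def Q_def algebra_simps)
          also have "\<dots> \<le> (\<Sum>j\<in>UNIV. G j \<xi>)"
            unfolding G_def using add_nonneg_nonneg[OF nn(3,4)] by (intro sum_mono) (simp add: add.assoc)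
          finally show ?thesis .
        next
          case False
          then have r1: "1 \<le> norm \<xi>" by simp
          have "1 * (norm (U t \<xi>))\<^sup>2 \<le> (norm \<xi>)\<^sup>2 * (norm (U t \<xi>))\<^sup>2"
            using r1 by (intro mult_right_mono one_le_power) auto
          moreover have "(norm (V t \<xi>))\<^sup>2 + (norm \<xi>)\<^sup>2 * (norm (U t \<xi>))\<^sup>2 \<le> K * E * ((norm (V 0 \<xi>))\<^sup>2 + (norm \<xi>)\<^sup>2 * (norm (U 0 \<xi>))\<^sup>2)"
            using d.high_frequency_decay[OF r1 refl \<theta> t] unfolding E_def .
          moreover have "0 \<le> (norm (V t \<xi>))\<^sup>2" by simp
          ultimately have "(norm (U t \<xi>))\<^sup>2 \<le> K * E * ((norm (V 0 \<xi>))\<^sup>2 + (norm \<xi>)\<^sup>2 * (norm (U 0 \<xi>))\<^sup>2)" by linarith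
          also have "\<dots> = (\<Sum>j\<in>UNIV. K * E * ((cmod (V 0 \<xi> $ j))\<^sup>2 + (norm \<xi>)\<^sup>2 * (cmod (U 0 \<xi> $ j))\<^sup>2))"
            unfolding norm_vec_complex_sq by (simp add: sum.distrib sum_distrib_left[symmetric])
          also have "\<dots> = (\<Sum>j\<in>UNIV. K * E * f3 j \<xi> + K * E * f4 j \<xi>)"
            using \<xi> by (intro sum.cong refl) (simp add: f3_def f4_def algebra_simps)
          also have "\<dots> \<le> (\<Sum>j\<in>UNIV. G j \<xi>)"
            unfolding G_def using add_nonneg_nonneg[OF nn(1,2)] by (intro sum_mono) simp
          finally show ?thesis .
        qed
        finally show ?case .
      qed
      have "(\<Sum>j\<in>UNIV. C * X * (D j)\<^sup>2) = C * X * (\<Sum>j\<in>UNIV. (D j)\<^sup>2)" by (rule sum_distrib_left[symmetric])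
      also have "\<dots> \<le> C * X * (\<Sum>j\<in>UNIV. D j)\<^sup>2"
        using C X by (intro mult_left_mono sum_squares_le_square_sum D0) auto
      finally show "(\<Sum>j\<in>UNIV. C * X * (D j)\<^sup>2) \<le> C * X * (\<Sum>j\<in>UNIV. D j)\<^sup>2" .
    qed auto
    then show "nn_integral_bounded (\<lambda>\<xi>. (cmod (U t \<xi> $ i))\<^sup>2) (C * (1 + t) powr (2 * e) *
      (\<Sum>j\<in>UNIV. Hdot_norm 1 (\<lambda>\<xi>. U 0 \<xi> $ j) + Lp_norm m (\<lambda>x. u 0 x $ j)
        + Lp_norm 2 (\<lambda>x. v 0 x $ j) + Lp_norm m (\<lambda>x. v 0 x $ j))\<^sup>2)"
      unfolding X_def D_def h0_def h1_def l0_def l1_def .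
  qed
qed

section \<open>Estimates for the energy of order \<open>s\<close>\<close>

text \<open>Serves the fast part of the velocity, which decays like exp(-|\<xi>|^(2\<theta>) t). For
  \<theta> = 0 the dyadic argument has no scaling to exploit, but the factor is exp(-t): it beats
  every power of 1 + t, and the weight at time 0 supplies the integrability.\<close>

lemma low_frequency_estimate_velocity:
  assumes e: "\<theta> = 0 \<or> - (2 * s + (6 / m - 3)) / (2 * \<theta>) \<le> 2 * e"
  shows "\<exists>C. low_frequency_estimate m (low_weight s 1 (2 * \<theta>)) e C"
proof (cases "\<theta> = 0")
  case False
  then have "0 < 2 * \<theta>" "0 < 2 * s + (6 / m - 3)" using m_exponent_pos s \<theta> by auto
  then show ?thesis
    using low_frequency_estimate_exists[OF m(1) m_le_2 _ zero_less_one, of "2 * \<theta>" s e] e False by blast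
next
  case True
  have "- (2 * s + (6 / m - 3)) / 1 \<le> 2 * 0" "0 < 2 * s + (6 / m - 3)" using s m_exponent_pos by auto
  then obtain C where C: "low_frequency_estimate m (low_weight s 1 1) 0 C"
    using low_frequency_estimate_exists[OF m(1) m_le_2 zero_less_one zero_less_one] by blast
  obtain C' where C': "0 < C'" "\<And>t. 0 \<le> t \<Longrightarrow> exp (- 1 * t) \<le> C' * (1 + t) powr (2 * e)"
    using exp_decay_le_powr[OF zero_less_one, of "2 * e"] by blast
  note C0 = low_frequency_estimateD(1)[OF C]
  have "low_frequency_estimate m (low_weight s 1 (2 * \<theta>)) e (C' * C)"
    unfolding low_frequency_estimate_def
  proof (intro conjI allI impI)
    show "0 < C' * C" using C0 C' by simp
    fix f F and t :: real assume FT: "is_FT f F" and f: "memLp m f" and t: "0 \<le> t"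
    have [measurable]: "F \<in> borel_measurable borel" by (rule is_FT_measurable[OF FT])
    note b = low_frequency_estimateD(2)[OF C FT f order_refl]
    show "nn_integral_bounded (\<lambda>\<xi>. low_weight s 1 (2 * \<theta>) t \<xi> * (cmod (F \<xi>))\<^sup>2) (C' * C * (1 + t) powr (2 * e) * (Lp_norm m f)\<^sup>2)"
    proof (rule nn_integral_bounded_mono[OF nn_integral_bounded_cmult[OF b, of "exp (- 1 * t)"]])
      show "AE \<xi> in lborel. low_weight s 1 (2 * \<theta>) t \<xi> * (cmod (F \<xi>))\<^sup>2 \<le> exp (- 1 * t) * (low_weight s 1 1 0 \<xi> * (cmod (F \<xi>))\<^sup>2)"
        using True by (intro AE_I2) (auto simp: low_weight_def)
      have "exp (- 1 * t) * (C * (Lp_norm m f)\<^sup>2) \<le> C' * (1 + t) powr (2 * e) * (C * (Lp_norm m f)\<^sup>2)"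
        using C0 by (intro mult_right_mono C'(2)[OF t]) auto
      then show "exp (- 1 * t) * (C * (1 + 0) powr (2 * 0) * (Lp_norm m f)\<^sup>2) \<le> C' * C * (1 + t) powr (2 * e) * (Lp_norm m f)\<^sup>2"
        by (simp add: mult_ac)
    qed auto
  qed
  then show ?thesis ..
qed

definition energy_density :: "(real \<Rightarrow> real^3 \<Rightarrow> complex^3) \<Rightarrow> (real \<Rightarrow> real^3 \<Rightarrow> complex^3) \<Rightarrow> real \<Rightarrow> real^3 \<Rightarrow> real" where
  "energy_density U V t \<xi> = norm \<xi> powr (2 * s) * ((norm (V t \<xi>))\<^sup>2 + (norm \<xi>)\<^sup>2 * (norm (U t \<xi>))\<^sup>2)"

text \<open>\<open>e1\<close> is the requirement for \<theta> >= 1/2; for \<theta> < 1/2,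
  \<open>e2\<close> is that of the slow part with its gain of order 1 - 2\<theta>, and
  \<open>e3\<close> that of the fast part. The existential majorants \<open>g\<close> hide the
  regime from the later summation over components.\<close>

lemma low_frequency_energy_bounded:
  fixes e :: real
  assumes e1: "1 / 2 \<le> \<theta> \<Longrightarrow> - (2 * s + (6 / m - 3)) / (2 * \<theta>) \<le> 2 * e"
    and e2: "\<theta> < 1 / 2 \<Longrightarrow> - (2 * (s + (1 - 2 * \<theta>)) + (6 / m - 3)) / (2 - 2 * \<theta>) \<le> 2 * e"
    and e3: "\<theta> < 1 / 2 \<Longrightarrow> \<theta> = 0 \<or> - (2 * s + (6 / m - 3)) / (2 * \<theta>) \<le> 2 * e"
  shows "\<exists>C>0. \<forall>u v U V t. solution u v U V \<longrightarrow> 0 \<le> t \<longrightarrow> (\<exists>g.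
    (\<forall>j. nn_integral_bounded (g j) (C * (1 + t) powr (2 * e) * ((Lp_norm m (\<lambda>x. u 0 x $ j))\<^sup>2 + (Lp_norm m (\<lambda>x. v 0 x $ j))\<^sup>2))) \<and>
    (AE \<xi> in lborel. norm \<xi> \<le> 1 \<longrightarrow> energy_density U V t \<xi> \<le> (\<Sum>j\<in>UNIV. g j \<xi>)))"
proof (cases "1 / 2 \<le> \<theta>")
  case True
  have "0 < 2 * \<theta>" "0 < 2 * s + (6 / m - 3)" using True s m_exponent_pos by auto
  then obtain C where C: "low_frequency_estimate m (low_weight s \<kappa> (2 * \<theta>)) e C"
    using low_frequency_estimate_exists[OF m(1) m_le_2 _ \<kappa>(1) _ e1[OF True]] by blast
  show ?thesis
  proof (intro exI[of _ "K * C"] conjI allI impI)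
    show "0 < K * C" using K_pos low_frequency_estimateD(1)[OF C] by simp
    fix u v :: "real \<Rightarrow> real^3 \<Rightarrow> real^3" and U V :: "real \<Rightarrow> real^3 \<Rightarrow> complex^3" and t :: real
    assume sol: "solution u v U V" and t: "0 \<le> t"
    note S = solutionD[OF sol]
    define w where "w = low_weight s \<kappa> (2 * \<theta>) t"
    define g where "g = (\<lambda>j \<xi>. K * (w \<xi> * (cmod (U 0 \<xi> $ j))\<^sup>2) + K * (w \<xi> * (cmod (V 0 \<xi> $ j))\<^sup>2))"
    have "nn_integral_bounded (g j) (K * C * (1 + t) powr (2 * e) * ((Lp_norm m (\<lambda>x. u 0 x $ j))\<^sup>2 + (Lp_norm m (\<lambda>x. v 0 x $ j))\<^sup>2))" for j
    proof -
      have "nn_integral_bounded (g j) (K * (C * (1 + t) powr (2 * e) * (Lp_norm m (\<lambda>x. u 0 x $ j))\<^sup>2) + K * (C * (1 + t) powr (2 * e) * (Lp_norm m (\<lambda>x. v 0 x $ j))\<^sup>2))"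
        unfolding g_def w_def using K_pos
        by (intro nn_integral_bounded_add nn_integral_bounded_cmult low_frequency_estimateD(2)[OF C] S order_refl t) auto
      then show ?thesis by (simp only: distrib_left mult.assoc)
    qed
    moreover have "AE \<xi> in lborel. norm \<xi> \<le> 1 \<longrightarrow> energy_density U V t \<xi> \<le> (\<Sum>j\<in>UNIV. g j \<xi>)"
      using solution_damped_system[OF sol]
    proof eventually_elim
      case (elim \<xi>)
      interpret d: damped_system "a\<^sup>2" "b\<^sup>2" "lame_symbol a b \<xi>" "norm \<xi> powr (2 * \<theta>)" "norm \<xi>" "\<lambda>t. U t \<xi>" "\<lambda>t. V t \<xi>"
        using elim by simp
      show ?case
      proof
        assume le: "norm \<xi> \<le> 1"
        have "energy_density U V t \<xi> \<le> norm \<xi> powr (2 * s) * (K * exp (- \<kappa> * norm \<xi> powr (2 * \<theta>) * t) * ((norm (U 0 \<xi>))\<^sup>2 + (norm (V 0 \<xi>))\<^sup>2))"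
          unfolding energy_density_def by (intro mult_left_mono d.low_frequency_energy_underdamped[OF le refl True t]) auto
        also have "\<dots> = K * w \<xi> * ((norm (U 0 \<xi>))\<^sup>2 + (norm (V 0 \<xi>))\<^sup>2)"
          using le by (simp add: w_def low_weight_def mult_ac)
        also have "\<dots> = (\<Sum>j\<in>UNIV. g j \<xi>)"
          unfolding norm_vec_complex_sq g_def by (simp add: sum.distrib sum_distrib_left distrib_left mult.assoc)
        finally show "energy_density U V t \<xi> \<le> (\<Sum>j\<in>UNIV. g j \<xi>)" .
      qed
    qed
    ultimately show "\<exists>g. (\<forall>j. nn_integral_bounded (g j) (K * C * (1 + t) powr (2 * e) * ((Lp_norm m (\<lambda>x. u 0 x $ j))\<^sup>2 + (Lp_norm m (\<lambda>x. v 0 x $ j))\<^sup>2))) \<and>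
        (AE \<xi> in lborel. norm \<xi> \<le> 1 \<longrightarrow> energy_density U V t \<xi> \<le> (\<Sum>j\<in>UNIV. g j \<xi>))" by blast
  qed
next
  case False
  then have \<theta>h: "\<theta> < 1 / 2" by simp
  define \<alpha> where "\<alpha> = s + (1 - 2 * \<theta>)"
  have "0 < 2 - 2 * \<theta>" "0 < 2 * \<alpha> + (6 / m - 3)" using \<theta>h s m_exponent_pos by (auto simp: \<alpha>_def)
  moreover have "- (2 * \<alpha> + (6 / m - 3)) / (2 - 2 * \<theta>) \<le> 2 * e" unfolding \<alpha>_def by (rule e2[OF \<theta>h])
  ultimately obtain C where C: "low_frequency_estimate m (low_weight \<alpha> \<kappa> (2 - 2 * \<theta>)) e C"
    using low_frequency_estimate_exists[OF m(1) m_le_2 _ \<kappa>(1)] by blast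
  obtain C' where C': "low_frequency_estimate m (low_weight s 1 (2 * \<theta>)) e C'"
    using low_frequency_estimate_velocity[OF e3[OF \<theta>h]] by blast
  define c where "c = (16 * (b\<^sup>2)\<^sup>2 + 1) * K"
  have c: "0 < c" unfolding c_def using K_pos by (intro mult_pos_pos add_nonneg_pos) auto
  note C0 = low_frequency_estimateD(1)[OF C] low_frequency_estimateD(1)[OF C']
  show ?thesis
  proof (intro exI[of _ "c * C + 2 * C'"] conjI allI impI)
    show "0 < c * C + 2 * C'" using c C0 by (intro add_pos_pos mult_pos_pos) auto
    fix u v :: "real \<Rightarrow> real^3 \<Rightarrow> real^3" and U V :: "real \<Rightarrow> real^3 \<Rightarrow> complex^3" and t :: real
    assume sol: "solution u v U V" and t: "0 \<le> t"
    note S = solutionD[OF sol]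
    define w z where "w = low_weight \<alpha> \<kappa> (2 - 2 * \<theta>) t" and "z = low_weight s 1 (2 * \<theta>) t"
    define g where "g = (\<lambda>j \<xi>. c * (w \<xi> * (cmod (U 0 \<xi> $ j))\<^sup>2) + c * (w \<xi> * (cmod (V 0 \<xi> $ j))\<^sup>2) + 2 * (z \<xi> * (cmod (V 0 \<xi> $ j))\<^sup>2))"
    have "nn_integral_bounded (g j) ((c * C + 2 * C') * (1 + t) powr (2 * e) * ((Lp_norm m (\<lambda>x. u 0 x $ j))\<^sup>2 + (Lp_norm m (\<lambda>x. v 0 x $ j))\<^sup>2))" for j
    proof -
      let ?u = "(Lp_norm m (\<lambda>x. u 0 x $ j))\<^sup>2" and ?v = "(Lp_norm m (\<lambda>x. v 0 x $ j))\<^sup>2" and ?X = "(1 + t) powr (2 * e)"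
      have b: "nn_integral_bounded (g j) (c * (C * ?X * ?u) + c * (C * ?X * ?v) + 2 * (C' * ?X * ?v))"
        unfolding g_def w_def z_def using c
        by (intro nn_integral_bounded_add nn_integral_bounded_cmult low_frequency_estimateD(2)[OF C] low_frequency_estimateD(2)[OF C'] S order_refl t) auto
      show "nn_integral_bounded (g j) ((c * C + 2 * C') * ?X * (?u + ?v))"
      proof (rule nn_integral_bounded_mono[OF b])
        have "0 \<le> 2 * (C' * ?X * ?u)" using C0 by simp
        moreover have "(c * C + 2 * C') * ?X * (?u + ?v) = (c * (C * ?X * ?u) + c * (C * ?X * ?v) + 2 * (C' * ?X * ?v)) + 2 * (C' * ?X * ?u)"
          by (simp add: algebra_simps)
        ultimately show "c * (C * ?X * ?u) + c * (C * ?X * ?v) + 2 * (C' * ?X * ?v) \<le> (c * C + 2 * C') * ?X * (?u + ?v)" by linarith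
      qed (use b in \<open>simp_all add: nn_integral_bounded_def\<close>)
    qed
    moreover have "AE \<xi> in lborel. norm \<xi> \<le> 1 \<longrightarrow> energy_density U V t \<xi> \<le> (\<Sum>j\<in>UNIV. g j \<xi>)"
      using solution_damped_system[OF sol]
    proof eventually_elim
      case (elim \<xi>)
      interpret d: damped_system "a\<^sup>2" "b\<^sup>2" "lame_symbol a b \<xi>" "norm \<xi> powr (2 * \<theta>)" "norm \<xi>" "\<lambda>t. U t \<xi>" "\<lambda>t. V t \<xi>"
        using elim by simp
      show ?case
      proof
        assume le: "norm \<xi> \<le> 1"
        have pw: "norm \<xi> powr (2 * s) * norm \<xi> powr (2 * (1 - 2 * \<theta>)) = norm \<xi> powr (2 * \<alpha>)"
          unfolding powr_add[symmetric] \<alpha>_def by (simp add: algebra_simps)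
        have "energy_density U V t \<xi> \<le>
          norm \<xi> powr (2 * s) * (c * (norm \<xi> powr (2 * (1 - 2 * \<theta>)) * exp (- \<kappa> * norm \<xi> powr (2 - 2 * \<theta>) * t)) * ((norm (U 0 \<xi>))\<^sup>2 + (norm (V 0 \<xi>))\<^sup>2)
            + 2 * exp (- 1 * norm \<xi> powr (2 * \<theta>) * t) * (norm (V 0 \<xi>))\<^sup>2)"
          unfolding c_def energy_density_def by (intro mult_left_mono d.low_frequency_energy_overdamped[OF le refl \<theta>(1) \<theta>h t]) auto
        also have "\<dots> = c * ((norm \<xi> powr (2 * s) * norm \<xi> powr (2 * (1 - 2 * \<theta>))) * exp (- \<kappa> * norm \<xi> powr (2 - 2 * \<theta>) * t)) * ((norm (U 0 \<xi>))\<^sup>2 + (norm (V 0 \<xi>))\<^sup>2)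
            + 2 * (norm \<xi> powr (2 * s) * exp (- 1 * norm \<xi> powr (2 * \<theta>) * t)) * (norm (V 0 \<xi>))\<^sup>2"
          unfolding distrib_left[of "norm \<xi> powr (2 * s)"] by (simp only: mult_ac)
        also have "\<dots> = c * w \<xi> * ((norm (U 0 \<xi>))\<^sup>2 + (norm (V 0 \<xi>))\<^sup>2) + 2 * z \<xi> * (norm (V 0 \<xi>))\<^sup>2"
          unfolding pw w_def z_def low_weight_def using le by simp
        also have "\<dots> = (\<Sum>j\<in>UNIV. g j \<xi>)"
          unfolding norm_vec_complex_sq g_def by (simp add: sum.distrib sum_distrib_left distrib_left mult.assoc)
        finally show "energy_density U V t \<xi> \<le> (\<Sum>j\<in>UNIV. g j \<xi>)" .
      qed
    qed
    ultimately show "\<exists>g. (\<forall>j. nn_integral_bounded (g j) ((c * C + 2 * C') * (1 + t) powr (2 * e) * ((Lp_norm m (\<lambda>x. u 0 x $ j))\<^sup>2 + (Lp_norm m (\<lambda>x. v 0 x $ j))\<^sup>2))) \<and>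
        (AE \<xi> in lborel. norm \<xi> \<le> 1 \<longrightarrow> energy_density U V t \<xi> \<le> (\<Sum>j\<in>UNIV. g j \<xi>))" by blast
  qed
qed

lemma energy_bound:
  fixes e :: real
  assumes e1: "1 / 2 \<le> \<theta> \<Longrightarrow> - (2 * s + (6 / m - 3)) / (2 * \<theta>) \<le> 2 * e"
    and e2: "\<theta> < 1 / 2 \<Longrightarrow> - (2 * (s + (1 - 2 * \<theta>)) + (6 / m - 3)) / (2 - 2 * \<theta>) \<le> 2 * e"
    and e3: "\<theta> < 1 / 2 \<Longrightarrow> \<theta> = 0 \<or> - (2 * s + (6 / m - 3)) / (2 * \<theta>) \<le> 2 * e"
  shows "\<exists>C>0. \<forall>u v U V t k. solution u v U V \<longrightarrow> 0 \<le> t \<longrightarrow>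
    nn_integral_bounded (\<lambda>\<xi>. norm \<xi> powr (2 * (s + 1)) * (cmod (U t \<xi> $ k))\<^sup>2 + norm \<xi> powr (2 * s) * (cmod (V t \<xi> $ k))\<^sup>2)
      (C * (1 + t) powr (2 * e) * (\<Sum>j\<in>UNIV. Hdot_norm (s + 1) (\<lambda>\<xi>. U 0 \<xi> $ j) + Lp_norm m (\<lambda>x. u 0 x $ j)
        + Hdot_norm s (\<lambda>\<xi>. V 0 \<xi> $ j) + Lp_norm m (\<lambda>x. v 0 x $ j))\<^sup>2)"
proof -
  obtain C1 where C1: "0 < C1" "\<forall>u v U V t. solution u v U V \<longrightarrow> 0 \<le> t \<longrightarrow> (\<exists>g.
    (\<forall>j. nn_integral_bounded (g j) (C1 * (1 + t) powr (2 * e) * ((Lp_norm m (\<lambda>x. u 0 x $ j))\<^sup>2 + (Lp_norm m (\<lambda>x. v 0 x $ j))\<^sup>2))) \<and>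
    (AE \<xi> in lborel. norm \<xi> \<le> 1 \<longrightarrow> energy_density U V t \<xi> \<le> (\<Sum>j\<in>UNIV. g j \<xi>)))"
    using low_frequency_energy_bounded[OF e1 e2 e3] by blast
  obtain C3 where C3: "0 < C3" "\<And>t. 0 \<le> t \<Longrightarrow> exp (- \<kappa> * t) \<le> C3 * (1 + t) powr (2 * e)"
    using exp_decay_le_powr[OF \<kappa>(1), of "2 * e"] by blast
  define C2 where "C2 = K * C3 * (2 * pi) ^ 3"
  have C2: "0 < C2" unfolding C2_def using K_pos C3(1) by (intro mult_pos_pos) auto
  \<comment> \<open>Both L^m norms of a component are bounded by its total \<open>D\<close>, giving
    2 C1; the displacement and the velocity datum each contribute C2 at high frequencies.\<close>
  define C where "C = 2 * C1 + 2 * C2"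
  show ?thesis
  proof (intro exI[of _ C] conjI allI impI)
    show C: "0 < C" unfolding C_def using C1(1) C2 by simp
    fix u v :: "real \<Rightarrow> real^3 \<Rightarrow> real^3" and U V :: "real \<Rightarrow> real^3 \<Rightarrow> complex^3" and t :: real and i :: 3
    assume sol: "solution u v U V" and t: "0 \<le> t"
    note S = solutionD[OF sol]
    define X E where "X = (1 + t) powr (2 * e)" and "E = exp (- \<kappa> * t)"
    have X: "0 \<le> X" and E: "0 \<le> E" "E \<le> C3 * X" using C3(2)[OF t] by (simp_all add: E_def X_def)
    define h0 h1 l0 l1 where "h0 = (\<lambda>j. Hdot_norm (s + 1) (\<lambda>\<xi>. U 0 \<xi> $ j))" and "h1 = (\<lambda>j. Hdot_norm s (\<lambda>\<xi>. V 0 \<xi> $ j))"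
      and "l0 = (\<lambda>j. Lp_norm m (\<lambda>x. u 0 x $ j))" and "l1 = (\<lambda>j. Lp_norm m (\<lambda>x. v 0 x $ j))"
    have nn0: "0 \<le> h0 j" "0 \<le> h1 j" "0 \<le> l0 j" "0 \<le> l1 j" for j
      by (auto simp: h0_def h1_def l0_def l1_def Lp_norm_nonneg Hdot_norm_nonneg)
    define D where "D = (\<lambda>j. h0 j + l0 j + h1 j + l1 j)"
    have D0: "0 \<le> D j" for j using nn0[of j] by (simp add: D_def)
    obtain g where g: "\<And>j. nn_integral_bounded (g j) (C1 * X * ((l0 j)\<^sup>2 + (l1 j)\<^sup>2))"
      and gle: "AE \<xi> in lborel. norm \<xi> \<le> 1 \<longrightarrow> energy_density U V t \<xi> \<le> (\<Sum>j\<in>UNIV. g j \<xi>)"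
      using C1(2)[rule_format, OF sol t] unfolding X_def l0_def l1_def by blast
    have g0: "0 \<le> g j \<xi>" for j \<xi> using g[of j] by (simp add: nn_integral_bounded_def)
    define f3 f4 where "f3 = (\<lambda>j (\<xi>::real^3). norm \<xi> powr (2 * (s + 1)) * (cmod (U 0 \<xi> $ j))\<^sup>2)"
      and "f4 = (\<lambda>j (\<xi>::real^3). norm \<xi> powr (2 * s) * (cmod (V 0 \<xi> $ j))\<^sup>2)"
    define G where "G = (\<lambda>j \<xi>. g j \<xi> + K * E * f3 j \<xi> + K * E * f4 j \<xi>)"
    have nn: "0 \<le> K * E * f3 j \<xi>" "0 \<le> K * E * f4 j \<xi>" for j \<xi> using K_pos E by (auto simp: f3_def f4_def)
    have bG: "nn_integral_bounded (G j) (C * X * (D j)\<^sup>2)" for j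
    proof -
      let ?B = "C1 * X * ((l0 j)\<^sup>2 + (l1 j)\<^sup>2) + K * E * ((2 * pi) ^ 3 * (h0 j)\<^sup>2) + K * E * ((2 * pi) ^ 3 * (h1 j)\<^sup>2)"
      have b: "nn_integral_bounded (G j) ?B"
        unfolding G_def f3_def f4_def h0_def h1_def using K_pos E
        by (intro nn_integral_bounded_add nn_integral_bounded_cmult g memHdot_bounded S) auto
      have le: "(h0 j)\<^sup>2 \<le> (D j)\<^sup>2" "(h1 j)\<^sup>2 \<le> (D j)\<^sup>2" "(l0 j)\<^sup>2 \<le> (D j)\<^sup>2" "(l1 j)\<^sup>2 \<le> (D j)\<^sup>2"
        using nn0[of j] by (auto simp: D_def intro!: power_mono)
      have "C1 * X * ((l0 j)\<^sup>2 + (l1 j)\<^sup>2) \<le> C1 * X * ((D j)\<^sup>2 + (D j)\<^sup>2)"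
        using C1(1) X le by (intro mult_left_mono add_mono) auto
      then have 1: "C1 * X * ((l0 j)\<^sup>2 + (l1 j)\<^sup>2) \<le> 2 * C1 * X * (D j)\<^sup>2" by (simp add: algebra_simps)
      have 2: "K * E * ((2 * pi) ^ 3 * h\<^sup>2) \<le> C2 * X * (D j)\<^sup>2" if "h\<^sup>2 \<le> (D j)\<^sup>2" for h
      proof -
        have "K * E * ((2 * pi) ^ 3 * h\<^sup>2) \<le> K * (C3 * X) * ((2 * pi) ^ 3 * (D j)\<^sup>2)"
          using K_pos E X C3(1) that by (intro mult_mono mult_left_mono) auto
        then show ?thesis unfolding C2_def by (simp only: mult_ac)
      qed
      have "C * X * (D j)\<^sup>2 = 2 * C1 * X * (D j)\<^sup>2 + C2 * X * (D j)\<^sup>2 + C2 * X * (D j)\<^sup>2"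
        by (simp add: C_def algebra_simps)
      then have "?B \<le> C * X * (D j)\<^sup>2" using 1 2[OF le(1)] 2[OF le(2)] by linarith
      then show ?thesis
        by (rule nn_integral_bounded_mono[OF b, rotated -1]) (use b in \<open>auto simp: nn_integral_bounded_def\<close>)
    qed
    have "nn_integral_bounded (\<lambda>\<xi>. norm \<xi> powr (2 * (s + 1)) * (cmod (U t \<xi> $ i))\<^sup>2 + norm \<xi> powr (2 * s) * (cmod (V t \<xi> $ i))\<^sup>2) (C * X * (\<Sum>j\<in>UNIV. D j)\<^sup>2)"
    proof (rule nn_integral_bounded_mono[OF nn_integral_bounded_sum[OF finite bG, where I=UNIV]])
      show "(\<lambda>\<xi>. norm \<xi> powr (2 * (s + 1)) * (cmod (U t \<xi> $ i))\<^sup>2 + norm \<xi> powr (2 * s) * (cmod (V t \<xi> $ i))\<^sup>2) \<in> borel_measurable borel"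
        using is_FT_measurable(1)[OF S(1)[OF t, of i]] is_FT_measurable(1)[OF S(2)[OF t, of i]] by measurable
      show "AE \<xi> in lborel. norm \<xi> powr (2 * (s + 1)) * (cmod (U t \<xi> $ i))\<^sup>2 + norm \<xi> powr (2 * s) * (cmod (V t \<xi> $ i))\<^sup>2 \<le> (\<Sum>j\<in>UNIV. G j \<xi>)"
        using solution_damped_system[OF sol] gle
      proof eventually_elim
        case (elim \<xi>)
        then have \<xi>: "\<xi> \<noteq> 0" by simp
        interpret d: damped_system "a\<^sup>2" "b\<^sup>2" "lame_symbol a b \<xi>" "norm \<xi> powr (2 * \<theta>)" "norm \<xi>" "\<lambda>t. U t \<xi>" "\<lambda>t. V t \<xi>"
          using elim by simp
        have pw: "norm \<xi> powr (2 * (s + 1)) = norm \<xi> powr (2 * s) * (norm \<xi>)\<^sup>2"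
          using \<xi> by (simp add: powr_add distrib_left)
        have "(cmod (U t \<xi> $ i))\<^sup>2 \<le> (norm (U t \<xi>))\<^sup>2" "(cmod (V t \<xi> $ i))\<^sup>2 \<le> (norm (V t \<xi>))\<^sup>2"
          by (auto intro!: power_mono Finite_Cartesian_Product.norm_nth_le)
        then have "norm \<xi> powr (2 * s) * ((cmod (V t \<xi> $ i))\<^sup>2 + (norm \<xi>)\<^sup>2 * (cmod (U t \<xi> $ i))\<^sup>2) \<le> energy_density U V t \<xi>"
          unfolding energy_density_def by (intro mult_left_mono add_mono) auto
        then have "norm \<xi> powr (2 * (s + 1)) * (cmod (U t \<xi> $ i))\<^sup>2 + norm \<xi> powr (2 * s) * (cmod (V t \<xi> $ i))\<^sup>2 \<le> energy_density U V t \<xi>"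
          unfolding pw by (simp add: algebra_simps)
        also have "\<dots> \<le> (\<Sum>j\<in>UNIV. G j \<xi>)"
        proof (cases "norm \<xi> \<le> 1")
          case True
          then have "energy_density U V t \<xi> \<le> (\<Sum>j\<in>UNIV. g j \<xi>)" using elim by blast
          also have "\<dots> \<le> (\<Sum>j\<in>UNIV. G j \<xi>)"
            unfolding G_def using add_nonneg_nonneg[OF nn] by (intro sum_mono) (simp add: add.assoc)
          finally show ?thesis .
        next
          case False
          then have r1: "1 \<le> norm \<xi>" by simp
          have "energy_density U V t \<xi> \<le> norm \<xi> powr (2 * s) * (K * E * ((norm (V 0 \<xi>))\<^sup>2 + (norm \<xi>)\<^sup>2 * (norm (U 0 \<xi>))\<^sup>2))"
            unfolding E_def energy_density_def by (intro mult_left_mono d.high_frequency_decay[OF r1 refl \<theta> t]) auto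
          also have "\<dots> = (\<Sum>j\<in>UNIV. K * E * f3 j \<xi> + K * E * f4 j \<xi>)"
            unfolding norm_vec_complex_sq f3_def f4_def pw by (simp add: sum.distrib sum_distrib_left algebra_simps)
          also have "\<dots> \<le> (\<Sum>j\<in>UNIV. G j \<xi>)"
            unfolding G_def using g0 by (intro sum_mono) simp
          finally show ?thesis .
        qed
        finally show ?case .
      qed
      have "(\<Sum>j\<in>UNIV. C * X * (D j)\<^sup>2) = C * X * (\<Sum>j\<in>UNIV. (D j)\<^sup>2)" by (rule sum_distrib_left[symmetric])
      also have "\<dots> \<le> C * X * (\<Sum>j\<in>UNIV. D j)\<^sup>2"
        using C X by (intro mult_left_mono sum_squares_le_square_sum D0) auto
      finally show "(\<Sum>j\<in>UNIV. C * X * (D j)\<^sup>2) \<le> C * X * (\<Sum>j\<in>UNIV. D j)\<^sup>2" .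
    qed auto
    then show "nn_integral_bounded (\<lambda>\<xi>. norm \<xi> powr (2 * (s + 1)) * (cmod (U t \<xi> $ i))\<^sup>2 + norm \<xi> powr (2 * s) * (cmod (V t \<xi> $ i))\<^sup>2)
      (C * (1 + t) powr (2 * e) * (\<Sum>j\<in>UNIV. Hdot_norm (s + 1) (\<lambda>\<xi>. U 0 \<xi> $ j) + Lp_norm m (\<lambda>x. u 0 x $ j)
        + Hdot_norm s (\<lambda>\<xi>. V 0 \<xi> $ j) + Lp_norm m (\<lambda>x. v 0 x $ j))\<^sup>2)"
      unfolding X_def D_def h0_def h1_def l0_def l1_def .
  qed
qed

end

section \<open>Arithmetic of the decay exponents\<close>

text \<open>Cancelling \<open>m\<close> exposes 6/m - 3, the exponent in the bound on balls, inside
  the quotients that define the decay functions.\<close>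

lemma exponent_ratio:
  fixes m x c :: real
  assumes "0 < m"
  shows "(6 - 3 * m + 2 * \<sigma> * m + 2 * m * c) / (4 * m * x) = (6 / m - 3 + 2 * \<sigma> + 2 * c) / (4 * x)"
proof -
  have "6 - 3 * m + 2 * \<sigma> * m + 2 * m * c = m * (6 / m - 3 + 2 * \<sigma> + 2 * c)"
    using assms by (simp add: algebra_simps)
  moreover have "4 * m * x = m * (4 * x)" by simp
  ultimately show ?thesis using assms by (simp only: mult_divide_mult_cancel_left_if) simp
qed

lemma rho_ok_iff:
  assumes "0 < m"
  shows "rho_ok \<theta> m \<sigma> \<rho> \<longleftrightarrow> \<rho> < (6 / m - 3 + 2 * \<sigma> + 2 * (1 - 2 * \<theta>)) / (4 * (1 - \<theta>)) \<and>
    (\<theta> = 0 \<or> \<rho> < (6 / m - 3 + 2 * \<sigma>) / (4 * \<theta>))"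
  using exponent_ratio[OF assms, of \<sigma> "1 - 2 * \<theta>" "1 - \<theta>"] exponent_ratio[OF assms, of \<sigma> 0 \<theta>]
  by (simp add: rho_ok_def)

text \<open>The weight of the velocity datum is bounded both by \<open>1 + t\<close> and by \<open>|\<xi>| ^ (- min 1 (2 \<theta>))\<close>.
  The exponent \<open>k\<close> of the interpolation between the two has to keep the weight square integrable
  near the origin; the strict inequalities for the constants \<open>\<rho>\<close> leave room for this.\<close>
lemma displacement_exponent:
  fixes \<theta> m \<rho>0 \<rho>1 :: real
  defines "e \<equiv> (if \<theta> < 1/2 then (if m < 6/5 then - \<rho>0 else 1 - \<rho>1)
      else (if m < 6/5 then - ((6 - 5*m) / (4*m*\<theta>)) else 1 - (6 - 3*m) / (4*m*\<theta>)))"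
  assumes \<theta>: "0 \<le> \<theta>" "\<theta> \<le> 1" and m: "1 \<le> m" "m < 2"
    and \<rho>0: "\<theta> < 1/2 \<Longrightarrow> rho_ok \<theta> m (-1) \<rho>0" and \<rho>1: "\<theta> < 1/2 \<Longrightarrow> rho_ok \<theta> m 0 \<rho>1"
  obtains k where "0 \<le> k" "k \<le> 1" "2 * (min 1 (2 * \<theta>) * (1 - k)) < 6 / m - 3"
    "2 * k - (6 / m - 3 - 2 * (min 1 (2 * \<theta>) * (1 - k))) / max (2 * \<theta>) (2 - 2 * \<theta>) \<le> 2 * e"
proof -
  define q where "q = 6 / m - 3"
  have m0: "0 < m" using m by simp
  have q: "0 < q" using m by (simp add: q_def field_simps)
  have m65: "m < 6/5 \<longleftrightarrow> 2 < q" using m by (simp add: q_def field_simps)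
  show thesis
  proof (cases "\<theta> < 1/2")
    case False
    then have mm: "min 1 (2 * \<theta>) = 1" "max (2 * \<theta>) (2 - 2 * \<theta>) = 2 * \<theta>" and \<theta>0: "0 < \<theta>" by auto
    have r1: "(6 - 5*m) / (4*m*\<theta>) = (q - 2) / (4 * \<theta>)" and r2: "(6 - 3*m) / (4*m*\<theta>) = q / (4 * \<theta>)"
      using exponent_ratio[OF m0, of "- 1" 0 \<theta>] exponent_ratio[OF m0, of 0 0 \<theta>] by (simp_all add: q_def)
    show thesis
    proof (cases "m < 6/5")
      \<comment> \<open>Here q > 2, so the full weight |\<xi>|^-2 is summable and no factor 1 + t
        has to be spent: k = 0.\<close>
      case True
      then show thesis
        using that[of 0] m65 False r1 \<theta>0 unfolding mm e_def q_def[symmetric] by (simp add: field_simps)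
    next
      \<comment> \<open>Here q <= 2 and the weight |\<xi>|^-2 is too singular for this method, so
        the velocity datum is bounded through 1 + t alone: k = 1.\<close>
      case nm: False
      then show thesis
        using that[of 1] q False r2 \<theta>0 unfolding mm e_def q_def[symmetric] by (simp add: field_simps)
    qed
  next
    case True
    then have mm: "min 1 (2 * \<theta>) = 2 * \<theta>" "max (2 * \<theta>) (2 - 2 * \<theta>) = 2 - 2 * \<theta>" by auto
    have p: "0 < 2 - 2 * \<theta>" using True by simp
    have R0: "\<rho>0 * (4 * (1 - \<theta>)) < q - 2 + 2 * (1 - 2 * \<theta>)"
      using \<rho>0[OF True] p unfolding rho_ok_iff[OF m0] q_def[symmetric] by (simp add: pos_less_divide_eq)
    have R1: "\<rho>1 * (4 * (1 - \<theta>)) < q + 2 * (1 - 2 * \<theta>)"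
      using \<rho>1[OF True] p unfolding rho_ok_iff[OF m0] q_def[symmetric] by (simp add: pos_less_divide_eq)
    \<comment> \<open>The admissibility condition for k = 0, with a general target exponent;
      \<open>R0\<close> matches it exactly for \<open>x = - \<rho>0\<close>.\<close>
    have zero: "2 * 0 - (q - 2 * (2 * \<theta> * (1 - 0))) / (2 - 2 * \<theta>) \<le> 2 * x"
      if "- x * (4 * (1 - \<theta>)) \<le> q - 4 * \<theta>" for x
    proof -
      have "- (2 * x) * (2 - 2 * \<theta>) \<le> q - 4 * \<theta>" using that by (simp add: algebra_simps)
      then have "- (2 * x) \<le> (q - 4 * \<theta>) / (2 - 2 * \<theta>)" using p by (simp only: pos_le_divide_eq)
      then show ?thesis by simp
    qed
    show thesis
    proof (cases "m < 6/5")
      case m6: True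
      then have e: "e = - \<rho>0" using True by (simp add: e_def)
      show thesis
      proof (rule that[of 0], unfold mm q_def[symmetric])
        show "2 * (2 * \<theta> * (1 - 0)) < q" using m6 m65 True by simp
        show "2 * 0 - (q - 2 * (2 * \<theta> * (1 - 0))) / (2 - 2 * \<theta>) \<le> 2 * e"
          unfolding e using R0 by (intro zero) (simp add: algebra_simps)
      qed auto
    next
      case m6: False
      then have e: "e = 1 - \<rho>1" using True by (simp add: e_def)
      have q2: "q \<le> 2" using m6 m65 by simp
      show thesis
      \<comment> \<open>Decides whether the weight |\<xi>|^(-4\<theta>) of k = 0 is summable. If so,
        the first quotient bounding \<open>\<rho>1\<close> suffices; if not, the second one comes
        into play.\<close>
      proof (cases "4 * \<theta> < q")
        case big: True
        show thesis
        proof (rule that[of 0], unfold mm q_def[symmetric])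
          show "2 * (2 * \<theta> * (1 - 0)) < q" using big by simp
          show "2 * 0 - (q - 2 * (2 * \<theta> * (1 - 0))) / (2 - 2 * \<theta>) \<le> 2 * e"
            unfolding e using R1 True by (intro zero) (simp add: algebra_simps)
        qed auto
      next
        case small: False
        then have \<theta>0: "0 < \<theta>" using q by simp
        have R2: "\<rho>1 * (4 * \<theta>) < q"
          using \<rho>1[OF True] \<theta>0 unfolding rho_ok_iff[OF m0] q_def[symmetric] by (simp add: pos_less_divide_eq)
        have r1: "\<rho>1 \<le> 1"
        proof (rule ccontr)
          assume "\<not> \<rho>1 \<le> 1"
          then have "1 * (4 * \<theta>) \<le> \<rho>1 * (4 * \<theta>)" using \<theta>0 by (intro mult_right_mono) auto
          then show False using R2 small by linarith
        qed
        \<comment> \<open>The largest share of 1 + t, up to the maximal share 1, that the target (1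
          + t)^(1 - \<rho>1) tolerates. For \<open>\<rho>1\<close> >= 0 the requirement 4\<theta> (1
          - k) < q is then precisely the second strict bound on \<open>\<rho>1\<close>.\<close>
        define k where "k = min 1 (1 - \<rho>1)"
        have k: "0 \<le> k" "k \<le> 1" "k \<le> 1 - \<rho>1" using r1 by (auto simp: k_def)
        have kq: "2 * (2 * \<theta> * (1 - k)) < q"
          using R2 q \<theta>0 by (cases "0 \<le> \<rho>1") (simp_all add: k_def algebra_simps)
        show thesis
        proof (rule that[OF k(1,2)], unfold mm q_def[symmetric])
          show "2 * (2 * \<theta> * (1 - k)) < q" by (rule kq)
          \<comment> \<open>The remaining low frequency decay is simply discarded, since the growth
            (1 + t)^k already meets the target.\<close>
          have "0 \<le> (q - 2 * (2 * \<theta> * (1 - k))) / (2 - 2 * \<theta>)" using kq p by (intro divide_nonneg_pos) auto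
          then have "2 * k - (q - 2 * (2 * \<theta> * (1 - k))) / (2 - 2 * \<theta>) \<le> 2 * k - 0"
            by (rule diff_left_mono)
          also have "\<dots> = 2 * k" by simp
          also have "\<dots> \<le> 2 * e" unfolding e using k(3) by (intro mult_left_mono) auto
          finally show "2 * k - (q - 2 * (2 * \<theta> * (1 - k))) / (2 - 2 * \<theta>) \<le> 2 * e" .
        qed
      qed
    qed
  qed
qed

theorem theorem3p6:
  fixes a b \<theta> s m \<rho>0 \<rho>1 \<rho>s :: real
  assumes "0 < a\<^sup>2" "a\<^sup>2 < b\<^sup>2"
    and "0 \<le> \<theta>" "\<theta> \<le> 1" "0 \<le> s" "1 \<le> m" "m < 2"
    and "\<theta> < 1/2 \<Longrightarrow> rho_ok \<theta> m (-1) \<rho>0"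
    and "\<theta> < 1/2 \<Longrightarrow> rho_ok \<theta> m 0 \<rho>1"
    and "\<theta> < 1/2 \<Longrightarrow> rho_ok \<theta> m s \<rho>s"
  shows "\<exists>C. \<forall>(u :: real \<Rightarrow> real^3 \<Rightarrow> real^3) (v :: real \<Rightarrow> real^3 \<Rightarrow> real^3)
              (U :: real \<Rightarrow> real^3 \<Rightarrow> complex^3) (V :: real \<Rightarrow> real^3 \<Rightarrow> complex^3).
     ((\<forall>t\<ge>0. \<forall>k. is_FT (\<lambda>x. u t x $ k) (\<lambda>\<xi>. U t \<xi> $ k) \<and> is_FT (\<lambda>x. v t x $ k) (\<lambda>\<xi>. V t \<xi> $ k))
      \<and> (AE \<xi> in lborel. \<forall>t\<ge>0.
            ((\<lambda>\<tau>. U \<tau> \<xi>) has_vector_derivative V t \<xi>) (at t within {0..}) \<and>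
            ((\<lambda>\<tau>. V \<tau> \<xi>) has_vector_derivative lame_rhs a b \<theta> \<xi> (U t \<xi>) (V t \<xi>)) (at t within {0..}))
      \<and> (\<forall>k. memHdot (s + 1) (\<lambda>\<xi>. U 0 \<xi> $ k) \<and> memLp m (\<lambda>x. u 0 x $ k)
              \<and> memHdot s (\<lambda>\<xi>. V 0 \<xi> $ k) \<and> memLp m (\<lambda>x. v 0 x $ k)))
     \<longrightarrow> (\<forall>t\<ge>0. \<forall>k.
           memLp 2 (\<lambda>x. u t x $ k)
         \<and> Lp_norm 2 (\<lambda>x. u t x $ k)
             \<le> C * d0 \<theta> m \<rho>0 \<rho>1 t *
               (\<Sum>j\<in>UNIV. Hdot_norm 1 (\<lambda>\<xi>. U 0 \<xi> $ j) + Lp_norm m (\<lambda>x. u 0 x $ j)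
                          + Lp_norm 2 (\<lambda>x. v 0 x $ j) + Lp_norm m (\<lambda>x. v 0 x $ j))
         \<and> memHdot (s + 1) (\<lambda>\<xi>. U t \<xi> $ k) \<and> memHdot s (\<lambda>\<xi>. V t \<xi> $ k)
         \<and> Hdot_norm (s + 1) (\<lambda>\<xi>. U t \<xi> $ k) + Hdot_norm s (\<lambda>\<xi>. V t \<xi> $ k)
             \<le> C * dS \<theta> m s \<rho>s t *
               (\<Sum>j\<in>UNIV. Hdot_norm (s + 1) (\<lambda>\<xi>. U 0 \<xi> $ j) + Lp_norm m (\<lambda>x. u 0 x $ j)
                          + Hdot_norm s (\<lambda>\<xi>. V 0 \<xi> $ j) + Lp_norm m (\<lambda>x. v 0 x $ j)))"
proof -
  interpret lame_problem a b \<theta> s m using assms(1-7) by unfold_locales auto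
  have m0: "0 < m" using m by simp
  define e where "e = (if \<theta> < 1/2 then (if m < 6/5 then - \<rho>0 else 1 - \<rho>1)
      else (if m < 6/5 then - ((6 - 5*m) / (4*m*\<theta>)) else 1 - (6 - 3*m) / (4*m*\<theta>)))"
  have d0: "d0 \<theta> m \<rho>0 \<rho>1 t = (1 + t) powr e" for t by (simp add: d0_def e_def)
  obtain k where k: "0 \<le> k" "k \<le> 1" "2 * (min 1 (2 * \<theta>) * (1 - k)) < 6 / m - 3"
    "2 * k - (6 / m - 3 - 2 * (min 1 (2 * \<theta>) * (1 - k))) / max (2 * \<theta>) (2 - 2 * \<theta>) \<le> 2 * e"
    using displacement_exponent[OF \<theta> m assms(8,9)] unfolding e_def by blast
  obtain C1 where C1: "0 < C1" "\<forall>u v U V t k. solution u v U V \<longrightarrow> 0 \<le> t \<longrightarrow>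
    nn_integral_bounded (\<lambda>\<xi>. (cmod (U t \<xi> $ k))\<^sup>2) (C1 * (1 + t) powr (2 * e) *
      (\<Sum>j\<in>UNIV. Hdot_norm 1 (\<lambda>\<xi>. U 0 \<xi> $ j) + Lp_norm m (\<lambda>x. u 0 x $ j)
        + Lp_norm 2 (\<lambda>x. v 0 x $ j) + Lp_norm m (\<lambda>x. v 0 x $ j))\<^sup>2)"
    using displacement_bound[OF k] by blast
  define f where "f = (if \<theta> < 1/2 then - \<rho>s else - ((6 - 3*m + 2 * s * m) / (4*m*\<theta>)))"
  have dS: "dS \<theta> m s \<rho>s t = (1 + t) powr f" for t by (simp add: dS_def f_def)
  have f1: "- (2 * s + (6 / m - 3)) / (2 * \<theta>) \<le> 2 * f" if "1 / 2 \<le> \<theta>"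
    using exponent_ratio[OF m0, of s 0 \<theta>] that by (simp add: f_def field_simps)
  have f2: "- (2 * (s + (1 - 2 * \<theta>)) + (6 / m - 3)) / (2 - 2 * \<theta>) \<le> 2 * f" if "\<theta> < 1 / 2"
  proof -
    have "\<rho>s * (4 * (1 - \<theta>)) < 6 / m - 3 + 2 * s + 2 * (1 - 2 * \<theta>)"
      using assms(10)[OF that] that unfolding rho_ok_iff[OF m0] by (simp add: pos_less_divide_eq)
    moreover have "2 * f * (2 - 2 * \<theta>) = - (\<rho>s * (4 * (1 - \<theta>)))" using that by (simp add: f_def algebra_simps)
    ultimately have "- (2 * (s + (1 - 2 * \<theta>)) + (6 / m - 3)) \<le> 2 * f * (2 - 2 * \<theta>)" by (simp add: distrib_left)
    then show ?thesis using that by (simp only: pos_divide_le_eq)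
  qed
  have f3: "\<theta> = 0 \<or> - (2 * s + (6 / m - 3)) / (2 * \<theta>) \<le> 2 * f" if "\<theta> < 1 / 2"
  proof (cases "\<theta> = 0")
    case False
    then have \<theta>0: "0 < 2 * \<theta>" using \<theta> by simp
    have "\<rho>s * (4 * \<theta>) < 6 / m - 3 + 2 * s"
      using assms(10)[OF that] False \<theta>0 unfolding rho_ok_iff[OF m0] by (simp add: pos_less_divide_eq)
    moreover have "2 * f * (2 * \<theta>) = - (\<rho>s * (4 * \<theta>))" using that by (simp add: f_def)
    ultimately have "- (2 * s + (6 / m - 3)) \<le> 2 * f * (2 * \<theta>)" by linarith
    then have "- (2 * s + (6 / m - 3)) / (2 * \<theta>) \<le> 2 * f" using \<theta>0 by (simp only: pos_divide_le_eq)
    then show ?thesis ..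
  qed simp
  obtain C2 where C2: "0 < C2" "\<forall>u v U V t k. solution u v U V \<longrightarrow> 0 \<le> t \<longrightarrow>
    nn_integral_bounded (\<lambda>\<xi>. norm \<xi> powr (2 * (s + 1)) * (cmod (U t \<xi> $ k))\<^sup>2 + norm \<xi> powr (2 * s) * (cmod (V t \<xi> $ k))\<^sup>2)
      (C2 * (1 + t) powr (2 * f) * (\<Sum>j\<in>UNIV. Hdot_norm (s + 1) (\<lambda>\<xi>. U 0 \<xi> $ j) + Lp_norm m (\<lambda>x. u 0 x $ j)
        + Hdot_norm s (\<lambda>\<xi>. V 0 \<xi> $ j) + Lp_norm m (\<lambda>x. v 0 x $ j))\<^sup>2)"
    using energy_bound[OF f1 f2 f3] by blast
  \<comment> \<open>Square roots, since the integrals bound squares of norms. \<open>A\<close>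
    includes the cost of returning from frequency to physical space; \<open>B\<close> is counted
    twice in the final constant because the two homogeneous norms are bounded separately.\<close>
  define A B where "A = sqrt (HY_const * C1)" and "B = sqrt C2"
  have A: "0 \<le> A" "A\<^sup>2 = HY_const * C1" and B: "0 \<le> B" "B\<^sup>2 = C2"
    using C1(1) C2(1) HY_const_pos by (auto simp: A_def B_def)
  have main: "memLp 2 (\<lambda>x. u t x $ k)
         \<and> Lp_norm 2 (\<lambda>x. u t x $ k)
             \<le> (A + 2 * B) * d0 \<theta> m \<rho>0 \<rho>1 t *
               (\<Sum>j\<in>UNIV. Hdot_norm 1 (\<lambda>\<xi>. U 0 \<xi> $ j) + Lp_norm m (\<lambda>x. u 0 x $ j)
                          + Lp_norm 2 (\<lambda>x. v 0 x $ j) + Lp_norm m (\<lambda>x. v 0 x $ j))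
         \<and> memHdot (s + 1) (\<lambda>\<xi>. U t \<xi> $ k) \<and> memHdot s (\<lambda>\<xi>. V t \<xi> $ k)
         \<and> Hdot_norm (s + 1) (\<lambda>\<xi>. U t \<xi> $ k) + Hdot_norm s (\<lambda>\<xi>. V t \<xi> $ k)
             \<le> (A + 2 * B) * dS \<theta> m s \<rho>s t *
               (\<Sum>j\<in>UNIV. Hdot_norm (s + 1) (\<lambda>\<xi>. U 0 \<xi> $ j) + Lp_norm m (\<lambda>x. u 0 x $ j)
                          + Hdot_norm s (\<lambda>\<xi>. V 0 \<xi> $ j) + Lp_norm m (\<lambda>x. v 0 x $ j))"
    if sol: "solution u v U V" and t: "0 \<le> t" for u v U V t k
  proof -
    note S = solutionD[OF sol]
    have dbl: "(1 + t) powr (2 * x) = ((1 + t) powr x)\<^sup>2" for x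
      using t by (simp add: powr_power mult.commute)
    define D where "D = (\<Sum>j\<in>UNIV. Hdot_norm 1 (\<lambda>\<xi>. U 0 \<xi> $ j) + Lp_norm m (\<lambda>x. u 0 x $ j)
                          + Lp_norm 2 (\<lambda>x. v 0 x $ j) + Lp_norm m (\<lambda>x. v 0 x $ j))"
    define D' where "D' = (\<Sum>j\<in>UNIV. Hdot_norm (s + 1) (\<lambda>\<xi>. U 0 \<xi> $ j) + Lp_norm m (\<lambda>x. u 0 x $ j)
                          + Hdot_norm s (\<lambda>\<xi>. V 0 \<xi> $ j) + Lp_norm m (\<lambda>x. v 0 x $ j))"
    have D: "0 \<le> D" "0 \<le> D'"
      unfolding D_def D'_def by (intro sum_nonneg add_nonneg_nonneg Lp_norm_nonneg Hdot_norm_nonneg)+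
    have FTu: "is_FT (\<lambda>x. u t x $ k) (\<lambda>\<xi>. U t \<xi> $ k)" and FTv: "is_FT (\<lambda>x. v t x $ k) (\<lambda>\<xi>. V t \<xi> $ k)"
      by (rule S(1)[OF t], rule S(2)[OF t])
    note meas = is_FT_measurable(1)[OF FTu] is_FT_measurable(1)[OF FTv]
    have I: "integrable lborel (\<lambda>\<xi>. (cmod (U t \<xi> $ k))\<^sup>2)"
      "(\<integral>\<xi>. (cmod (U t \<xi> $ k))\<^sup>2 \<partial>lborel) \<le> C1 * ((1 + t) powr e)\<^sup>2 * D\<^sup>2"
      using nn_integral_bounded_integrable[OF C1(2)[rule_format, OF sol t, of k]] unfolding D_def dbl by auto
    have "nn_integral_bounded (\<lambda>x. (u t x $ k)\<^sup>2) ((A * (1 + t) powr e * D)\<^sup>2)"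
    proof -
      have "(\<integral>\<^sup>+x. ennreal ((u t x $ k)\<^sup>2) \<partial>lborel) \<le> ennreal (HY_const * (\<integral>\<xi>. (cmod (U t \<xi> $ k))\<^sup>2 \<partial>lborel))"
        by (rule is_FT_L2_inverse_bound[OF FTu I(1)])
      also have "\<dots> \<le> ennreal (HY_const * (C1 * ((1 + t) powr e)\<^sup>2 * D\<^sup>2))"
        using HY_const_pos by (intro ennreal_leI mult_left_mono I(2)) auto
      also have "HY_const * (C1 * ((1 + t) powr e)\<^sup>2 * D\<^sup>2) = (A * (1 + t) powr e * D)\<^sup>2"
        by (simp add: power_mult_distrib A mult_ac)
      finally show ?thesis
        using is_FT_measurable(2)[OF FTu] by (auto simp: nn_integral_bounded_def)
    qed
    then have u: "memLp 2 (\<lambda>x. u t x $ k)" "Lp_norm 2 (\<lambda>x. u t x $ k) \<le> A * (1 + t) powr e * D"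
      using memLp2_of_bounded[of "\<lambda>x. u t x $ k"] A D is_FT_measurable(2)[OF FTu] by auto
    have Eb: "nn_integral_bounded (\<lambda>\<xi>. norm \<xi> powr (2 * (s + 1)) * (cmod (U t \<xi> $ k))\<^sup>2 + norm \<xi> powr (2 * s) * (cmod (V t \<xi> $ k))\<^sup>2)
        ((B * (1 + t) powr f * D')\<^sup>2)"
      using C2(2)[rule_format, OF sol t, of k] unfolding dbl D'_def[symmetric] by (simp add: power_mult_distrib B)
    have BD: "0 \<le> B * (1 + t) powr f * D'" using B D by simp
    have "nn_integral_bounded (\<lambda>\<xi>. norm \<xi> powr (2 * (s + 1)) * (cmod (U t \<xi> $ k))\<^sup>2) ((B * (1 + t) powr f * D')\<^sup>2)"
      by (rule nn_integral_bounded_mono[OF Eb]) (use meas in auto)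
    note U = memHdot_of_bounded[OF this BD]
    have "nn_integral_bounded (\<lambda>\<xi>. norm \<xi> powr (2 * s) * (cmod (V t \<xi> $ k))\<^sup>2) ((B * (1 + t) powr f * D')\<^sup>2)"
      by (rule nn_integral_bounded_mono[OF Eb]) (use meas in auto)
    note V = memHdot_of_bounded[OF this BD]
    have "A * (1 + t) powr e * D \<le> (A + 2 * B) * (1 + t) powr e * D"
      using A B D by (intro mult_right_mono) auto
    moreover have "(2 * B) * (1 + t) powr f * D' \<le> (A + 2 * B) * (1 + t) powr f * D'"
      using A B D by (intro mult_right_mono) auto
    ultimately show ?thesis
      using u U V unfolding d0 dS D_def[symmetric] D'_def[symmetric] by simp
  qed
  show ?thesis
    by (intro exI[of _ "A + 2 * B"] allI impI) (rule main, unfold solution_def)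
qed

end
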